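(* Let $\psi$ solve $\square_g\psi=0$ on the expanding region $\mathcal{R}^+$ of Schwarzschild–de Sitter, let $r_0>r_{\mathcal{C}}$, and let $X=r\phi^{-2}\partial_r$, $Y=r\phi^{-1}\partial_r$. Then for all $r_2>r_1\ge r_0$, $$E[Y(X\psi)](r_2)+E[X\psi](r_2)+E[\psi](r_2)\lesssim_{\Lambda,m,r_0}E[Y(X\psi)](r_1)+E[X\psi](r_1)+E[\psi](r_1).$$
   Context: Fix $\Lambda>0$, $0<3m<1/\sqrt\Lambda$; $D(r)=\frac{\Lambda}{3}r^2-1+\frac{2m}{r}$, $r_{\mathcal{C}}$ its largest positive root; $\mathcal{R}^+=(r_{\mathcal{C}},\infty)_r\times\mathbb{R}_t\times\mathbb{S}^2$ with $g=-D^{-1}dr^2+Ddt^2+r^2\gamma_{\mathbb{S}^2}$; lapse $\phi=D^{-1/2}$; $\square_g\psi=\phi^2\partial_t^2\psi-r^{-2}\partial_r(r^2\phi^{-2}\partial_r\psi)+r^{-2}\Delta_{\mathbb{S}^2}\psi$. For a function $\varphi$, $E[\varphi](r)$ denotes the $\partial_r$-energy flux through $\Sigma_r=\{r=\text{const}\}$: $E[\varphi](r)=\frac12\int_{\mathbb{R}\times\mathbb{S}^2}\big(r^2\phi^{-2}(\partial_r\varphi)^2+r^2\phi^2(\partial_t\varphi)^2+|\nabla_{\mathbb{S}^2}\varphi|_\gamma^2\big)dt\,d\mu_\gamma$. *)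

theory Defs
  imports "HOL-Analysis.Analysis"
begin

definition SdS_D :: "real \<Rightarrow> real \<Rightarrow> real \<Rightarrow> real" where
  "SdS_D \<Lambda> m r = \<Lambda> / 3 * r\<^sup>2 - 1 + 2 * m / r"

definition SdS_rC :: "real \<Rightarrow> real \<Rightarrow> real" where
  "SdS_rC \<Lambda> m = (GREATEST r. r > 0 \<and> SdS_D \<Lambda> m r = 0)"

definition pdiff :: "'a::real_normed_vector \<Rightarrow> ('a \<Rightarrow> real) \<Rightarrow> 'a \<Rightarrow> real" where
  "pdiff v f p = deriv (\<lambda>s. f (p + s *\<^sub>R v)) 0"

definition smooth_on :: "'a::euclidean_space set \<Rightarrow> ('a \<Rightarrow> real) \<Rightarrow> bool" where
  "smooth_on U f \<longleftrightarrow> open U \<and>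
     (\<forall>vs. set vs \<subseteq> Basis \<longrightarrow>
        continuous_on U (fold pdiff vs f) \<and>
        (\<forall>p\<in>U. \<forall>v\<in>Basis. (\<lambda>s. fold pdiff vs f (p + s *\<^sub>R v)) differentiable (at 0)))"

text \<open>A function on R^+ is given as psi r t omega, omega a unit vector of R^3 (a point of S^2);
  its values off the sphere are irrelevant.  lift psi is its extension to
  (r,t,x), x in R^3 - {0}, constant along rays: lift psi (r,t,x) = psi r t (x/|x|).\<close>
type_synonym sfun = "real \<Rightarrow> real \<Rightarrow> real^3 \<Rightarrow> real"

definition lift :: "sfun \<Rightarrow> real \<times> real \<times> (real^3) \<Rightarrow> real" where
  "lift \<psi> = (\<lambda>(r, t, x). \<psi> r t (x /\<^sub>R norm x))"

definition region :: "real \<Rightarrow> real \<Rightarrow> (real \<times> real \<times> (real^3)) set" where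
  "region \<Lambda> m = {(r, t, x). r > SdS_rC \<Lambda> m \<and> x \<noteq> 0}"

definition d_r :: "sfun \<Rightarrow> sfun" where
  "d_r \<psi> r t \<omega> = deriv (\<lambda>s. \<psi> s t \<omega>) r"

definition d_t :: "sfun \<Rightarrow> sfun" where
  "d_t \<psi> r t \<omega> = deriv (\<lambda>s. \<psi> r s \<omega>) t"

text \<open>Angular derivatives: the gradient of the ray-constant extension at a unit vector omega
  is tangent to the sphere and equals the spherical gradient; the Euclidean Laplacian of the
  ray-constant extension at omega equals the spherical Laplacian.\<close>
definition d_ang :: "sfun \<Rightarrow> 3 \<Rightarrow> sfun" where
  "d_ang \<psi> i r t \<omega> = deriv (\<lambda>s. lift \<psi> (r, t, \<omega> + s *\<^sub>R axis i 1)) 0"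

definition grad_S2_sq :: "sfun \<Rightarrow> sfun" where
  "grad_S2_sq \<psi> r t \<omega> = (\<Sum>i\<in>UNIV. (d_ang \<psi> i r t \<omega>)\<^sup>2)"

definition lap_S2 :: "sfun \<Rightarrow> sfun" where
  "lap_S2 \<psi> r t \<omega> =
     (\<Sum>i\<in>UNIV. deriv (\<lambda>s. d_ang \<psi> i r t (\<omega> + s *\<^sub>R axis i 1)) 0)"

text \<open>Wave operator, with phi = D^(-1/2) (so phi^2 = 1/D, phi^(-2) = D).\<close>
definition wave_op :: "real \<Rightarrow> real \<Rightarrow> sfun \<Rightarrow> sfun" where
  "wave_op \<Lambda> m \<psi> r t \<omega> =
     (1 / SdS_D \<Lambda> m r) * d_t (d_t \<psi>) r t \<omega>
     - (1 / r\<^sup>2) * deriv (\<lambda>s. s\<^sup>2 * SdS_D \<Lambda> m s * d_r \<psi> s t \<omega>) r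
     + (1 / r\<^sup>2) * lap_S2 \<psi> r t \<omega>"

definition Xop :: "real \<Rightarrow> real \<Rightarrow> sfun \<Rightarrow> sfun" where
  "Xop \<Lambda> m \<psi> r t \<omega> = r * SdS_D \<Lambda> m r * d_r \<psi> r t \<omega>"

definition Yop :: "real \<Rightarrow> real \<Rightarrow> sfun \<Rightarrow> sfun" where
  "Yop \<Lambda> m \<psi> r t \<omega> = r * sqrt (SdS_D \<Lambda> m r) * d_r \<psi> r t \<omega>"

definition edens :: "real \<Rightarrow> real \<Rightarrow> sfun \<Rightarrow> sfun" where
  "edens \<Lambda> m \<psi> r t \<omega> =
     r\<^sup>2 * SdS_D \<Lambda> m r * (d_r \<psi> r t \<omega>)\<^sup>2
     + r\<^sup>2 * (1 / SdS_D \<Lambda> m r) * (d_t \<psi> r t \<omega>)\<^sup>2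
     + grad_S2_sq \<psi> r t \<omega>"

text \<open>Integral over S^2 w.r.t. the round measure, via polar coordinates:
  int_{S^2} g dmu = 3 * int_{|x|<1} g(x/|x|) dx.\<close>
definition S2_integral :: "(real^3 \<Rightarrow> ennreal) \<Rightarrow> ennreal" where
  "S2_integral g = 3 * (\<integral>\<^sup>+ x. indicator (ball 0 1) x * g (x /\<^sub>R norm x) \<partial>lborel)"

definition energy :: "real \<Rightarrow> real \<Rightarrow> sfun \<Rightarrow> real \<Rightarrow> ennreal" where
  "energy \<Lambda> m \<psi> r =
     ennreal (1/2) * (\<integral>\<^sup>+ t. S2_integral (\<lambda>\<omega>. ennreal (edens \<Lambda> m \<psi> r t \<omega>)) \<partial>lborel)"

end

theory Submission
  imports Defs
begin

text \<open>
  Put \<open>\<sigma> = r / sqrt D\<close>, \<open>\<iota> = 1/r\<close>, \<open>q = 2 - 6m/r\<close>, so that \<open>\<partial>\<^sub>r = \<sigma> \<iota>\<^sup>2 Y\<close>, and write \<open>u = X \<psi>\<close>, \<open>v = Y u\<close>, \<open>w = Y v\<close>.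
  With \<open>\<Delta>\<close> the spherical Laplacian the wave equation reads \<open>\<Delta> \<psi> = u + \<sigma> \<iota> v - \<sigma>\<^sup>2 \<psi>\<^sub>t\<^sub>t\<close>. Applying \<open>Y\<close>
  to it once and twice yields wave equations for \<open>u\<close> and \<open>v\<close> in which \<open>\<Delta> \<psi>\<close> and \<open>\<Delta> u\<close> have been
  eliminated, so that the only non-perturbative sources are bounded multiples of \<open>\<psi>\<^sub>t\<^sub>t\<close> and \<open>u\<^sub>t\<^sub>t\<close>.
  Tested against \<open>v\<close> and \<open>w\<close>, these are absorbed, by integrating by parts in \<open>t\<close> and then in \<open>r\<close>, into
  cross terms \<open>u\<^sub>t \<psi>\<^sub>t\<close>, \<open>v\<^sub>t u\<^sub>t\<close>, \<open>v\<^sub>t \<psi>\<^sub>t\<close> added to the energy density. The modified density \<open>G\<close> is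
  comparable to the sum of the three densities and satisfies \<open>\<partial>\<^sub>r G \<le> \<partial>\<^sub>t \<Phi> + div J + C r\<^sup>-\<^sup>2 G\<close> with
  \<open>|\<Phi>| \<le> C r\<^sup>-\<^sup>2 G\<close>. As \<open>r\<^sup>-\<^sup>2\<close> is integrable, Gronwall's inequality (integrating factor \<open>exp (C/r)\<close>) concludes; finite propagation speed
  is used through a weight supported in a truncated cone, so that no decay in \<open>t\<close> is needed.
\<close>

subsection \<open>Smooth functions\<close>

text \<open>As \<open>D\<close> grows like \<open>r^2\<close>, \<open>sg\<close> stays between
  positive constants and every r-derivative of an energy carries a factor of size
  \<open>r^-2\<close>. The obstacle is the count of derivatives. Commuting leaves second angular
  derivatives in the sources; the wave equation trades them for second time derivatives, but
  \<open>\<psi>_tt\<close> and \<open>u_tt\<close> are still one order too high for energies of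
  first order. Subtracting a cross term cancels such a source exactly and leaves only products of
  first derivatives; the new ones, such as \<open>v_t\<close> times the t-derivative of
  \<open>Y \<psi>\<close>, are harmless because \<open>Y \<psi> = sg * io * u\<close>. Cross terms
  are indefinite, so the energies of lower level enter \<open>G\<close> with large weights
  \<open>K1\<close>, \<open>K0\<close>. One source is not bounded by the energies: the equation for
  \<psi> contains \<open>u = z / (sg * io)\<close>, larger than \<open>z = Y \<psi>\<close> by a
  factor of order \<open>r\<close>. Its sign is favourable, an effect of the expansion. Functions on
  the sphere are replaced by functions on the punctured ball that are constant along rays, so that
  integration by parts takes place in a flat space, with cutoffs whose gradients are normal to the
  spheres.\<close>

primrec Ck_on :: "nat \<Rightarrow> 'a::euclidean_space set \<Rightarrow> ('a \<Rightarrow> real) \<Rightarrow> bool" where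
  "Ck_on 0 U f \<longleftrightarrow> continuous_on U f"
| "Ck_on (Suc k) U f \<longleftrightarrow> continuous_on U f \<and>
     (\<forall>v\<in>Basis. (\<forall>p\<in>U. (\<lambda>s. f (p + s *\<^sub>R v)) differentiable (at 0)) \<and> Ck_on k U (pdiff v f))"

lemma smooth_on_unfold:
  "smooth_on U f \<longleftrightarrow> open U \<and> continuous_on U f \<and>
     (\<forall>v\<in>Basis. (\<forall>p\<in>U. (\<lambda>s. f (p + s *\<^sub>R v)) differentiable (at 0)) \<and> smooth_on U (pdiff v f))"
  (is "?L \<longleftrightarrow> ?R")
proof
  assume L: ?L
  have o: "open U" and L': "\<And>vs. set vs \<subseteq> Basis \<Longrightarrow> continuous_on U (fold pdiff vs f) \<and>
        (\<forall>p\<in>U. \<forall>v\<in>Basis. (\<lambda>s. fold pdiff vs f (p + s *\<^sub>R v)) differentiable (at 0))"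
    using L unfolding smooth_on_def by blast+
  have "smooth_on U (pdiff v f)" if "v \<in> Basis" for v
    unfolding smooth_on_def using o L'[of "v # vs" for vs] that by auto
  then show ?R using o L'[of "[]"] by auto
next
  assume R: ?R
  have "continuous_on U (fold pdiff vs f) \<and>
        (\<forall>p\<in>U. \<forall>v\<in>Basis. (\<lambda>s. fold pdiff vs f (p + s *\<^sub>R v)) differentiable (at 0))"
    if "set vs \<subseteq> Basis" for vs
  proof (cases vs)
    case Nil
    then show ?thesis using R by auto
  next
    case (Cons w ws)
    then have "smooth_on U (pdiff w f)" "set ws \<subseteq> Basis" using R that by auto
    then show ?thesis unfolding smooth_on_def Cons by auto
  qed
  then show ?L using R unfolding smooth_on_def by blast
qed

lemma Ck_on_if_smooth_on: "smooth_on U f \<Longrightarrow> Ck_on k U f"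
proof (induction k arbitrary: f)
  case 0
  then show ?case using smooth_on_unfold[of U f] by simp
next
  case (Suc k)
  then show ?case using smooth_on_unfold[of U f] by auto
qed

lemma Ck_on_fold_pdiff:
  "Ck_on (length vs + Suc k) U f \<Longrightarrow> set vs \<subseteq> Basis \<Longrightarrow> Ck_on (Suc k) U (fold pdiff vs f)"
proof (induction vs arbitrary: f)
  case (Cons w ws)
  then show ?case by simp
qed simp

text \<open>Closure under products is an induction on the order of differentiability with
  \<open>f\<close> and \<open>g\<close> arbitrary. The definition by lists of directions offers no
  such induction, because one derivative turns a product into a sum of products.\<close>

lemma smooth_on_iff_Ck_on: "smooth_on U f \<longleftrightarrow> open U \<and> (\<forall>k. Ck_on k U f)"
proof
  assume R: "open U \<and> (\<forall>k. Ck_on k U f)"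
  show "smooth_on U f"
    unfolding smooth_on_def
  proof (intro conjI allI impI)
    show "open U" using R by simp
    fix vs :: "'a list" assume vs: "set vs \<subseteq> Basis"
    have "Ck_on (Suc 0) U (fold pdiff vs f)" by (rule Ck_on_fold_pdiff) (use R vs in auto)
    then show "continuous_on U (fold pdiff vs f)"
      "\<forall>p\<in>U. \<forall>v\<in>Basis. (\<lambda>s. fold pdiff vs f (p + s *\<^sub>R v)) differentiable (at 0)" by auto
  qed
qed (use Ck_on_if_smooth_on smooth_on_unfold in blast)

lemma eventually_line_in_open:
  fixes p v :: "'a::real_normed_vector"
  assumes "open U" "p \<in> U"
  shows "eventually (\<lambda>s. p + s *\<^sub>R v \<in> U) (nhds (0::real))"
proof -
  have "isCont (\<lambda>s::real. p + s *\<^sub>R v) 0" by (intro continuous_intros)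
  then have "((\<lambda>s::real. p + s *\<^sub>R v) \<longlongrightarrow> p + 0 *\<^sub>R v) (nhds 0)"
    unfolding continuous_at by (subst (asm) tendsto_at_iff_tendsto_nhds)
  then show ?thesis using assms by (auto dest: topological_tendstoD)
qed

lemma has_pdiff_cong:
  fixes f g :: "'a::real_normed_vector \<Rightarrow> real"
  assumes "open U" "p \<in> U" "\<And>q. q \<in> U \<Longrightarrow> f q = g q"
  shows "((\<lambda>s. f (p + s *\<^sub>R v)) has_real_derivative d) (at 0) \<longleftrightarrow>
         ((\<lambda>s. g (p + s *\<^sub>R v)) has_real_derivative d) (at 0)"
proof (rule DERIV_cong_ev)
  show "eventually (\<lambda>s. f (p + s *\<^sub>R v) = g (p + s *\<^sub>R v)) (nhds 0)"
    using eventually_line_in_open[OF assms(1,2)] by (rule eventually_mono) (rule assms(3))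
qed simp_all

lemma pdiff_cong:
  fixes f g :: "'a::real_normed_vector \<Rightarrow> real"
  assumes "open U" "p \<in> U" "\<And>q. q \<in> U \<Longrightarrow> f q = g q"
  shows "pdiff v f p = pdiff v g p"
  unfolding pdiff_def deriv_def by (simp only: has_pdiff_cong[where f=f and g=g, OF assms])

lemma real_differentiable_iff:
  "f differentiable (at (x::real)) \<longleftrightarrow> (\<exists>D. (f has_real_derivative D) (at x))"
  by (simp add: real_differentiable_def)

lemma Ck_on_cong:
  assumes "open U"
  shows "(\<And>q. q \<in> U \<Longrightarrow> f q = g q) \<Longrightarrow> Ck_on k U f \<Longrightarrow> Ck_on k U g"
proof (induction k arbitrary: f g)
  case 0
  then show ?case by (simp cong: continuous_on_cong)
next
  case (Suc k)
  have "continuous_on U f" using Suc.prems(2) by simp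
  then have "continuous_on U g" using Suc.prems(1) by (simp cong: continuous_on_cong)
  moreover have "(\<lambda>s. g (p + s *\<^sub>R v)) differentiable (at 0)" if "p \<in> U" "v \<in> Basis" for p v
  proof -
    have "(\<lambda>s. f (p + s *\<^sub>R v)) differentiable (at 0)" using Suc.prems(2) that by simp
    then show ?thesis
      unfolding real_differentiable_iff
      using has_pdiff_cong[where f=f and g=g, OF assms that(1) Suc.prems(1)] by auto
  qed
  moreover have "Ck_on k U (pdiff v g)" if "v \<in> Basis" for v
  proof (rule Suc.IH[of "pdiff v f"])
    show "pdiff v f q = pdiff v g q" if "q \<in> U" for q
      by (rule pdiff_cong[OF assms that Suc.prems(1)])
    show "Ck_on k U (pdiff v f)" using Suc.prems(2) that by simp
  qed
  ultimately show ?case by simp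
qed

lemma smooth_on_cong:
  "smooth_on U f \<Longrightarrow> (\<And>q. q \<in> U \<Longrightarrow> f q = g q) \<Longrightarrow> smooth_on U g"
  unfolding smooth_on_iff_Ck_on by (auto intro: Ck_on_cong[where f=f])

lemma smooth_on_open: "smooth_on U f \<Longrightarrow> open U"
  by (simp add: smooth_on_def)

lemma smooth_on_continuous: "smooth_on U f \<Longrightarrow> continuous_on U f"
  using smooth_on_unfold[of U f] by simp

lemma smooth_on_pdiff: "smooth_on U f \<Longrightarrow> v \<in> Basis \<Longrightarrow> smooth_on U (pdiff v f)"
  using smooth_on_unfold[of U f] by simp

lemma differentiable_has_pdiff:
  assumes "(\<lambda>s. f (p + s *\<^sub>R v)) differentiable (at (0::real))"
  shows "((\<lambda>s. f (p + s *\<^sub>R v)) has_real_derivative pdiff v f p) (at 0)"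
proof -
  obtain D where D: "((\<lambda>s. f (p + s *\<^sub>R v)) has_real_derivative D) (at 0)"
    using assms unfolding real_differentiable_iff ..
  then show ?thesis using DERIV_imp_deriv[OF D] by (simp add: pdiff_def)
qed

lemma smooth_on_has_pdiff:
  assumes "smooth_on U f" "p \<in> U" "v \<in> Basis"
  shows "((\<lambda>s. f (p + s *\<^sub>R v)) has_real_derivative pdiff v f p) (at 0)"
  by (rule differentiable_has_pdiff) (use assms smooth_on_unfold[of U f] in simp)

lemma smooth_on_has_pdiff_line:
  assumes "smooth_on U f" "p + a *\<^sub>R v \<in> U" "v \<in> Basis"
  shows "((\<lambda>s. f (p + s *\<^sub>R v)) has_real_derivative pdiff v f (p + a *\<^sub>R v)) (at a)"
proof -
  have "((\<lambda>s. f ((p + a *\<^sub>R v) + s *\<^sub>R v)) has_real_derivative pdiff v f (p + a *\<^sub>R v)) (at 0)"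
    by (rule smooth_on_has_pdiff[OF assms])
  moreover have "(p + a *\<^sub>R v) + s *\<^sub>R v = p + (s + a) *\<^sub>R v" for s
    by (simp add: scaleR_left_distrib)
  ultimately have "((\<lambda>s. f (p + (s + a) *\<^sub>R v)) has_real_derivative pdiff v f (p + a *\<^sub>R v)) (at 0)"
    by simp
  then show ?thesis
    using DERIV_shift[of "\<lambda>s. f (p + s *\<^sub>R v)" "pdiff v f (p + a *\<^sub>R v)" 0 a] by simp
qed

lemma Ck_on_pred: "Ck_on (Suc k) U f \<Longrightarrow> Ck_on k U f"
proof (induction k arbitrary: f)
  case (Suc k)
  have "Ck_on (Suc k) U (pdiff v f)" if "v \<in> Basis" for v
    using Suc.prems that by (subst (asm) Ck_on.simps(2)) blast
  then have "Ck_on k U (pdiff v f)" if "v \<in> Basis" for v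
    using Suc.IH that by blast
  moreover have "continuous_on U f" "\<forall>v\<in>Basis. \<forall>p\<in>U. (\<lambda>s. f (p + s *\<^sub>R v)) differentiable (at 0)"
    using Suc.prems by (subst (asm) Ck_on.simps(2); blast)+
  ultimately show ?case unfolding Ck_on.simps(2) by blast
qed simp

text \<open>The derivative is supplied in closed form \<open>g v\<close> and has to agree with
  \<open>pdiff v f\<close> on \<open>U\<close> only; off \<open>U\<close> the value of
  \<open>pdiff\<close> is arbitrary.\<close>

lemma Ck_on_SucI:
  assumes "open U" "continuous_on U f"
    and "\<And>v p. v \<in> Basis \<Longrightarrow> p \<in> U \<Longrightarrow> ((\<lambda>s. f (p + s *\<^sub>R v)) has_real_derivative g v p) (at 0)"
    and "\<And>v. v \<in> Basis \<Longrightarrow> Ck_on k U (g v)"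
  shows "Ck_on (Suc k) U f"
proof -
  have "Ck_on k U (pdiff v f)" if "v \<in> Basis" for v
  proof (rule Ck_on_cong[OF assms(1) _ assms(4)[OF that]])
    show "g v q = pdiff v f q" if "q \<in> U" for q
      using DERIV_imp_deriv[OF assms(3)[OF \<open>v \<in> Basis\<close> that]] by (simp add: pdiff_def)
  qed
  moreover have "(\<lambda>s. f (p + s *\<^sub>R v)) differentiable (at 0)" if "p \<in> U" "v \<in> Basis" for p v
    using assms(3) that unfolding real_differentiable_iff by blast
  ultimately show ?thesis using assms(2) by simp
qed

lemma Ck_on_has_pdiff:
  assumes "Ck_on (Suc k) U f" "p \<in> U" "v \<in> Basis"
  shows "((\<lambda>s. f (p + s *\<^sub>R v)) has_real_derivative pdiff v f p) (at 0)"
  by (rule differentiable_has_pdiff) (use assms in simp)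

lemma Ck_on_continuous: "Ck_on k U f \<Longrightarrow> continuous_on U f"
  by (cases k) auto

lemma Ck_on_const: "Ck_on k (U :: 'a::euclidean_space set) (\<lambda>_. c)"
proof (induction k arbitrary: c)
  case (Suc k)
  have "pdiff v (\<lambda>_. c) = (\<lambda>_ :: 'a. 0)" for v by (simp add: pdiff_def fun_eq_iff)
  then show ?case using Suc by simp
qed simp

lemma Ck_on_add:
  assumes "open U"
  shows "Ck_on k U f \<Longrightarrow> Ck_on k U g \<Longrightarrow> Ck_on k U (\<lambda>p. f p + g p)"
proof (induction k arbitrary: f g)
  case 0
  then show ?case by (simp add: continuous_on_add)
next
  case (Suc k)
  show ?case
  proof (rule Ck_on_SucI[where g="\<lambda>v p. pdiff v f p + pdiff v g p", OF assms])
    show "continuous_on U (\<lambda>p. f p + g p)" using Suc.prems by (simp add: continuous_on_add)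
    show "((\<lambda>s. f (p + s *\<^sub>R v) + g (p + s *\<^sub>R v)) has_real_derivative pdiff v f p + pdiff v g p) (at 0)"
      if "v \<in> Basis" "p \<in> U" for v p
      using Ck_on_has_pdiff[OF Suc.prems(1) that(2,1)] Ck_on_has_pdiff[OF Suc.prems(2) that(2,1)]
      by (rule DERIV_add)
    show "Ck_on k U (\<lambda>p. pdiff v f p + pdiff v g p)" if "v \<in> Basis" for v
      using Suc that by simp
  qed
qed

lemma Ck_on_mult:
  assumes "open U"
  shows "Ck_on k U f \<Longrightarrow> Ck_on k U g \<Longrightarrow> Ck_on k U (\<lambda>p. f p * g p)"
proof (induction k arbitrary: f g)
  case 0
  then show ?case by (simp add: continuous_on_mult)
next
  case (Suc k)
  show ?case
  proof (rule Ck_on_SucI[where g="\<lambda>v p. pdiff v f p * g p + pdiff v g p * f p", OF assms])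
    show "continuous_on U (\<lambda>p. f p * g p)" using Suc.prems by (simp add: continuous_on_mult)
    show "((\<lambda>s. f (p + s *\<^sub>R v) * g (p + s *\<^sub>R v)) has_real_derivative
            pdiff v f p * g p + pdiff v g p * f p) (at 0)"
      if "v \<in> Basis" "p \<in> U" for v p
      using DERIV_mult[OF Ck_on_has_pdiff[OF Suc.prems(1) that(2,1)] Ck_on_has_pdiff[OF Suc.prems(2) that(2,1)]]
      by simp
    show "Ck_on k U (\<lambda>p. pdiff v f p * g p + pdiff v g p * f p)" if "v \<in> Basis" for v
      by (intro Ck_on_add[OF assms] Suc.IH) (use Suc.prems[THEN Ck_on_pred] Suc.prems that in simp_all)
  qed
qed

text \<open>The function \<open>h = 1 / sqrt f\<close> solves \<open>h' = - h\<^sup>3 f' / 2\<close>, so its regularity bootstraps.\<close>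
lemma Ck_on_rsqrt:
  assumes "open U" "\<And>p. p \<in> U \<Longrightarrow> f p > 0"
  shows "Ck_on k U f \<Longrightarrow> Ck_on k U (\<lambda>p. 1 / sqrt (f p))"
proof (induction k)
  case 0
  then show ?case using assms(2) by (auto intro!: continuous_intros) (metis less_irrefl)
next
  case (Suc k)
  let ?h = "\<lambda>p. 1 / sqrt (f p)"
  show ?case
  proof (rule Ck_on_SucI[where g="\<lambda>v p. (-1/2) * (?h p * ?h p * ?h p) * pdiff v f p", OF assms(1)])
    show "continuous_on U ?h"
      using Suc Ck_on_continuous Ck_on_pred by blast
    show "((\<lambda>s. 1 / sqrt (f (p + s *\<^sub>R v))) has_real_derivative
            (-1/2) * (?h p * ?h p * ?h p) * pdiff v f p) (at 0)"
      if "v \<in> Basis" "p \<in> U" for v p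
    proof -
      have pos: "f p > 0" using assms(2) that by blast
      have sq: "sqrt (f p) * sqrt (f p) = f p" using pos by simp
      have "((\<lambda>s. 1 / sqrt (f (p + s *\<^sub>R v))) has_real_derivative
              - (pdiff v f p * (inverse (sqrt (f (p + 0 *\<^sub>R v))) / 2)) /
                (sqrt (f (p + 0 *\<^sub>R v)) * sqrt (f (p + 0 *\<^sub>R v)))) (at 0)"
        by (rule derivative_eq_intros refl Ck_on_has_pdiff[OF Suc.prems that(2,1)] | use pos in simp)+
      then show ?thesis by (simp add: sq inverse_eq_divide field_simps)
    qed
    show "Ck_on k U (\<lambda>p. (-1/2) * (?h p * ?h p * ?h p) * pdiff v f p)" if "v \<in> Basis" for v
      by (intro Ck_on_mult[OF assms(1)] Ck_on_const Suc.IH Ck_on_pred[OF Suc.prems]) (use Suc.prems that in simp)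
  qed
qed

lemma smooth_on_const: "open U \<Longrightarrow> smooth_on U (\<lambda>_. c)"
  unfolding smooth_on_iff_Ck_on by (auto intro: Ck_on_const)

lemma smooth_on_add: "smooth_on U f \<Longrightarrow> smooth_on U g \<Longrightarrow> smooth_on U (\<lambda>p. f p + g p)"
  unfolding smooth_on_iff_Ck_on by (auto intro: Ck_on_add)

lemma smooth_on_mult: "smooth_on U f \<Longrightarrow> smooth_on U g \<Longrightarrow> smooth_on U (\<lambda>p. f p * g p)"
  unfolding smooth_on_iff_Ck_on by (auto intro: Ck_on_mult)

lemma smooth_on_rsqrt:
  "smooth_on U f \<Longrightarrow> (\<And>p. p \<in> U \<Longrightarrow> f p > 0) \<Longrightarrow> smooth_on U (\<lambda>p. 1 / sqrt (f p))"
  unfolding smooth_on_iff_Ck_on by (auto intro: Ck_on_rsqrt)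

lemma smooth_on_diff:
  assumes "smooth_on U f" "smooth_on U g" shows "smooth_on U (\<lambda>p. f p - g p)"
proof -
  have "smooth_on U (\<lambda>p. f p + (-1) * g p)"
    using assms by (intro smooth_on_add smooth_on_mult smooth_on_const) (auto dest: smooth_on_open)
  then show ?thesis by simp
qed

lemma smooth_on_power: "smooth_on U f \<Longrightarrow> smooth_on U (\<lambda>p. f p ^ n)"
proof (induction n)
  case 0
  then show ?case by (simp add: smooth_on_const smooth_on_open)
qed (simp add: smooth_on_mult)

lemma smooth_on_sum:
  assumes "finite I" "open U" "\<And>i. i \<in> I \<Longrightarrow> smooth_on U (f i)"
  shows "smooth_on U (\<lambda>p. \<Sum>i\<in>I. f i p)"
  using assms(1,3) by (induction rule: finite_induct) (auto intro: smooth_on_const smooth_on_add assms(2))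

lemma smooth_on_inner:
  assumes "open U" shows "smooth_on U (\<lambda>p. p \<bullet> w)"
proof -
  have "Ck_on (Suc k) U (\<lambda>p. p \<bullet> w)" for k
    by (rule Ck_on_SucI[where g="\<lambda>v p. v \<bullet> w", OF assms])
      (auto intro!: continuous_intros derivative_eq_intros Ck_on_const simp: inner_add_left)
  then have "Ck_on k U (\<lambda>p. p \<bullet> w)" for k by (rule Ck_on_pred)
  then show ?thesis using assms by (simp add: smooth_on_iff_Ck_on)
qed

lemma pdiff_sum:
  assumes "finite I" "\<And>i. i \<in> I \<Longrightarrow> smooth_on U (f i)" "p \<in> U" "v \<in> Basis"
  shows "pdiff v (\<lambda>q. \<Sum>i\<in>I. f i q) p = (\<Sum>i\<in>I. pdiff v (f i) p)"
  unfolding pdiff_def[of v "\<lambda>q. \<Sum>i\<in>I. f i q"]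
  by (rule DERIV_imp_deriv, rule DERIV_sum) (rule smooth_on_has_pdiff[OF assms(2,3,4)])

subsection \<open>Symmetry of second derivatives and total differentiability\<close>

text \<open>Two applications of the mean value theorem, first along \<open>v\<close>, then along
  \<open>w\<close>. The left side is symmetric in \<open>v\<close> and \<open>w\<close>, the right
  side is not; this asymmetry yields the symmetry of second derivatives.\<close>

lemma mixed_difference_mean_value:
  assumes f: "smooth_on U f" and v: "v \<in> Basis" and w: "w \<in> Basis" and h: "h > 0"
    and box: "\<And>a b. 0 \<le> a \<Longrightarrow> a \<le> h \<Longrightarrow> 0 \<le> b \<Longrightarrow> b \<le> h \<Longrightarrow> p + a *\<^sub>R v + b *\<^sub>R w \<in> U"
  obtains a b where "0 < a" "a < h" "0 < b" "b < h"
    "f (p + h *\<^sub>R v + h *\<^sub>R w) - f (p + h *\<^sub>R v) - f (p + h *\<^sub>R w) + f p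
      = h * h * pdiff w (pdiff v f) (p + a *\<^sub>R v + b *\<^sub>R w)"
proof -
  define g where "g s = f (p + h *\<^sub>R w + s *\<^sub>R v) - f (p + s *\<^sub>R v)" for s
  have dg: "(g has_real_derivative pdiff v f (p + h *\<^sub>R w + s *\<^sub>R v) - pdiff v f (p + s *\<^sub>R v)) (at s)"
    if "0 \<le> s" "s \<le> h" for s
    unfolding g_def
    by (intro derivative_intros smooth_on_has_pdiff_line[OF f _ v])
      (use box[OF that, of h] box[OF that, of 0] h in \<open>simp_all add: add_ac\<close>)
  obtain a where a: "0 < a" "a < h"
    "g h - g 0 = (h - 0) * (pdiff v f (p + h *\<^sub>R w + a *\<^sub>R v) - pdiff v f (p + a *\<^sub>R v))"
    using MVT2[OF h dg] by metis
  have dk: "((\<lambda>s. pdiff v f (p + a *\<^sub>R v + s *\<^sub>R w)) has_real_derivative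
      pdiff w (pdiff v f) (p + a *\<^sub>R v + s *\<^sub>R w)) (at s)" if "0 \<le> s" "s \<le> h" for s
    by (intro smooth_on_has_pdiff_line[OF smooth_on_pdiff[OF f v] _ w] box) (use that a in auto)
  obtain b where b: "0 < b" "b < h"
    "pdiff v f (p + a *\<^sub>R v + h *\<^sub>R w) - pdiff v f (p + a *\<^sub>R v + 0 *\<^sub>R w)
      = (h - 0) * pdiff w (pdiff v f) (p + a *\<^sub>R v + b *\<^sub>R w)"
    using MVT2[OF h dk] by metis
  have "f (p + h *\<^sub>R v + h *\<^sub>R w) - f (p + h *\<^sub>R v) - f (p + h *\<^sub>R w) + f p = g h - g 0"
    by (simp add: g_def add_ac)
  also have "\<dots> = h * h * pdiff w (pdiff v f) (p + a *\<^sub>R v + b *\<^sub>R w)"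
    using a(3) b(3) by (simp add: add_ac)
  finally show ?thesis using that a b by blast
qed

text \<open>The same second difference over a small square equals \<open>h * h\<close> times either
  mixed derivative at some point of the square. If the two differed at \<open>p\<close>, continuity
  with half the gap as tolerance would keep them apart on the whole square.\<close>

lemma pdiff_commute:
  assumes f: "smooth_on U f" and p: "p \<in> U" and v: "v \<in> Basis" and w: "w \<in> Basis"
  shows "pdiff v (pdiff w f) p = pdiff w (pdiff v f) p"
proof (rule ccontr)
  let ?A = "pdiff v (pdiff w f)" and ?B = "pdiff w (pdiff v f)"
  assume ne: "?A p \<noteq> ?B p"
  define e where "e = \<bar>?A p - ?B p\<bar> / 2"
  have e: "e > 0" using ne by (simp add: e_def)
  have U: "open U" by (rule smooth_on_open[OF f])
  have "continuous_on U ?A" "continuous_on U ?B"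
    using f v w by (auto intro!: smooth_on_continuous smooth_on_pdiff)
  then have "\<forall>\<^sub>F q in nhds p. dist (?A q) (?A p) < e" "\<forall>\<^sub>F q in nhds p. dist (?B q) (?B p) < e"
    using U p e by (auto simp: continuous_on_eq_continuous_at isCont_def tendsto_at_iff_tendsto_nhds
        intro!: tendstoD)
  moreover have "\<forall>\<^sub>F q in nhds p. q \<in> U" using U p by (rule eventually_nhds_in_open)
  ultimately have "\<forall>\<^sub>F q in nhds p. dist (?A q) (?A p) < e \<and> dist (?B q) (?B p) < e \<and> q \<in> U"
    by eventually_elim simp
  then obtain d where d: "d > 0" "\<And>q. dist q p < d \<Longrightarrow> dist (?A q) (?A p) < e \<and> dist (?B q) (?B p) < e \<and> q \<in> U"
    unfolding eventually_nhds_metric by blast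
  \<comment> \<open>Two displacements of length at most \<open>h\<close> add up to at most
    \<open>2 * d / 3\<close>, so the square lies in the ball of radius \<open>d\<close>.\<close>
  define h where "h = d / 3"
  have h: "h > 0" using d by (simp add: h_def)
  have small: "dist (p + a *\<^sub>R v' + b *\<^sub>R w') p < d"
    if "0 \<le> a" "a \<le> h" "0 \<le> b" "b \<le> h" "v' \<in> Basis" "w' \<in> Basis" for a b and v' w'
  proof -
    have "norm (a *\<^sub>R v' + b *\<^sub>R w') \<le> a + b"
      using that norm_triangle_ineq[of "a *\<^sub>R v'" "b *\<^sub>R w'"] by simp
    then show ?thesis using that d(1) by (simp add: dist_norm add.assoc h_def)
  qed
  obtain a b where ab: "0 < a" "a < h" "0 < b" "b < h"
    "f (p + h *\<^sub>R v + h *\<^sub>R w) - f (p + h *\<^sub>R v) - f (p + h *\<^sub>R w) + f p = h * h * ?B (p + a *\<^sub>R v + b *\<^sub>R w)"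
    using mixed_difference_mean_value[OF f v w h] d(2) small v w by metis
  obtain a' b' where ab': "0 < a'" "a' < h" "0 < b'" "b' < h"
    "f (p + h *\<^sub>R w + h *\<^sub>R v) - f (p + h *\<^sub>R w) - f (p + h *\<^sub>R v) + f p = h * h * ?A (p + a' *\<^sub>R w + b' *\<^sub>R v)"
    using mixed_difference_mean_value[OF f w v h] d(2) small v w by metis
  have "p + h *\<^sub>R w + h *\<^sub>R v = p + h *\<^sub>R v + h *\<^sub>R w" by (simp add: algebra_simps)
  note ab'(5)[unfolded this]
  then have "h * h * ?B (p + a *\<^sub>R v + b *\<^sub>R w) = h * h * ?A (p + a' *\<^sub>R w + b' *\<^sub>R v)"
    using ab(5) by linarith
  then have eq: "?B (p + a *\<^sub>R v + b *\<^sub>R w) = ?A (p + a' *\<^sub>R w + b' *\<^sub>R v)" using h by simp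
  have "dist (?B (p + a *\<^sub>R v + b *\<^sub>R w)) (?B p) < e"
    using d(2)[OF small[of a b v w]] ab v w by simp
  moreover have "dist (?A (p + a' *\<^sub>R w + b' *\<^sub>R v)) (?A p) < e"
    using d(2)[OF small[of a' b' w v]] ab' v w by simp
  ultimately show False using eq unfolding e_def dist_real_def by (simp add: field_simps abs_if split: if_splits)
qed

text \<open>Continuous partial derivatives imply total differentiability: basis directions are added
  one at a time, and the increment along the new direction is estimated by the mean value inequality
  and the continuity of that partial derivative. \<open>B = Basis\<close> is the case of
  interest.\<close>

lemma partial_increment_estimate:
  assumes f: "smooth_on U f" and p: "p \<in> U" and B: "finite B" "B \<subseteq> Basis" and e: "e > 0"
  shows "\<exists>d>0. \<forall>h. norm h < d \<longrightarrow>
    \<bar>f (p + (\<Sum>b\<in>B. (h \<bullet> b) *\<^sub>R b)) - f p - (\<Sum>b\<in>B. (h \<bullet> b) * pdiff b f p)\<bar> \<le> e * norm h"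
  using B e
proof (induction B arbitrary: e rule: finite_induct)
  case empty
  then show ?case by (intro exI[of _ 1]) simp
next
  case (insert c B)
  let ?S = "\<lambda>h. \<Sum>b\<in>B. (h \<bullet> b) *\<^sub>R b"
  have c: "c \<in> Basis" using insert by simp
  obtain d1 where d1: "d1 > 0" "\<And>h. norm h < d1 \<Longrightarrow>
      \<bar>f (p + ?S h) - f p - (\<Sum>b\<in>B. (h \<bullet> b) * pdiff b f p)\<bar> \<le> e / 2 * norm h"
    using insert.IH[of "e / 2"] insert.prems by auto
  have "continuous_on U (pdiff c f)" using f c by (intro smooth_on_continuous smooth_on_pdiff)
  then have "\<forall>\<^sub>F q in nhds p. dist (pdiff c f q) (pdiff c f p) < e / 2"
    using smooth_on_open[OF f] p insert.prems
    by (intro tendstoD) (auto simp: continuous_on_eq_continuous_at isCont_def tendsto_at_iff_tendsto_nhds)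
  moreover have "\<forall>\<^sub>F q in nhds p. q \<in> U" using smooth_on_open[OF f] p by (rule eventually_nhds_in_open)
  ultimately have "\<forall>\<^sub>F q in nhds p. dist (pdiff c f q) (pdiff c f p) < e / 2 \<and> q \<in> U"
    by eventually_elim simp
  then obtain d2 where d2: "d2 > 0" "\<And>q. dist q p < d2 \<Longrightarrow> dist (pdiff c f q) (pdiff c f p) < e / 2 \<and> q \<in> U"
    unfolding eventually_nhds_metric by blast
  \<comment> \<open>\<open>card B\<close> bounds the partial sum already travelled and 1 the segment
    along \<open>c\<close>, both in units of \<open>norm h\<close>; so
    \<open>norm h < d2 / N\<close> keeps the segment within distance \<open>d2\<close> of
    \<open>p\<close>.\<close>
  define N where "N = real (card B) + 1"
  have N: "N > 0" by (simp add: N_def add_nonneg_pos)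
  have S_le: "norm (?S h) \<le> real (card B) * norm h" for h
  proof -
    have "norm ((h \<bullet> b) *\<^sub>R b) \<le> norm h" if "b \<in> B" for b
      using insert.prems that Basis_le_norm[of b h] by (auto simp: subset_iff)
    then have "norm (?S h) \<le> (\<Sum>b\<in>B. norm h)" by (rule order_trans[OF norm_sum sum_mono])
    then show ?thesis by simp
  qed
  have "\<bar>f (p + (\<Sum>b\<in>insert c B. (h \<bullet> b) *\<^sub>R b)) - f p - (\<Sum>b\<in>insert c B. (h \<bullet> b) * pdiff b f p)\<bar> \<le> e * norm h"
    if h: "norm h < min d1 (d2 / N)" for h
  proof -
    have hc: "\<bar>h \<bullet> c\<bar> \<le> norm h" using c by (rule Basis_le_norm)
    have Nh: "N * norm h < d2" using h N by (simp add: field_simps)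
    have near: "dist (p + ?S h + s *\<^sub>R c) p < d2" if "\<bar>s\<bar> \<le> \<bar>h \<bullet> c\<bar>" for s
    proof -
      have "norm (?S h + s *\<^sub>R c) \<le> real (card B) * norm h + norm h"
        using norm_triangle_ineq[of "?S h" "s *\<^sub>R c"] S_le[of h] that hc c by simp
      then show ?thesis using Nh by (simp add: dist_norm add.assoc N_def algebra_simps)
    qed
    have step: "\<bar>f (p + ?S h + (h \<bullet> c) *\<^sub>R c) - f (p + ?S h) - (h \<bullet> c) * pdiff c f p\<bar> \<le> e / 2 * norm h"
    proof -
      define k where "k s = f (p + ?S h + s *\<^sub>R c) - s * pdiff c f p" for s
      have dk: "(k has_real_derivative pdiff c f (p + ?S h + s *\<^sub>R c) - pdiff c f p) (at s)"
        if "\<bar>s\<bar> \<le> \<bar>h \<bullet> c\<bar>" for s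
        unfolding k_def
        by (rule derivative_eq_intros smooth_on_has_pdiff_line[OF f _ c] refl | use d2(2)[OF near[OF that]] in simp)+
      have "norm (k (h \<bullet> c) - k 0) \<le> e / 2 * norm (h \<bullet> c - 0)"
      proof (rule field_differentiable_bound[where S="cball 0 \<bar>h \<bullet> c\<bar>"])
        show "(k has_field_derivative pdiff c f (p + ?S h + s *\<^sub>R c) - pdiff c f p) (at s within cball 0 \<bar>h \<bullet> c\<bar>)"
          if "s \<in> cball 0 \<bar>h \<bullet> c\<bar>" for s
          using dk[of s] that by (auto simp: dist_real_def intro: has_field_derivative_at_within)
        show "norm (pdiff c f (p + ?S h + s *\<^sub>R c) - pdiff c f p) \<le> e / 2" if "s \<in> cball 0 \<bar>h \<bullet> c\<bar>" for s
          using d2(2)[OF near[of s]] that by (auto simp: dist_real_def)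
      qed (auto simp: dist_real_def)
      then have "\<bar>k (h \<bullet> c) - k 0\<bar> \<le> e / 2 * \<bar>h \<bullet> c\<bar>" by simp
      also have "\<dots> \<le> e / 2 * norm h" using hc insert.prems by (intro mult_left_mono) auto
      finally show ?thesis by (simp add: k_def algebra_simps)
    qed
    have eq: "(\<Sum>b\<in>insert c B. (h \<bullet> b) *\<^sub>R b) = ?S h + (h \<bullet> c) *\<^sub>R c"
      "(\<Sum>b\<in>insert c B. (h \<bullet> b) * pdiff b f p) = (\<Sum>b\<in>B. (h \<bullet> b) * pdiff b f p) + (h \<bullet> c) * pdiff c f p"
      using insert.hyps by (simp_all add: add.commute)
    show ?thesis
    proof -
      have "norm h < d1" using h by simp
      from d1(2)[OF this] step show ?thesis unfolding eq add.assoc[symmetric] by linarith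
    qed
  qed
  moreover have "min d1 (d2 / N) > 0" using d1 d2 N by simp
  ultimately show ?case by blast
qed

lemma smooth_on_has_derivative:
  assumes f: "smooth_on U f" and p: "p \<in> U"
  shows "(f has_derivative (\<lambda>h. \<Sum>b\<in>Basis. (h \<bullet> b) * pdiff b f p)) (at p)"
  unfolding has_derivative_at_alt
proof (intro conjI allI impI)
  show "bounded_linear (\<lambda>h. \<Sum>b\<in>Basis. (h \<bullet> b) * pdiff b f p)"
    by (intro bounded_linear_sum bounded_linear_mult_left[THEN bounded_linear_compose] bounded_linear_inner_left)
  fix e :: real assume "e > 0"
  from partial_increment_estimate[OF f p finite_Basis order_refl this]
  obtain d where d: "d > 0" "\<And>h. norm h < d \<Longrightarrow>
    \<bar>f (p + (\<Sum>b\<in>Basis. (h \<bullet> b) *\<^sub>R b)) - f p - (\<Sum>b\<in>Basis. (h \<bullet> b) * pdiff b f p)\<bar> \<le> e * norm h"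
    by blast
  show "\<exists>d>0. \<forall>y. norm (y - p) < d \<longrightarrow>
    norm (f y - f p - (\<Sum>b\<in>Basis. ((y - p) \<bullet> b) * pdiff b f p)) \<le> e * norm (y - p)"
    using d(1) d(2)[of "y - p" for y] by (intro exI[of _ d]) (simp add: euclidean_representation)
qed

section \<open>Integrals of derivatives of compactly supported functions\<close>

lemma integral_eq_integral_UNIV:
  fixes f :: "'a::euclidean_space \<Rightarrow> real"
  assumes "\<And>x. x \<notin> S \<Longrightarrow> f x = 0"
  shows "integral S f = integral UNIV f"
proof -
  have "(\<lambda>x. if x \<in> S then f x else 0) = f" using assms by auto
  then show ?thesis using integral_restrict_UNIV[of S f] by simp
qed

text \<open>The integral of the translate \<open>F (p + s v)\<close> does not depend on
  \<open>s\<close> while the support stays inside the box; differentiating under the integral at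
  \<open>s = 0\<close> gives the claim, without iterated integrals.\<close>

lemma integral_pdiff_eq_0:
  fixes F F' :: "'a::euclidean_space \<Rightarrow> real"
  assumes deriv: "\<And>p. ((\<lambda>s. F (p + s *\<^sub>R v)) has_real_derivative F' p) (at 0)"
    and cont: "continuous_on UNIV F" "continuous_on UNIV F'"
    and supp: "\<And>p. norm p > R \<Longrightarrow> F p = 0"
    and sub: "cball 0 R \<subseteq> cbox a b"
  shows "integral (cbox a b) F' = 0"
proof -
  \<comment> \<open>The margin \<open>norm v\<close> keeps the supports of all translates with
    \<open>|s| < 1\<close> inside the larger box.\<close>
  define R' where "R' = R + norm v"
  obtain c d where cd: "cball 0 R' \<subseteq> cbox c (d :: 'a)"
    using bounded_subset_cbox_symmetric[OF bounded_cball] by metis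
  have supp': "F' p = 0" if "norm p > R" for p
  proof -
    have "p \<in> {q. norm q > R}" "open {q :: 'a. norm q > R}"
      using that by (auto intro!: open_Collect_less continuous_intros)
    then have "((\<lambda>s. F (p + s *\<^sub>R v)) has_real_derivative F' p) (at 0) \<longleftrightarrow>
       ((\<lambda>s. (\<lambda>_. 0) (p + s *\<^sub>R v)) has_real_derivative F' p) (at 0)"
      using has_pdiff_cong[where f=F and g="\<lambda>_. 0" and p=p and v=v and U="{q. norm q > R}"] supp by auto
    then show ?thesis using deriv[of p] DERIV_unique DERIV_const by metis
  qed
  have "cball 0 R \<subseteq> cbox c d"
  proof -
    have "R \<le> R'" by (simp add: R'_def)
    then show ?thesis using cd subset_cball[of R R' 0] by blast
  qed
  then have restrict: "integral (cbox c d) F' = integral (cbox a b) F'"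
    using sub supp' integral_eq_integral_UNIV[of "cbox c d" F'] integral_eq_integral_UNIV[of "cbox a b" F']
    by (force simp: subset_iff not_less)
  define I where "I s = integral (cbox c d) (\<lambda>p. F (p + s *\<^sub>R v))" for s :: real
  have "(I has_real_derivative integral (cbox c d) (\<lambda>p. F' (p + 0 *\<^sub>R v))) (at 0 within UNIV)"
    unfolding I_def
  proof (rule leibniz_rule_field_derivative)
    fix s p
    have "((\<lambda>x. F (p + (x + s) *\<^sub>R v)) has_real_derivative F' (p + s *\<^sub>R v)) (at 0)"
      using deriv[of "p + s *\<^sub>R v"] by (simp add: scaleR_left_distrib add_ac)
    then show "((\<lambda>x. F (p + x *\<^sub>R v)) has_real_derivative F' (p + s *\<^sub>R v)) (at s within UNIV)"
      using DERIV_shift[of "\<lambda>x. F (p + x *\<^sub>R v)" "F' (p + s *\<^sub>R v)" 0 s] by simp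
    show "(\<lambda>p. F (p + s *\<^sub>R v)) integrable_on cbox c d"
      by (intro integrable_continuous continuous_on_compose2[OF cont(1)] continuous_intros) auto
    show "continuous_on (UNIV \<times> cbox c d) (\<lambda>(x, t). F' (t + x *\<^sub>R v))"
      unfolding split_beta
      by (intro continuous_on_compose2[OF cont(2)] continuous_intros) auto
  qed auto
  moreover have "(I has_real_derivative 0) (at 0)"
  proof -
    have const: "I s = integral UNIV F" if "\<bar>s\<bar> < 1" for s
    proof -
      have "F (p + s *\<^sub>R v) = 0" if "p \<notin> cbox c d" for p
      proof (rule supp)
        have "norm p > R'" using that cd by (auto simp: subset_iff not_le[symmetric])
        moreover have "norm p \<le> norm (p + s *\<^sub>R v) + \<bar>s\<bar> * norm v"
          using norm_triangle_ineq4[of "p + s *\<^sub>R v" "s *\<^sub>R v"] by simp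
        moreover have "\<bar>s\<bar> * norm v \<le> norm v" using \<open>\<bar>s\<bar> < 1\<close> by (simp add: mult_left_le_one_le)
        ultimately show "norm (p + s *\<^sub>R v) > R" by (simp add: R'_def)
      qed
      note zero = this
      have 2: "F p = 0" if "p \<notin> cbox (c + s *\<^sub>R v) (d + s *\<^sub>R v)" for p
        using zero[of "p - s *\<^sub>R v"] that
        by (auto simp: mem_box inner_diff_left inner_add_left algebra_simps)
      have "I s = integral (cbox c d) (F \<circ> (+) (s *\<^sub>R v))"
        by (simp add: I_def o_def add.commute)
      also have "\<dots> = integral UNIV F"
        unfolding integral_shift_cbox_plus by (rule integral_eq_integral_UNIV[OF 2])
      finally show ?thesis .
    qed
    have "eventually (\<lambda>s. I s = integral UNIV F) (nhds 0)"
      unfolding eventually_nhds_metric using const by (intro exI[of _ 1]) (auto simp: dist_real_def)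
    then have "(I has_real_derivative 0) (at 0) \<longleftrightarrow> ((\<lambda>_. integral UNIV F) has_real_derivative 0) (at 0)"
      by (intro DERIV_cong_ev) auto
    then show ?thesis by simp
  qed
  ultimately have "integral (cbox c d) F' = 0" using DERIV_unique by fastforce
  then show ?thesis using restrict by simp
qed

subsection \<open>Weighted energy estimates on truncated cones\<close>

abbreviation dir_r :: "real \<times> real \<times> (real^3)" where "dir_r \<equiv> (1, 0, 0)"
abbreviation dir_t :: "real \<times> real \<times> (real^3)" where "dir_t \<equiv> (0, 1, 0)"
abbreviation dir_x :: "3 \<Rightarrow> real \<times> real \<times> (real^3)" where "dir_x i \<equiv> (0, 0, axis i 1)"

lemma dir_in_Basis [simp]: "dir_r \<in> Basis" "dir_t \<in> Basis" "dir_x i \<in> Basis"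
  by (auto simp: Basis_prod_def axis_in_Basis_iff zero_prod_def)

abbreviation punctured :: "real \<Rightarrow> (real \<times> real \<times> (real^3)) set" where
  "punctured R \<equiv> {(r, t, x). r > R \<and> x \<noteq> 0}"

lemma continuous_on_open_cover:
  assumes "open A" "open B" "S \<subseteq> A \<union> B" "continuous_on (S \<inter> A) g" "continuous_on (S \<inter> B) g"
  shows "continuous_on S g"
proof -
  have S: "S = (S \<inter> A) \<union> (S \<inter> B)" using assms(3) by auto
  have "continuous_on ((S \<inter> A) \<union> (S \<inter> B)) g"
    by (rule continuous_on_Un_local_open)
      (use assms S in \<open>auto intro: openin_open_Int\<close>)
  then show ?thesis using S by simp
qed

text \<open>Every cutoff depends on \<open>x\<close> through \<open>|x|\<close> only, so its gradient is \<open>x\<close> times a scalar \<open>\<xi>\<close>;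
  it is then annihilated by tangential vector fields.\<close>
definition radial_cutoff :: "real \<Rightarrow> (real^3 \<Rightarrow> real) \<Rightarrow> (real^3 \<Rightarrow> real) \<Rightarrow> bool" where
  "radial_cutoff \<delta> \<eta> \<xi> \<longleftrightarrow> \<delta> > 0 \<and> continuous_on UNIV \<eta> \<and> continuous_on UNIV \<xi> \<and>
     (\<forall>x i. ((\<lambda>s. \<eta> (x + s *\<^sub>R axis i 1)) has_real_derivative x $ i * \<xi> x) (at 0)) \<and>
     (\<forall>x. 0 \<le> \<eta> x) \<and> (\<forall>x. norm x < \<delta> \<or> norm x > 1 \<longrightarrow> \<eta> x = 0 \<and> \<xi> x = 0)"

text \<open>The support in \<open>t\<close> shrinks, as \<open>r\<close> grows, at the speed
  \<open>C / r^2\<close>, which is the bound for the ratio of flux to density.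
  \<open>sqrt (1 + t^2)\<close> is a smooth substitute for \<open>|t|\<close>, the square makes the
  positive part continuously differentiable, and \<open>exp (C / r)\<close> is the integrating
  factor for the growth term.\<close>

definition cone_weight :: "real \<Rightarrow> real \<Rightarrow> real \<Rightarrow> real \<Rightarrow> real" where
  "cone_weight C T r t = exp (C / r) * (max 0 (T + C / r - sqrt (1 + t\<^sup>2)))\<^sup>2"

definition cone_weight_r :: "real \<Rightarrow> real \<Rightarrow> real \<Rightarrow> real \<Rightarrow> real" where
  "cone_weight_r C T r t = - (C / r\<^sup>2) * exp (C / r) *
     ((max 0 (T + C / r - sqrt (1 + t\<^sup>2)))\<^sup>2 + 2 * max 0 (T + C / r - sqrt (1 + t\<^sup>2)))"

definition cone_weight_t :: "real \<Rightarrow> real \<Rightarrow> real \<Rightarrow> real \<Rightarrow> real" where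
  "cone_weight_t C T r t = - exp (C / r) * 2 * max 0 (T + C / r - sqrt (1 + t\<^sup>2)) * (t / sqrt (1 + t\<^sup>2))"

lemma DERIV_max_square: "((\<lambda>s. (max 0 s)\<^sup>2) has_real_derivative 2 * max 0 s) (at (s::real))"
proof -
  consider "s < 0" | "s = 0" | "s > 0" by linarith
  then show ?thesis
  proof cases
    case 1
    have "\<forall>\<^sub>F y in nhds s. (max 0 y)\<^sup>2 = (0::real)"
      using eventually_nhds_in_open[of "{..<0}" s] 1 by (auto elim!: eventually_mono)
    then show ?thesis using 1 DERIV_cong_ev[of s s "\<lambda>s. (max 0 s)\<^sup>2" "\<lambda>_. 0" 0 0] by simp
  next
    case 2
    have "\<bar>(max 0 y)\<^sup>2 / y\<bar> \<le> \<bar>y\<bar>" for y :: real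
      by (cases "y > 0") (auto simp: max_def power2_eq_square)
    then have "((\<lambda>y. (max 0 y)\<^sup>2 / y) \<longlongrightarrow> 0) (at (0::real))"
      by (intro Lim_null_comparison[where g="\<lambda>y. \<bar>y\<bar>" and f="\<lambda>y. (max 0 y)\<^sup>2 / y"])
        (auto intro!: tendsto_rabs_zero)
    then show ?thesis using 2 by (simp add: has_field_derivative_iff)
  next
    case 3
    have "\<forall>\<^sub>F y in nhds s. (max 0 y)\<^sup>2 = y\<^sup>2"
      using eventually_nhds_in_open[of "{0<..}" s] 3 by (auto elim!: eventually_mono simp: max_def)
    moreover have "((\<lambda>y. y\<^sup>2) has_real_derivative 2 * s) (at s)" by (auto intro!: derivative_eq_intros)
    ultimately show ?thesis using 3 DERIV_cong_ev[of s s "\<lambda>s. (max 0 s)\<^sup>2" "\<lambda>s. s\<^sup>2" "2 * s" "2 * s"] by simp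
  qed
qed

lemma sqrt_1_plus_square_pos: "sqrt (1 + t\<^sup>2) > 0"
  by (simp add: add_pos_nonneg)

lemma cone_weight_deriv_r:
  assumes "r > 0"
  shows "((\<lambda>r. cone_weight C T r t) has_real_derivative cone_weight_r C T r t) (at r)"
proof -
  have 1: "((\<lambda>r. T + C / r - sqrt (1 + t\<^sup>2)) has_real_derivative - (C / r\<^sup>2)) (at r)"
    using assms by (auto intro!: derivative_eq_intros simp: power2_eq_square)
  have 2: "((\<lambda>r. exp (C / r)) has_real_derivative exp (C / r) * - (C / r\<^sup>2)) (at r)"
    using assms by (auto intro!: derivative_eq_intros simp: power2_eq_square)
  show ?thesis unfolding cone_weight_def
    by (rule DERIV_cong[OF DERIV_mult[OF 2 DERIV_chain2[OF DERIV_max_square 1]]])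
      (simp add: cone_weight_r_def algebra_simps)
qed

lemma cone_weight_deriv_t:
  "((\<lambda>s. cone_weight C T r (t + s)) has_real_derivative cone_weight_t C T r t) (at 0)"
proof -
  have 1: "((\<lambda>s. T + C / r - sqrt (1 + (t + s)\<^sup>2)) has_real_derivative - (t / sqrt (1 + t\<^sup>2))) (at 0)"
    using sqrt_1_plus_square_pos[of t]
      add_pos_nonneg[of 1 "t\<^sup>2"]
    by (auto intro!: derivative_eq_intros simp: divide_simps)
  show ?thesis unfolding cone_weight_def
    by (rule DERIV_cong[OF DERIV_cmult[OF DERIV_chain2[OF DERIV_max_square 1]]])
      (simp add: cone_weight_t_def)
qed

lemma cone_weight_zero:
  assumes "\<bar>t\<bar> \<ge> T + C / r"
  shows "cone_weight C T r t = 0" "cone_weight_r C T r t = 0" "cone_weight_t C T r t = 0"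
proof -
  have "\<bar>t\<bar> \<le> sqrt (1 + t\<^sup>2)" by (rule real_le_rsqrt) simp
  then have "max 0 (T + C / r - sqrt (1 + t\<^sup>2)) = 0" using assms by simp
  then show "cone_weight C T r t = 0" "cone_weight_r C T r t = 0" "cone_weight_t C T r t = 0"
    by (simp_all add: cone_weight_def cone_weight_r_def cone_weight_t_def)
qed

lemma cone_weight_nonneg: "0 \<le> cone_weight C T r t"
  by (simp add: cone_weight_def)

text \<open>\<open>cone_weight_r\<close> has two parts: the quadratic one, from the integrating
  factor, is exactly the growth term; the linear one, from the moving edge of the cone, dominates
  the flux term because \<open>|t| / sqrt (1 + t^2)\<close> is at most 1.\<close>

lemma cone_weight_t_le:
  assumes "C \<ge> 0" shows "\<bar>cone_weight_t C T r t\<bar> * (C / r\<^sup>2) + (C / r\<^sup>2) * cone_weight C T r t \<le> - cone_weight_r C T r t"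
proof -
  have "\<bar>t\<bar> \<le> sqrt (1 + t\<^sup>2)" by (rule real_le_rsqrt) simp
  then have q: "\<bar>t / sqrt (1 + t\<^sup>2)\<bar> \<le> 1" using sqrt_1_plus_square_pos[of t] by (simp add: abs_divide)
  let ?m = "max 0 (T + C / r - sqrt (1 + t\<^sup>2))"
  have "\<bar>cone_weight_t C T r t\<bar> = (exp (C / r) * 2 * ?m) * \<bar>t / sqrt (1 + t\<^sup>2)\<bar>"
    by (simp add: cone_weight_t_def abs_mult)
  also have "\<dots> \<le> exp (C / r) * 2 * ?m" by (rule mult_left_le[OF q]) simp
  finally have "\<bar>cone_weight_t C T r t\<bar> * (C / r\<^sup>2) \<le> (exp (C / r) * 2 * ?m) * (C / r\<^sup>2)"
    using assms by (intro mult_right_mono) auto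
  then show ?thesis by (simp add: cone_weight_def cone_weight_r_def algebra_simps)
qed

lemma continuous_on_cone_weight:
  assumes "continuous_on S f" "continuous_on S g" "\<And>z. z \<in> S \<Longrightarrow> f z \<noteq> 0"
  shows "continuous_on S (\<lambda>z. cone_weight C T (f z) (g z))"
    "continuous_on S (\<lambda>z. cone_weight_r C T (f z) (g z))"
    "continuous_on S (\<lambda>z. cone_weight_t C T (f z) (g z))"
  unfolding cone_weight_def cone_weight_r_def cone_weight_t_def
  using assms sqrt_1_plus_square_pos less_imp_neq
  by (auto intro!: continuous_intros simp: add_nonneg_eq_0_iff)

text \<open>After differentiation under the integral, the integrand is bounded pointwise by exact t-
  and x-derivatives of compactly supported functions, which integrate to zero. The r-derivative of
  the weight pays for both the growth term and the flux through the side of the cone.\<close>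

lemma weighted_energy_nonincreasing:
  fixes G \<Phi> :: "real \<times> real \<times> (real^3) \<Rightarrow> real" and J :: "3 \<Rightarrow> real \<times> real \<times> (real^3) \<Rightarrow> real"
  assumes smooth: "smooth_on (punctured R) G" "smooth_on (punctured R) \<Phi>" "\<And>i. smooth_on (punctured R) (J i)"
    and r: "R < r0" "0 < r0" "r0 \<le> r1" "r1 \<le> r2" and C: "C \<ge> 0"
    and tangential: "\<And>r t x. r \<ge> r0 \<Longrightarrow> x \<noteq> 0 \<Longrightarrow> (\<Sum>i\<in>UNIV. x $ i * J i (r, t, x)) = 0"
    and flux: "\<And>r t x. r \<ge> r0 \<Longrightarrow> x \<noteq> 0 \<Longrightarrow> \<bar>\<Phi> (r, t, x)\<bar> \<le> C / r\<^sup>2 * G (r, t, x)"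
    and bulk: "\<And>r t x. r \<ge> r0 \<Longrightarrow> x \<noteq> 0 \<Longrightarrow>
       pdiff dir_r G (r, t, x) \<le> pdiff dir_t \<Phi> (r, t, x) + (\<Sum>i\<in>UNIV. pdiff (dir_x i) (J i) (r, t, x))
         + C / r\<^sup>2 * G (r, t, x)"
    and cutoff: "radial_cutoff \<delta> \<eta> \<xi>"
    and box: "cball 0 (T + C / r0 + 1) \<subseteq> cbox a b" and T: "T \<ge> 0"
  defines "N \<equiv> \<lambda>r. integral (cbox a b) (\<lambda>p. cone_weight C T r (fst p) * \<eta> (snd p) * G (r, p))"
  shows "N r2 \<le> N r1"
proof -
  \<comment> \<open>The density is smooth only for \<open>x \<noteq> 0\<close>. On the open set
    \<open>Z\<close> the cutoff vanishes, and \<open>P\<close> and \<open>Z\<close> cover the space,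
    so continuity and derivatives are checked on each of them and hold everywhere.\<close>
  define P where "P = {p :: real \<times> (real^3). snd p \<noteq> 0}"
  define Z where "Z = {p :: real \<times> (real^3). norm (snd p) < \<delta>}"
  have oP: "open P" "open Z"
    unfolding P_def Z_def by (auto intro!: open_Collect_neq open_Collect_less continuous_intros)
  note cut = cutoff[unfolded radial_cutoff_def]
  have zeroZ: "\<eta> (snd p) = 0" "\<xi> (snd p) = 0" if "p \<in> Z" for p using that cut by (auto simp: Z_def)
  have cover: "P \<union> Z = UNIV" using cut by (auto simp: P_def Z_def)
  have mem: "(r, p) \<in> punctured R" if "r \<ge> r0" "p \<in> P" for r p
    using that r by (cases p) (auto simp: P_def)
  have cont_comp: "continuous_on ({r1..r2} \<times> UNIV \<inter> UNIV \<times> P) g" 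
    if "smooth_on (punctured R) g" for g
    by (rule continuous_on_subset[OF smooth_on_continuous[OF that]]) (use mem r in auto)
  have cont_comp': "continuous_on P (\<lambda>p. g (r, p))" if "smooth_on (punctured R) g" "r \<ge> r0" for g r
    by (rule continuous_on_compose2[OF smooth_on_continuous[OF that(1)]])
      (use mem that in \<open>auto intro!: continuous_intros\<close>)
  have cont\<eta>: "continuous_on S (\<lambda>z. \<eta> (f z))" "continuous_on S (\<lambda>z. \<xi> (f z))" if "continuous_on S f"
    for S and f :: "'z::topological_space \<Rightarrow> real^3"
    using cut by (auto intro!: continuous_on_compose2[OF _ that, of UNIV])
  define W where "W r p = cone_weight C T r (fst p) * \<eta> (snd p)" for r p
  define Wr where "Wr r p = cone_weight_r C T r (fst p) * \<eta> (snd p)" for r p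
  define Wt where "Wt r p = cone_weight_t C T r (fst p) * \<eta> (snd p)" for r p
  define N' where "N' r = integral (cbox a b) (\<lambda>p. Wr r p * G (r, p) + W r p * pdiff dir_r G (r, p))" for r
  \<comment> \<open>The summand 1 is the radius of the ball that carries the cutoff: a point this
    far out has either \<open>|t|\<close> outside the cone or \<open>norm x > 1\<close>.\<close>
  have supp: "W r p = 0" "Wr r p = 0" "Wt r p = 0" if "norm p > T + C / r0 + 1" "r \<ge> r0" for r p
  proof -
    obtain t x where p: "p = (t, x)" by (cases p)
    have "norm p \<le> \<bar>t\<bar> + norm x" unfolding p using norm_Pair_le[of t x] by simp
    then have "\<bar>t\<bar> > T + C / r0 \<or> norm x > 1" using that(1) by linarith
    moreover have "C / r \<le> C / r0" using that(2) r C by (intro divide_left_mono) auto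
    ultimately have "\<bar>t\<bar> \<ge> T + C / r \<or> norm x > 1" by linarith
    then show "W r p = 0" "Wr r p = 0" "Wt r p = 0"
      using cut cone_weight_zero[of T C r t] by (auto simp: W_def Wr_def Wt_def p)
  qed
  have extend: "continuous_on UNIV g" if "continuous_on P g" "\<And>p. p \<in> Z \<Longrightarrow> g p = 0"
    for g :: "real \<times> (real^3) \<Rightarrow> real"
  proof (rule continuous_on_open_cover[OF oP])
    show "continuous_on (UNIV \<inter> Z) g"
      using continuous_on_cong[of Z Z g "\<lambda>_. 0"] that(2) by simp
  qed (use that cover in auto)
  have N_deriv: "(N has_real_derivative N' r) (at r within {r1..r2})" if "r \<in> {r1..r2}" for r
    unfolding N_def N'_def
  proof (rule leibniz_rule_field_derivative[OF _ _ _ that])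
    fix s p assume s: "s \<in> {r1..r2}"
    have "((\<lambda>r. cone_weight C T r (fst p) * \<eta> (snd p) * G (r, p)) has_real_derivative
        Wr s p * G (s, p) + W s p * pdiff dir_r G (s, p)) (at s)"
    proof (cases "p \<in> P")
      case False
      then have "p \<in> Z" using cover by auto
      then show ?thesis using zeroZ by (simp add: W_def Wr_def)
    next
      case True
      have shift: "(0, p) + r *\<^sub>R dir_r = (r, p)" for r by (cases p) simp
      have "(0, p) + s *\<^sub>R dir_r \<in> punctured R" unfolding shift using mem[of s p] True s r by simp
      from smooth_on_has_pdiff_line[OF smooth(1) this dir_in_Basis(1)]
      have 1: "((\<lambda>r. G (r, p)) has_real_derivative pdiff dir_r G (s, p)) (at s)"
        unfolding shift .
      have "s > 0" using s r by simp
      from DERIV_mult[OF DERIV_cmult_right[OF cone_weight_deriv_r[OF this]] 1]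
      show ?thesis by (rule DERIV_cong) (simp add: W_def Wr_def)
    qed
    then show "((\<lambda>r. cone_weight C T r (fst p) * \<eta> (snd p) * G (r, p)) has_real_derivative
        Wr s p * G (s, p) + W s p * pdiff dir_r G (s, p)) (at s within {r1..r2})"
      by (rule has_field_derivative_at_within)
  next
    fix s assume s: "s \<in> {r1..r2}"
    have "continuous_on UNIV (\<lambda>p. W s p * G (s, p))"
      by (rule extend) (use s r zeroZ in \<open>auto intro!: continuous_intros continuous_on_cone_weight cont\<eta> cont_comp' smooth simp: W_def\<close>)
    then show "(\<lambda>p. cone_weight C T s (fst p) * \<eta> (snd p) * G (s, p)) integrable_on cbox a b"
      unfolding W_def by (intro integrable_continuous) (rule continuous_on_subset, auto)
  next
    show "continuous_on ({r1..r2} \<times> cbox a b) (\<lambda>(s, p). Wr s p * G (s, p) + W s p * pdiff dir_r G (s, p))"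
    proof (rule continuous_on_subset[where s="{r1..r2} \<times> UNIV"], rule continuous_on_open_cover[of "UNIV \<times> P" "UNIV \<times> Z"])
      show "continuous_on ({r1..r2} \<times> UNIV \<inter> UNIV \<times> P) (\<lambda>(s, p). Wr s p * G (s, p) + W s p * pdiff dir_r G (s, p))"
        unfolding split_beta Wr_def W_def
        using cont_comp[OF smooth(1)] cont_comp[OF smooth_on_pdiff[OF smooth(1), of dir_r]] r
        by (auto intro!: continuous_intros continuous_on_cone_weight cont\<eta>)
      show "continuous_on ({r1..r2} \<times> UNIV \<inter> UNIV \<times> Z) (\<lambda>(s, p). Wr s p * G (s, p) + W s p * pdiff dir_r G (s, p))"
        by (rule continuous_on_eq[OF continuous_on_const[of _ 0]]) (auto simp: Wr_def W_def dest: zeroZ)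
    qed (use oP cover in \<open>auto intro: open_Times\<close>)
  qed auto
  have "N' r \<le> 0" if "r \<in> {r1..r2}" for r
  proof -
    have rr: "r \<ge> r0" "r > 0" using that r by auto
    define Ft where "Ft p = Wt r p * \<Phi> (r, p) + W r p * pdiff dir_t \<Phi> (r, p)" for p
    define Fx where "Fx i p = cone_weight C T r (fst p) * (snd p $ i * \<xi> (snd p)) * J i (r, p)
                              + W r p * pdiff (dir_x i) (J i) (r, p)" for i p
    have contFt: "continuous_on UNIV Ft"
      by (rule extend) (use rr zeroZ in \<open>auto intro!: continuous_intros continuous_on_cone_weight cont\<eta> cont_comp' smooth_on_pdiff smooth simp: W_def Wt_def Ft_def[abs_def]\<close>)
    have contFx: "continuous_on UNIV (Fx i)" for i
      by (rule extend) (use rr zeroZ in \<open>auto intro!: continuous_intros continuous_on_cone_weight cont\<eta> cont_comp' smooth_on_pdiff smooth simp: W_def Wt_def Fx_def[abs_def]\<close>)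
    have intt: "integral (cbox a b) Ft = 0"
    proof (rule integral_pdiff_eq_0[OF _ _ contFt _ box])
      show "continuous_on UNIV (\<lambda>p. W r p * \<Phi> (r, p))"
        by (rule extend) (use rr zeroZ in \<open>auto intro!: continuous_intros continuous_on_cone_weight cont\<eta> cont_comp' smooth simp: W_def\<close>)
      show "W r p * \<Phi> (r, p) = 0" if "norm p > T + C / r0 + 1" for p using supp[OF that rr(1)] by simp
      fix p :: "real \<times> (real^3)"
      show "((\<lambda>s. W r (p + s *\<^sub>R (1, 0)) * \<Phi> (r, p + s *\<^sub>R (1, 0))) has_real_derivative Ft p) (at 0)"
      proof (cases "p \<in> P")
        case False
        then have "p \<in> Z" using cover by auto
        then show ?thesis using zeroZ[of p] by (simp add: W_def Wt_def Ft_def)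
      next
        case True
        have "((\<lambda>s. \<Phi> ((r, p) + s *\<^sub>R dir_t)) has_real_derivative pdiff dir_t \<Phi> (r, p)) (at 0)"
          by (rule smooth_on_has_pdiff[OF smooth(2)]) (use mem True rr in auto)
        then have 1: "((\<lambda>s. \<Phi> (r, p + s *\<^sub>R (1, 0))) has_real_derivative pdiff dir_t \<Phi> (r, p)) (at 0)"
          by (cases p) simp
        have 2: "((\<lambda>s. W r (p + s *\<^sub>R (1, 0))) has_real_derivative Wt r p) (at 0)"
          unfolding W_def Wt_def using DERIV_cmult_right[OF cone_weight_deriv_t] by (cases p) simp
        show ?thesis by (rule DERIV_cong[OF DERIV_mult[OF 2 1]]) (simp add: Ft_def zero_prod_def[symmetric])
      qed
    qed
    have intx: "integral (cbox a b) (Fx i) = 0" for i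
    proof (rule integral_pdiff_eq_0[OF _ _ contFx _ box])
      show "continuous_on UNIV (\<lambda>p. W r p * J i (r, p))"
        by (rule extend) (use rr zeroZ in \<open>auto intro!: continuous_intros continuous_on_cone_weight cont\<eta> cont_comp' smooth simp: W_def\<close>)
      show "W r p * J i (r, p) = 0" if "norm p > T + C / r0 + 1" for p using supp[OF that rr(1)] by simp
      fix p :: "real \<times> (real^3)"
      show "((\<lambda>s. W r (p + s *\<^sub>R (0, axis i 1)) * J i (r, p + s *\<^sub>R (0, axis i 1))) has_real_derivative Fx i p) (at 0)"
      proof (cases "p \<in> P")
        case False
        then have pZ: "p \<in> Z" using cover by auto
        have "((\<lambda>s. (\<lambda>q. W r q * J i (r, q)) (p + s *\<^sub>R (0, axis i 1))) has_real_derivative 0) (at 0)"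
          using has_pdiff_cong[where f="\<lambda>q. W r q * J i (r, q)" and g="\<lambda>_. 0" and U=Z and p=p and v="(0, axis i 1)"]
            oP(2) pZ zeroZ by (simp add: W_def)
        moreover have "Fx i p = 0" using zeroZ[OF pZ] by (simp add: Fx_def W_def)
        ultimately show ?thesis by simp
      next
        case True
        have "((\<lambda>s. J i ((r, p) + s *\<^sub>R dir_x i)) has_real_derivative pdiff (dir_x i) (J i) (r, p)) (at 0)"
          by (rule smooth_on_has_pdiff[OF smooth(3)]) (use mem True rr in auto)
        then have 1: "((\<lambda>s. J i (r, p + s *\<^sub>R (0, axis i 1))) has_real_derivative pdiff (dir_x i) (J i) (r, p)) (at 0)"
          by (cases p) simp
        have "((\<lambda>s. \<eta> (snd p + s *\<^sub>R axis i 1)) has_real_derivative snd p $ i * \<xi> (snd p)) (at 0)"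
          using cut by blast
        from DERIV_cmult[OF this]
        have 2: "((\<lambda>s. W r (p + s *\<^sub>R (0, axis i 1))) has_real_derivative
            cone_weight C T r (fst p) * (snd p $ i * \<xi> (snd p))) (at 0)"
          unfolding W_def by simp
        show ?thesis by (rule DERIV_cong[OF DERIV_mult[OF 2 1]]) (simp add: Fx_def zero_prod_def[symmetric])
      qed
    qed
    have le: "Wr r p * G (r, p) + W r p * pdiff dir_r G (r, p) \<le> Ft p + (\<Sum>i\<in>UNIV. Fx i p)" for p
    proof (cases "p \<in> P")
      case False
      then have "p \<in> Z" using cover by auto
      then show ?thesis using zeroZ[of p] by (simp add: W_def Wr_def Wt_def Ft_def Fx_def)
    next
      case True
      obtain t x where p: "p = (t, x)" by (cases p)
      have x: "x \<noteq> 0" using True by (simp add: P_def p)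
      have \<eta>0: "\<eta> x \<ge> 0" using cut by blast
      have W0: "W r p \<ge> 0" using \<eta>0 cone_weight_nonneg by (simp add: W_def p)
      let ?G = "G (r, p)" and ?c = "C / r\<^sup>2"
      have "?c * ?G \<ge> 0" using flux[OF rr(1) x, of t] by (simp add: p)
      \<comment> \<open>The x-derivative of the weight is a multiple of \<open>x\<close>, to which
        \<open>J\<close> is orthogonal; only the divergence of \<open>J\<close> survives.\<close>
      have sumx: "(\<Sum>i\<in>UNIV. Fx i p) = W r p * (\<Sum>i\<in>UNIV. pdiff (dir_x i) (J i) (r, p))"
      proof -
        have "(\<Sum>i\<in>UNIV. Fx i p) = cone_weight C T r t * \<xi> x * (\<Sum>i\<in>UNIV. x $ i * J i (r, p))
              + W r p * (\<Sum>i\<in>UNIV. pdiff (dir_x i) (J i) (r, p))"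
          by (simp add: Fx_def p sum.distrib sum_distrib_left mult_ac)
        then show ?thesis using tangential[OF rr(1) x, of t] by (simp add: p)
      qed
      have "W r p * pdiff dir_r G (r, p) \<le> W r p * (pdiff dir_t \<Phi> (r, p) +
            (\<Sum>i\<in>UNIV. pdiff (dir_x i) (J i) (r, p)) + ?c * ?G)"
        using bulk[OF rr(1) x, of t] W0 by (intro mult_left_mono) (simp_all add: p)
      moreover have "Wr r p * ?G + W r p * (?c * ?G) \<le> Wt r p * \<Phi> (r, p)"
      \<comment> \<open>The flux hypothesis yields \<open>G \<ge> 0\<close> only when
        \<open>C\<close> is nonzero. For \<open>C = 0\<close> it forces the flux to vanish, and the
        weight no longer depends on \<open>r\<close>.\<close>
      proof (cases "C = 0")
        case True
        then have "\<Phi> (r, p) = 0" using flux[OF rr(1) x, of t] by (simp add: p)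
        then show ?thesis using True by (simp add: Wr_def cone_weight_r_def)
      next
        case False
        then have G0: "?G \<ge> 0" using \<open>?c * ?G \<ge> 0\<close> C rr by (simp add: zero_le_mult_iff zero_le_divide_iff)
        have "- (Wt r p * \<Phi> (r, p)) \<le> \<bar>Wt r p\<bar> * (?c * ?G)"
          using flux[OF rr(1) x, of t] mult_left_mono[of "\<bar>\<Phi> (r, p)\<bar>" "?c * ?G" "\<bar>Wt r p\<bar>"]
          by (simp add: p abs_mult[symmetric])
        moreover have "\<bar>Wt r p\<bar> * ?c + W r p * ?c \<le> - Wr r p"
          using mult_right_mono[OF cone_weight_t_le[OF C, of T r t] \<eta>0] \<eta>0
          by (simp add: Wt_def W_def Wr_def p abs_mult algebra_simps)
        then have "(\<bar>Wt r p\<bar> * ?c + W r p * ?c) * ?G \<le> - Wr r p * ?G" using G0 by (rule mult_right_mono)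
        ultimately show ?thesis by (simp add: algebra_simps)
      qed
      ultimately show ?thesis unfolding sumx Ft_def by (simp add: algebra_simps)
    qed
    have i1: "Ft integrable_on cbox a b" "\<And>i. Fx i integrable_on cbox a b"
      using contFt contFx by (auto intro!: integrable_continuous intro: continuous_on_subset)
    have "N' r \<le> integral (cbox a b) (\<lambda>p. Ft p + (\<Sum>i\<in>UNIV. Fx i p))"
      unfolding N'_def
    proof (rule integral_le[OF _ _ le])
      have "continuous_on UNIV (\<lambda>p. Wr r p * G (r, p) + W r p * pdiff dir_r G (r, p))"
        by (rule extend) (use rr zeroZ in \<open>auto intro!: continuous_intros continuous_on_cone_weight cont\<eta> cont_comp' smooth_on_pdiff smooth simp: W_def Wr_def\<close>)
      then show "(\<lambda>p. Wr r p * G (r, p) + W r p * pdiff dir_r G (r, p)) integrable_on cbox a b"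
        by (intro integrable_continuous) (rule continuous_on_subset, auto)
    qed (use i1 in \<open>auto intro!: integrable_add integrable_sum\<close>)
    also have "\<dots> = integral (cbox a b) Ft + (\<Sum>i\<in>UNIV. integral (cbox a b) (Fx i))"
      using i1 by (simp add: integral_add integral_sum integrable_sum)
    finally show ?thesis using intt intx by simp
  qed
  note N'_le = this
  show ?thesis
  proof (rule DERIV_nonpos_imp_decreasing_open[OF r(4)])
    fix r assume r': "r1 < r" "r < r2"
    then have "(N has_real_derivative N' r) (at r)"
      using N_deriv[of r] at_within_Icc_at[of r1 r r2] by simp
    moreover have "N' r \<le> 0" using N'_le[of r] r' by simp
    ultimately show "\<exists>y. (N has_real_derivative y) (at r) \<and> y \<le> 0" by blast
  next
    show "continuous_on {r1..r2} N" using N_deriv by (rule DERIV_continuous_on)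
  qed
qed

section \<open>Cutoffs that exhaust the punctured unit ball\<close>

definition shell_profile :: "real \<Rightarrow> real" where
  "shell_profile s = (max 0 s)\<^sup>2 / (1 + (max 0 s)\<^sup>2)"

text \<open>The polynomial \<open>(x \<bullet> x) * (1 - x \<bullet> x)\<close> is, away from the
  origin, positive exactly inside the unit ball. Subtracting 1 after scaling by \<open>n\<close>
  confines the support to a closed shell, and the shells exhaust the punctured ball as
  \<open>n\<close> grows. Dependence on \<open>x \<bullet> x\<close> alone makes the gradient
  radial.\<close>

definition shell_cutoff :: "real \<Rightarrow> real^3 \<Rightarrow> real" where
  "shell_cutoff n x = shell_profile (n * ((x \<bullet> x) * (1 - x \<bullet> x)) - 1)"

lemma one_plus_square_neq_0 [simp]: "1 + (a::real)\<^sup>2 \<noteq> 0"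
  using add_pos_nonneg[of 1 "a\<^sup>2"] by simp

lemma shell_profile_deriv:
  "(shell_profile has_real_derivative 2 * max 0 s / (1 + (max 0 s)\<^sup>2)\<^sup>2) (at s)"
proof -
  have "((\<lambda>s. (max 0 s)\<^sup>2 / (1 + (max 0 s)\<^sup>2)) has_real_derivative
      (2 * max 0 s * (1 + (max 0 s)\<^sup>2) - (max 0 s)\<^sup>2 * (0 + 2 * max 0 s)) / ((1 + (max 0 s)\<^sup>2) * (1 + (max 0 s)\<^sup>2))) (at s)"
    by (intro DERIV_divide DERIV_add DERIV_const DERIV_max_square) simp
  then show ?thesis unfolding shell_profile_def[abs_def]
    by (rule DERIV_cong) (simp add: power2_eq_square algebra_simps)
qed

lemma shell_profile_bounds: "0 \<le> shell_profile s" "shell_profile s \<le> 1" "s \<le> 0 \<Longrightarrow> shell_profile s = 0"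
  using add_pos_nonneg[of 1 "(max 0 s)\<^sup>2"] by (auto simp: shell_profile_def divide_le_eq_1)

lemma shell_profile_tendsto: "(shell_profile \<longlongrightarrow> 1) at_top"
proof -
  have "filterlim (\<lambda>s::real. 1 + s\<^sup>2) at_top at_top"
    by (intro filterlim_tendsto_add_at_top[OF tendsto_const] filterlim_pow_at_top filterlim_ident) simp
  from tendsto_diff[OF tendsto_const tendsto_inverse_0_at_top[OF this], of 1]
  have "((\<lambda>s::real. 1 - inverse (1 + s\<^sup>2)) \<longlongrightarrow> 1) at_top" by simp
  moreover have "eventually (\<lambda>s. 1 - inverse (1 + s\<^sup>2) = shell_profile s) at_top"
    using eventually_ge_at_top[of 0] by eventually_elim (simp add: shell_profile_def field_simps)
  ultimately show ?thesis by (rule Lim_transform_eventually)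
qed

lemma shell_cutoff_le_1: "shell_cutoff n x \<le> 1"
  by (simp add: shell_cutoff_def shell_profile_bounds)

lemma shell_cutoff_zero:
  assumes "n \<ge> 1" "norm x < 1 / n \<or> norm x \<ge> 1"
  shows "n * ((x \<bullet> x) * (1 - x \<bullet> x)) - 1 \<le> 0"
  using assms(2)
proof
  assume x: "norm x < 1 / n"
  have "1 / n \<le> 1" using assms by simp
  then have "norm x \<le> 1 / n" "norm x \<le> 1" using x by linarith+
  then have "norm x * norm x \<le> (1 / n) * 1" using assms(1) by (intro mult_mono) auto
  then have n: "n * (x \<bullet> x) \<le> 1" using assms by (simp add: dot_square_norm power2_eq_square field_simps)
  have "n * ((x \<bullet> x) * (1 - x \<bullet> x)) \<le> n * (x \<bullet> x) * 1"
    unfolding mult.assoc using assms by (intro mult_left_mono) auto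
  then show ?thesis using n by simp
next
  assume "norm x \<ge> 1"
  then have "1 - x \<bullet> x \<le> 0" by (simp add: dot_square_norm)
  then have "(x \<bullet> x) * (1 - x \<bullet> x) \<le> 0" by (intro mult_nonneg_nonpos) auto
  then have "n * ((x \<bullet> x) * (1 - x \<bullet> x)) \<le> 0" using assms(1) by (rule_tac mult_nonneg_nonpos) linarith+
  then show ?thesis by simp
qed

lemma radial_cutoff_shell:
  assumes "n \<ge> 1"
  defines "s \<equiv> \<lambda>x. n * ((x \<bullet> x) * (1 - x \<bullet> x)) - 1"
  shows "radial_cutoff (1 / n) (shell_cutoff n)
    (\<lambda>x. 2 * max 0 (s x) / (1 + (max 0 (s x))\<^sup>2)\<^sup>2 * (n * 2 * (1 - 2 * (x \<bullet> x))))"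
  unfolding radial_cutoff_def
proof (intro conjI allI impI)
  show "0 < 1 / n" using assms by simp
  show "continuous_on UNIV (shell_cutoff n)"
    unfolding shell_cutoff_def[abs_def] shell_profile_def by (intro continuous_intros) auto
  show "continuous_on UNIV (\<lambda>x. 2 * max 0 (s x) / (1 + (max 0 (s x))\<^sup>2)\<^sup>2 * (n * 2 * (1 - 2 * (x \<bullet> x))))"
    unfolding s_def by (intro continuous_intros) auto
  fix x :: "real^3"
  show "0 \<le> shell_cutoff n x" by (simp add: shell_cutoff_def shell_profile_bounds)
  fix i
  have dq: "((\<lambda>u. (x + u *\<^sub>R axis i 1) \<bullet> (x + u *\<^sub>R axis i 1)) has_real_derivative 2 * x $ i) (at 0)"
  proof -
    have "(x + u *\<^sub>R axis i 1) \<bullet> (x + u *\<^sub>R axis i 1) = x \<bullet> x + 2 * u * x $ i + u\<^sup>2" for u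
      by (simp add: inner_add_left inner_add_right inner_axis inner_axis' power2_eq_square algebra_simps)
    then show ?thesis by (auto intro!: derivative_eq_intros)
  qed
  have ds: "((\<lambda>u. s (x + u *\<^sub>R axis i 1)) has_real_derivative n * (2 * (1 - 2 * (x \<bullet> x)) * x $ i)) (at 0)"
    unfolding s_def
    by (rule derivative_eq_intros dq refl)+ (simp add: algebra_simps)
  show "((\<lambda>u. shell_cutoff n (x + u *\<^sub>R axis i 1)) has_real_derivative
       x $ i * (2 * max 0 (s x) / (1 + (max 0 (s x))\<^sup>2)\<^sup>2 * (n * 2 * (1 - 2 * (x \<bullet> x))))) (at 0)"
    using DERIV_chain2[OF shell_profile_deriv ds] unfolding shell_cutoff_def s_def
    by (rule DERIV_cong) simp
next
  fix x :: "real^3" assume "norm x < 1 / n \<or> norm x > 1"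
  then have "s x \<le> 0" unfolding s_def by (intro shell_cutoff_zero[OF assms(1)]) auto
  then show "shell_cutoff n x = 0"
    "2 * max 0 (s x) / (1 + (max 0 (s x))\<^sup>2)\<^sup>2 * (n * 2 * (1 - 2 * (x \<bullet> x))) = 0"
    by (simp_all add: shell_cutoff_def s_def shell_profile_bounds)
qed

section \<open>Removal of the cutoffs\<close>

text \<open>This is the passage from the gauge integral over a box, in which the weighted energy is
  differentiated, to the nonnegative Lebesgue integral over the whole space, in which the limit of
  the cutoffs is taken.\<close>

lemma nn_integral_weighted:
  fixes G :: "real \<times> real \<times> (real^3) \<Rightarrow> real"
  assumes G: "smooth_on (punctured R) G" and r: "R < r" "0 < r"
    and nonneg: "\<And>t x. x \<noteq> 0 \<Longrightarrow> 0 \<le> G (r, t, x)"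
    and cutoff: "radial_cutoff \<delta> \<eta> \<xi>"
    and box: "cball 0 (T + C / r + 1) \<subseteq> cbox a b"
  shows "(\<integral>\<^sup>+ p. ennreal (cone_weight C T r (fst p) * \<eta> (snd p) * G (r, p)) \<partial>lborel)
     = ennreal (integral (cbox a b) (\<lambda>p. cone_weight C T r (fst p) * \<eta> (snd p) * G (r, p)))"
proof -
  have cut: "\<delta> > 0" "continuous_on UNIV \<eta>" "\<And>x. 0 \<le> \<eta> x"
    "\<And>x. norm x < \<delta> \<Longrightarrow> \<eta> x = 0" "\<And>x. norm x > 1 \<Longrightarrow> \<eta> x = 0"
    using cutoff unfolding radial_cutoff_def by blast+
  let ?g = "\<lambda>p. cone_weight C T r (fst p) * \<eta> (snd p) * G (r, p)"
  have cont: "continuous_on UNIV ?g"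
  proof (rule continuous_on_open_cover[of "{p. snd p \<noteq> 0}" "{p. norm (snd p) < \<delta>}"])
    show "open {p :: real \<times> (real^3). snd p \<noteq> 0}" "open {p :: real \<times> (real^3). norm (snd p) < \<delta>}"
      by (auto intro!: open_Collect_neq open_Collect_less continuous_intros)
    show "UNIV \<subseteq> {p :: real \<times> (real^3). snd p \<noteq> 0} \<union> {p. norm (snd p) < \<delta>}" using cut by auto
    show "continuous_on (UNIV \<inter> {p. snd p \<noteq> 0}) ?g"
    proof (intro continuous_on_mult)
      show "continuous_on (UNIV \<inter> {p. snd p \<noteq> 0}) (\<lambda>p. cone_weight C T r (fst p))"
        using r by (intro continuous_intros continuous_on_cone_weight) simp
      show "continuous_on (UNIV \<inter> {p. snd p \<noteq> 0}) (\<lambda>p. \<eta> (snd p))"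
        by (rule continuous_on_compose2[OF cut(2)]) (auto intro!: continuous_intros)
      show "continuous_on (UNIV \<inter> {p. snd p \<noteq> 0}) (\<lambda>p. G (r, p))"
        by (rule continuous_on_compose2[OF smooth_on_continuous[OF G]]) (use r in \<open>auto intro!: continuous_intros\<close>)
    qed
    show "continuous_on (UNIV \<inter> {p. norm (snd p) < \<delta>}) ?g"
      by (rule continuous_on_eq[OF continuous_on_const[of _ 0]]) (use cut in auto)
  qed
  have zero: "?g p = 0" if "p \<notin> cbox a b" for p
  proof -
    obtain t x where p: "p = (t, x)" by (cases p)
    have "norm p \<le> \<bar>t\<bar> + norm x" unfolding p using norm_Pair_le[of t x] by simp
    moreover have "norm p > T + C / r + 1" using that box mem_cball_0[of p "T + C / r + 1"] by fastforce
    ultimately have "\<bar>t\<bar> \<ge> T + C / r \<or> norm x > 1" by linarith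
    then show ?thesis using cut cone_weight_zero[of T C r t] by (auto simp: p)
  qed
  have "?g integrable_on cbox a b"
    by (intro integrable_continuous continuous_on_subset[OF cont]) auto
  then have "(?g has_integral integral (cbox a b) ?g) UNIV"
    using zero by (intro has_integral_on_superset[OF integrable_integral]) auto
  moreover have "0 \<le> ?g p" for p
  proof (cases "snd p = 0")
    case True
    then show ?thesis using cut by auto
  next
    case False
    then show ?thesis using nonneg[of "snd p" "fst p"] cut cone_weight_nonneg by simp
  qed
  moreover have "?g \<in> borel_measurable borel" using cont by (rule borel_measurable_continuous_onI)
  ultimately show ?thesis by (intro nn_integral_has_integral_lborel)
qed

lemma measurable_slice:
  fixes g :: "real \<times> real \<times> (real^3) \<Rightarrow> real"
  assumes g: "smooth_on (punctured R) g" and r: "R < r"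
  shows "(\<lambda>p. indicator (ball 0 1 - {0}) (snd p) * ennreal (g (r, p))) \<in> borel_measurable borel"
proof -
  have "continuous_on {p. snd p \<noteq> 0} (\<lambda>p. g (r, p))"
    by (rule continuous_on_compose2[OF smooth_on_continuous[OF g]])
      (use r in \<open>auto intro!: continuous_intros\<close>)
  moreover have "open {p :: real \<times> (real^3). snd p \<noteq> 0}"
    by (auto intro!: open_Collect_neq continuous_intros)
  ultimately have 1: "(\<lambda>p. if p \<in> {p. snd p \<noteq> 0} then g (r, p) else 0) \<in> borel_measurable borel"
    by (intro borel_measurable_continuous_on_if) auto
  have 2: "snd -` (ball 0 1 - {0}) \<in> sets (borel :: (real \<times> (real^3)) measure)"
    by (intro borel_open open_vimage continuous_intros) auto
  have "(\<lambda>p. indicator (snd -` (ball 0 1 - {0})) p * ennreal (if p \<in> {p. snd p \<noteq> 0} then g (r, p) else 0))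
      \<in> borel_measurable borel"
    using 1 2 by measurable
  moreover have "(\<lambda>p. indicator (snd -` (ball 0 1 - {0})) p * ennreal (if p \<in> {p. snd p \<noteq> 0} then g (r, p) else 0))
     = (\<lambda>p. indicator (ball 0 1 - {0}) (snd p) * ennreal (g (r, p)))"
    by (auto simp: fun_eq_iff indicator_def)
  ultimately show ?thesis by simp
qed

text \<open>The cone weight divided by \<open>T^2\<close> is bounded by \<open>M\<close> at
  \<open>r1\<close>, uniformly in \<open>T\<close>, and tends to \<open>exp (C / r2) \<ge> 1\<close>
  at \<open>r2\<close> as \<open>T\<close> grows. Monotonicity of the weighted energies and Fatou's
  lemma then give the bound, also when the energies are infinite.\<close>

lemma energy_growth_bound:
  fixes G \<Phi> :: "real \<times> real \<times> (real^3) \<Rightarrow> real" and J :: "3 \<Rightarrow> real \<times> real \<times> (real^3) \<Rightarrow> real"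
  assumes smooth: "smooth_on (punctured R) G" "smooth_on (punctured R) \<Phi>" "\<And>i. smooth_on (punctured R) (J i)"
    and r: "R < r0" "0 < r0" "r0 \<le> r1" "r1 \<le> r2" and C: "C \<ge> 0"
    and nonneg: "\<And>r t x. r \<ge> r0 \<Longrightarrow> x \<noteq> 0 \<Longrightarrow> 0 \<le> G (r, t, x)"
    and tangential: "\<And>r t x. r \<ge> r0 \<Longrightarrow> x \<noteq> 0 \<Longrightarrow> (\<Sum>i\<in>UNIV. x $ i * J i (r, t, x)) = 0"
    and flux: "\<And>r t x. r \<ge> r0 \<Longrightarrow> x \<noteq> 0 \<Longrightarrow> \<bar>\<Phi> (r, t, x)\<bar> \<le> C / r\<^sup>2 * G (r, t, x)"
    and bulk: "\<And>r t x. r \<ge> r0 \<Longrightarrow> x \<noteq> 0 \<Longrightarrow>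
       pdiff dir_r G (r, t, x) \<le> pdiff dir_t \<Phi> (r, t, x) + (\<Sum>i\<in>UNIV. pdiff (dir_x i) (J i) (r, t, x))
         + C / r\<^sup>2 * G (r, t, x)"
  defines "E \<equiv> \<lambda>r. (\<integral>\<^sup>+ p. indicator (ball 0 1 - {0}) (snd p) * ennreal (G (r, p)) \<partial>lborel)"
  shows "E r2 \<le> ennreal (exp (C / r0) * (1 + C / r0)\<^sup>2) * E r1"
proof -
  \<comment> \<open>Since \<open>T \<ge> 1\<close> and \<open>C / r1 \<le> C / r0\<close>, the
    bracket \<open>T + C / r1\<close> is at most \<open>T * (1 + C / r0)\<close>; after division by
    \<open>T^2\<close> this leaves \<open>M\<close>.\<close>
  define M where "M = exp (C / r0) * (1 + C / r0)\<^sup>2"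
  define h where "h n r p = (1 / (real (Suc n))\<^sup>2) *
     (cone_weight C (Suc n) r (fst p) * shell_cutoff (Suc n) (snd p) * G (r, p))" for n r p
  have meas: "(\<lambda>p. h n r p) \<in> borel_measurable borel" if "r0 \<le> r" for n r
  proof -
    have "continuous_on {p. snd p \<noteq> 0} (\<lambda>p. h n r p)"
      unfolding h_def
    proof (intro continuous_on_mult continuous_on_const)
      show "continuous_on {p. snd p \<noteq> 0} (\<lambda>p. cone_weight C (Suc n) r (fst p))"
        using r that by (intro continuous_intros continuous_on_cone_weight) simp
      show "continuous_on {p. snd p \<noteq> 0} (\<lambda>p. shell_cutoff (Suc n) (snd p))"
        unfolding shell_cutoff_def shell_profile_def by (intro continuous_intros) auto
      show "continuous_on {p. snd p \<noteq> 0} (\<lambda>p. G (r, p))"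
        by (rule continuous_on_compose2[OF smooth_on_continuous[OF smooth(1)]])
          (use r that in \<open>auto intro!: continuous_intros\<close>)
    qed
    moreover have "open {p :: real \<times> (real^3). snd p \<noteq> 0}"
      by (auto intro!: open_Collect_neq continuous_intros)
    ultimately have "(\<lambda>p. if p \<in> {p. snd p \<noteq> 0} then h n r p else 0) \<in> borel_measurable borel"
      by (intro borel_measurable_continuous_on_if) auto
    \<comment> \<open>At \<open>x = 0\<close> the profile is evaluated at -1, so the cutoff is zero
      there and the value of \<open>G\<close> at the origin does not matter.\<close>
    moreover have "(\<lambda>p. if p \<in> {p. snd p \<noteq> 0} then h n r p else 0) = (\<lambda>p. h n r p)"
      by (auto simp: h_def fun_eq_iff shell_cutoff_def shell_profile_def)
    ultimately show ?thesis by simp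
  qed
  note Gmeas = measurable_slice[OF smooth(1) less_le_trans[OF r(1)]]
  have Ih: "(\<integral>\<^sup>+ p. h n r2 p \<partial>lborel) \<le> ennreal M * E r1" for n
  proof -
    let ?T = "real (Suc n)"
    have T: "?T \<ge> 1" by simp
    obtain a b :: "real \<times> (real^3)" where ab: "cball 0 (?T + C / r0 + 1) \<subseteq> cbox a b"
      using bounded_subset_cbox_symmetric[OF bounded_cball] by metis
    have sub: "cball 0 (?T + C / r + 1) \<subseteq> cbox a b" if "r0 \<le> r" for r
    proof -
      have "C / r \<le> C / r0" using that r C by (intro divide_left_mono) auto
      then show ?thesis using ab subset_cball[of "?T + C / r + 1" "?T + C / r0 + 1" "0 :: real \<times> (real^3)"] by auto
    qed
    let ?N = "\<lambda>r. integral (cbox a b) (\<lambda>p. cone_weight C ?T r (fst p) * shell_cutoff ?T (snd p) * G (r, p))"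
    have I: "(\<integral>\<^sup>+ p. h n r p \<partial>lborel) = ennreal (1 / ?T\<^sup>2) * ennreal (?N r)" if "r0 \<le> r" for r
    proof -
      have "(\<integral>\<^sup>+ p. h n r p \<partial>lborel) = ennreal (1 / ?T\<^sup>2) *
          (\<integral>\<^sup>+ p. ennreal (cone_weight C ?T r (fst p) * shell_cutoff ?T (snd p) * G (r, p)) \<partial>lborel)"
      proof (subst nn_integral_cmult[symmetric])
        have "(\<lambda>p. ?T\<^sup>2 * h n r p) \<in> borel_measurable borel" using meas[OF that] by measurable
        then show "(\<lambda>p. ennreal (cone_weight C ?T r (fst p) * shell_cutoff ?T (snd p) * G (r, p))) \<in> borel_measurable lborel"
          by (simp add: h_def)
      qed (simp add: h_def ennreal_mult'[symmetric])
      also have "\<dots> = ennreal (1 / ?T\<^sup>2) * ennreal (?N r)"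
        using that r nonneg sub[OF that]
        by (subst nn_integral_weighted[OF smooth(1) _ _ _ radial_cutoff_shell[OF T]]) auto
      finally show ?thesis .
    qed
    have "?N r2 \<le> ?N r1"
      by (rule weighted_energy_nonincreasing[OF smooth r C tangential flux bulk radial_cutoff_shell[OF T] ab]) auto
    then have "(\<integral>\<^sup>+ p. h n r2 p \<partial>lborel) \<le> (\<integral>\<^sup>+ p. h n r1 p \<partial>lborel)"
      using r by (simp only: I order_trans[OF r(3,4)]) (intro mult_left_mono ennreal_leI, auto)
    also have "\<dots> \<le> (\<integral>\<^sup>+ p. ennreal M * (indicator (ball 0 1 - {0}) (snd p) * ennreal (G (r1, p))) \<partial>lborel)"
    proof (rule nn_integral_mono)
      fix p :: "real \<times> (real^3)"
      obtain t x where p: "p = (t, x)" by (cases p)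
      show "ennreal (h n r1 p) \<le> ennreal M * (indicator (ball 0 1 - {0}) (snd p) * ennreal (G (r1, p)))"
      proof (cases "x = 0 \<or> norm x \<ge> 1")
        case True
        then have "norm x < 1 / ?T \<or> norm x \<ge> 1" by auto
        from shell_cutoff_zero[OF T this] have "shell_cutoff ?T x = 0"
          by (simp add: shell_cutoff_def shell_profile_bounds)
        then show ?thesis by (simp add: h_def p)
      next
        case False
        then have G0: "G (r1, t, x) \<ge> 0" using nonneg r by auto
        have "cone_weight C ?T r1 t \<le> exp (C / r0) * (?T * (1 + C / r0))\<^sup>2"
        proof -
          have 1: "C / r1 \<le> C / r0" using r C by (intro divide_left_mono) auto
          have sq: "0 \<le> sqrt (1 + t\<^sup>2)" by (intro real_sqrt_ge_zero) simp
          have "C / r0 \<le> ?T * (C / r0)" using mult_right_mono[OF T, of "C / r0"] r C by (simp del: of_nat_Suc)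
          moreover have "C / r0 \<ge> 0" using r C by simp
          moreover have "?T * (1 + C / r0) = ?T + ?T * (C / r0)" by (simp only: distrib_left mult_1_right)
          ultimately have "max 0 (?T + C / r1 - sqrt (1 + t\<^sup>2)) \<le> ?T * (1 + C / r0)"
            using 1 sq T by linarith
          then show ?thesis unfolding cone_weight_def using 1 by (intro mult_mono power_mono) auto
        qed
        then have "cone_weight C ?T r1 t * shell_cutoff ?T x \<le> (exp (C / r0) * (?T * (1 + C / r0))\<^sup>2) * 1"
          using shell_cutoff_le_1 by (intro mult_mono) (auto simp: shell_cutoff_def shell_profile_bounds)
        then have "cone_weight C ?T r1 t * shell_cutoff ?T x * G (r1, t, x) \<le> (?T\<^sup>2 * M) * G (r1, t, x)"
          using G0 by (intro mult_right_mono) (simp_all add: M_def power_mult_distrib mult_ac del: of_nat_Suc)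
        then have "h n r1 p \<le> M * G (r1, t, x)"
          using T by (simp add: h_def p field_simps del: of_nat_Suc)
        then have "ennreal (h n r1 p) \<le> ennreal (M * G (r1, t, x))" by (rule ennreal_leI)
        also have "\<dots> = ennreal M * ennreal (G (r1, t, x))"
          using G0 by (intro ennreal_mult'') 
        finally show ?thesis using False by (simp add: p)
      qed
    qed
    also have "\<dots> = ennreal M * E r1"
      unfolding E_def using Gmeas[OF r(3)] by (intro nn_integral_cmult) simp
    finally show ?thesis .
  qed
  have "E r2 \<le> (\<integral>\<^sup>+ p. liminf (\<lambda>n. ennreal (h n r2 p)) \<partial>lborel)"
    unfolding E_def
  proof (rule nn_integral_mono)
    fix p :: "real \<times> (real^3)"
    obtain t x where p: "p = (t, x)" by (cases p)
    show "indicator (ball 0 1 - {0}) (snd p) * ennreal (G (r2, p)) \<le> liminf (\<lambda>n. ennreal (h n r2 p))"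
    proof (cases "x = 0 \<or> norm x \<ge> 1")
      case True
      then show ?thesis by (auto simp: p)
    next
      case False
      define y where "y = (x \<bullet> x) * (1 - x \<bullet> x)"
      have "x \<bullet> x < 1" "x \<bullet> x > 0" using False by (auto simp: dot_square_norm power_less_one_iff)
      then have y: "y > 0" by (simp add: y_def)
      have S: "filterlim (\<lambda>n. real (Suc n)) at_top sequentially"
        by (rule filterlim_compose[OF filterlim_real_sequentially filterlim_Suc])
      have "filterlim (\<lambda>n. - 1 + y * real (Suc n)) at_top sequentially"
        by (intro filterlim_tendsto_add_at_top[OF tendsto_const] filterlim_tendsto_pos_mult_at_top[OF tendsto_const y S])
      then have "filterlim (\<lambda>n. real (Suc n) * y - 1) at_top sequentially" by (simp add: algebra_simps)
      from filterlim_compose[OF shell_profile_tendsto this]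
      have l1: "(\<lambda>n. shell_cutoff (real (Suc n)) x) \<longlonglongrightarrow> 1" by (simp add: shell_cutoff_def y_def)
      define c where "c = C / r2 - sqrt (1 + t\<^sup>2)"
      have "(\<lambda>n. 1 + c * inverse (real (Suc n))) \<longlonglongrightarrow> 1 + c * 0"
        by (rule tendsto_add[OF tendsto_const tendsto_mult[OF tendsto_const LIMSEQ_inverse_real_of_nat]])
      from tendsto_mult[OF tendsto_const tendsto_power[OF tendsto_max[OF tendsto_const this]]]
      have "(\<lambda>n. exp (C / r2) * (max 0 (1 + c * inverse (real (Suc n))))\<^sup>2) \<longlonglongrightarrow>
          exp (C / r2) * (max 0 (1 + c * 0))\<^sup>2" .
      moreover have "exp (C / r2) * (max 0 (1 + c * inverse (real (Suc n))))\<^sup>2 = cone_weight C (Suc n) r2 t / (real (Suc n))\<^sup>2" for n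
      proof -
        have "max 0 (1 + c * inverse (real (Suc n))) = max 0 (real (Suc n) + C / r2 - sqrt (1 + t\<^sup>2)) / real (Suc n)"
          by (simp add: c_def max_def field_simps del: of_nat_Suc)
        then show ?thesis by (simp add: cone_weight_def power_divide del: of_nat_Suc)
      qed
      ultimately have l2: "(\<lambda>n. cone_weight C (Suc n) r2 t / (real (Suc n))\<^sup>2) \<longlonglongrightarrow> exp (C / r2)" by simp
      have "(\<lambda>n. h n r2 p) \<longlonglongrightarrow> exp (C / r2) * 1 * G (r2, p)"
        using tendsto_mult[OF tendsto_mult[OF l2 l1] tendsto_const[of "G (r2, p)"]]
        by (simp add: h_def p del: of_nat_Suc)
      then have "(\<lambda>n. ennreal (h n r2 p)) \<longlonglongrightarrow> ennreal (exp (C / r2) * G (r2, p))" by (simp add: tendsto_ennrealI)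
      then have "liminf (\<lambda>n. ennreal (h n r2 p)) = ennreal (exp (C / r2) * G (r2, p))"
        by (intro lim_imp_Liminf) auto
      moreover have "1 * G (r2, p) \<le> exp (C / r2) * G (r2, p)"
        using nonneg[of r2 x t] r C False by (intro mult_right_mono) (auto simp: p)
      ultimately show ?thesis using False by (simp add: p ennreal_leI)
    qed
  qed
  also have "\<dots> \<le> liminf (\<lambda>n. \<integral>\<^sup>+ p. h n r2 p \<partial>lborel)"
    using meas[of r2] r by (intro nn_integral_liminf) auto
  also have "\<dots> \<le> ennreal M * E r1"
  proof -
    have "liminf (\<lambda>n. \<integral>\<^sup>+ p. h n r2 p \<partial>lborel) \<le> liminf (\<lambda>n. ennreal M * E r1)"
      using Ih by (intro Liminf_mono) auto
    then show ?thesis by (simp add: Liminf_const)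
  qed
  finally show ?thesis by (simp add: M_def)
qed

subsection \<open>Ray-constant extensions\<close>

lemma deriv_shift_0: "deriv (\<lambda>s. g (r + s)) 0 = deriv g (r :: real)"
proof -
  have "((\<lambda>s. g (r + s)) has_field_derivative d) (at 0) \<longleftrightarrow> (g has_field_derivative d) (at r)" for d
    using DERIV_shift[of g d 0 r] by (simp add: add.commute)
  then show ?thesis by (simp add: deriv_def)
qed

lemma d_r_eq_pdiff_lift: "d_r \<phi> r t (x /\<^sub>R norm x) = pdiff dir_r (lift \<phi>) (r, t, x)"
  unfolding d_r_def pdiff_def lift_def using deriv_shift_0[of "\<lambda>s. \<phi> s t (x /\<^sub>R norm x)" r] by simp

lemma d_t_eq_pdiff_lift: "d_t \<phi> r t (x /\<^sub>R norm x) = pdiff dir_t (lift \<phi>) (r, t, x)"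
  unfolding d_t_def pdiff_def lift_def using deriv_shift_0[of "\<lambda>s. \<phi> r s (x /\<^sub>R norm x)" t] by simp

lemma d_ang_eq_pdiff_lift: "d_ang \<phi> i r t x = pdiff (dir_x i) (lift \<phi>) (r, t, x)"
  by (simp add: d_ang_def pdiff_def)

lemma lap_S2_eq_pdiff_lift:
  "lap_S2 \<phi> r t x = (\<Sum>i\<in>UNIV. pdiff (dir_x i) (pdiff (dir_x i) (lift \<phi>)) (r, t, x))"
  by (simp add: lap_S2_def d_ang_eq_pdiff_lift pdiff_def[of _ "pdiff _ _"])

lemma lift_Xop: "lift (Xop \<Lambda> m \<phi>) = (\<lambda>p. fst p * SdS_D \<Lambda> m (fst p) * pdiff dir_r (lift \<phi>) p)"
  by (auto simp: fun_eq_iff lift_def[of "Xop _ _ _"] Xop_def d_r_eq_pdiff_lift)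

lemma lift_Yop: "lift (Yop \<Lambda> m \<phi>) = (\<lambda>p. fst p * sqrt (SdS_D \<Lambda> m (fst p)) * pdiff dir_r (lift \<phi>) p)"
  by (auto simp: fun_eq_iff lift_def[of "Yop _ _ _"] Yop_def d_r_eq_pdiff_lift)

lemma lift_scale: "c > 0 \<Longrightarrow> lift \<phi> (r, t, c *\<^sub>R x) = lift \<phi> (r, t, x)"
proof -
  assume c: "c > 0"
  have "inverse (norm (c *\<^sub>R x)) * c = inverse (norm x)" using c by (simp add: field_simps)
  then show ?thesis by (simp add: lift_def del: norm_scaleR)
qed

text \<open>Differentiation lowers the degree of homogeneity by one. Used with
  \<open>c = 1 / norm x\<close>, this moves derivatives from \<open>x\<close> to the unit vector: a
  gradient acquires the factor \<open>norm x\<close>, a second derivative its square.\<close>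

lemma pdiff_x_homogeneous:
  assumes "smooth_on (punctured R) g" "r > R" "x \<noteq> 0" "c > 0"
    and "\<And>y. y \<noteq> 0 \<Longrightarrow> g (r, t, c *\<^sub>R y) = k * g (r, t, y)"
  shows "pdiff (dir_x i) g (r, t, c *\<^sub>R x) = k / c * pdiff (dir_x i) g (r, t, x)"
proof -
  have D: "((\<lambda>s. g (r, t, x + s *\<^sub>R axis i 1)) has_real_derivative pdiff (dir_x i) g (r, t, x)) (at 0)"
    using smooth_on_has_pdiff[OF assms(1), of "(r, t, x)" "dir_x i"] assms(2,3) by simp
  have 1: "((\<lambda>s. s / c) has_real_derivative 1 / c) (at 0)"
    using assms(4) by (auto intro!: derivative_eq_intros)
  have D': "((\<lambda>s. k * g (r, t, x + (s / c) *\<^sub>R axis i 1)) has_real_derivative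
      k * (pdiff (dir_x i) g (r, t, x) * (1 / c))) (at 0)"
    by (rule DERIV_cmult, rule DERIV_chain2[OF _ 1]) (use D in simp)
  have "\<forall>\<^sub>F s in nhds 0. x + s *\<^sub>R axis i (1::real) \<in> - {0}"
    by (rule eventually_line_in_open) (use assms in auto)
  moreover have "filterlim (\<lambda>s. s / c) (nhds 0) (nhds (0::real))"
  proof -
    have "isCont (\<lambda>s. s / c) 0" using assms(4) by (intro continuous_intros) simp
    then show ?thesis unfolding isCont_def by (subst (asm) tendsto_at_iff_tendsto_nhds) simp
  qed
  ultimately have "\<forall>\<^sub>F s in nhds 0. x + (s / c) *\<^sub>R axis i (1::real) \<in> - {0}"
    by (rule eventually_compose_filterlim)
  then have "\<forall>\<^sub>F s in nhds 0. g (r, t, c *\<^sub>R x + s *\<^sub>R axis i 1) = k * g (r, t, x + (s / c) *\<^sub>R axis i 1)"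
  proof eventually_elim
    case (elim s)
    have "c *\<^sub>R x + s *\<^sub>R axis i 1 = c *\<^sub>R (x + (s / c) *\<^sub>R axis i 1)"
      using assms(4) by (simp add: scaleR_right_distrib)
    then show ?case using assms(5)[of "x + (s / c) *\<^sub>R axis i 1"] elim by simp
  qed
  then have "((\<lambda>s. g (r, t, c *\<^sub>R x + s *\<^sub>R axis i 1)) has_real_derivative
      k * (pdiff (dir_x i) g (r, t, x) * (1 / c))) (at 0)"
    using D' by (subst DERIV_cong_ev[OF refl _ refl])
  then show ?thesis by (simp add: pdiff_def DERIV_imp_deriv)
qed

lemma sum_Basis_vec:
  fixes F :: "real^'n \<Rightarrow> real"
  shows "(\<Sum>b\<in>Basis. F b) = (\<Sum>i\<in>UNIV. F (axis i 1))"
proof -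
  have B: "(Basis :: (real^'n) set) = (\<lambda>i. axis i 1) ` UNIV" by (auto simp: Basis_vec_def)
  have "inj (\<lambda>i. axis i 1 :: real^'n)" by (auto simp: inj_def axis_eq_axis)
  then show ?thesis unfolding B by (subst sum.reindex) simp_all
qed

lemma sum_Basis_prod:
  fixes F :: "'a::euclidean_space \<times> 'b::euclidean_space \<Rightarrow> real"
  shows "(\<Sum>b\<in>Basis. F b) = (\<Sum>u\<in>Basis. F (u, 0)) + (\<Sum>v\<in>Basis. F (0, v))"
proof -
  have "inj_on (\<lambda>u. (u::'a, 0::'b)) Basis" "inj_on (\<lambda>u. (0::'a, u::'b)) Basis"
    by (auto intro!: inj_onI)
  then show ?thesis
    unfolding Basis_prod_def
    by (subst sum.union_disjoint) (auto simp: Basis_prod_def sum.reindex)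
qed

text \<open>The function is constant along the ray through \<open>x\<close>, so its derivative along
  \<open>x\<close> vanishes. As \<open>x\<close> is not a coordinate direction, the total derivative
  is needed to write this as a sum of partial derivatives.\<close>

lemma euler_identity:
  assumes g: "smooth_on (punctured R) g" and "r > R" "x \<noteq> 0"
    and "\<And>c. c > 0 \<Longrightarrow> g (r, t, c *\<^sub>R x) = g (r, t, x)"
  shows "(\<Sum>i\<in>UNIV. x $ i * pdiff (dir_x i) g (r, t, x)) = 0"
proof -
  let ?L = "\<lambda>h. \<Sum>b\<in>Basis. (h \<bullet> b) * pdiff b g (r, t, x)"
  have 1: "((\<lambda>s. (r, t, x + s *\<^sub>R x)) has_derivative (\<lambda>s. s *\<^sub>R (0, 0, x))) (at (0 :: real))"
    by (auto intro!: derivative_eq_intros)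
  have "((\<lambda>s. g (r, t, x + s *\<^sub>R x)) has_derivative (\<lambda>s. ?L (s *\<^sub>R (0, 0, x)))) (at (0::real))"
    by (rule has_derivative_compose[OF 1]) (use smooth_on_has_derivative[OF g, of "(r, t, x)"] assms in simp)
  moreover have "(\<lambda>s. ?L (s *\<^sub>R (0, 0, x))) = (\<lambda>s. ?L (0, 0, x) * s)"
    by (simp add: fun_eq_iff sum_distrib_left inner_scaleR_left mult_ac del: scaleR_Pair)
  ultimately have "((\<lambda>s. g (r, t, x + s *\<^sub>R x)) has_real_derivative ?L (0, 0, x)) (at 0)"
    by (simp add: has_field_derivative_def)
  moreover have "((\<lambda>s. g (r, t, x + s *\<^sub>R x)) has_real_derivative 0) (at 0)"
  proof -
    have "\<forall>\<^sub>F s in nhds (0::real). s \<in> {-1<..}" by (rule eventually_nhds_in_open) auto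
    then have "\<forall>\<^sub>F s in nhds 0. g (r, t, x + s *\<^sub>R x) = g (r, t, x)"
    proof eventually_elim
      case (elim s)
      then show ?case using assms(4)[of "1 + s"] by (simp add: scaleR_left_distrib)
    qed
    from DERIV_cong_ev[OF refl this refl] show ?thesis by simp
  qed
  ultimately have "?L (0, 0, x) = 0" by (rule DERIV_unique)
  then show ?thesis
    unfolding sum_Basis_prod sum_Basis_vec by (simp add: inner_axis zero_prod_def)
qed

subsection \<open>Calculus on Schwarzschild--de Sitter\<close>

text \<open>The relational form lets a derivative be assembled by rules whose value is found on the
  way; \<open>has_pdiff_imp\<close> then compares that value with the desired one.\<close>

definition has_pdiff :: "'a::real_normed_vector \<Rightarrow> ('a \<Rightarrow> real) \<Rightarrow> 'a \<Rightarrow> real \<Rightarrow> bool" where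
  "has_pdiff v f p d \<longleftrightarrow> ((\<lambda>s. f (p + s *\<^sub>R v)) has_real_derivative d) (at 0)"

lemma has_pdiff_imp: "has_pdiff v f p d \<Longrightarrow> d = e \<Longrightarrow> pdiff v f p = e"
  by (auto simp: has_pdiff_def pdiff_def DERIV_imp_deriv)

lemma has_pdiff_smooth: "smooth_on U f \<Longrightarrow> p \<in> U \<Longrightarrow> v \<in> Basis \<Longrightarrow> has_pdiff v f p (pdiff v f p)"
  unfolding has_pdiff_def by (rule smooth_on_has_pdiff)

lemma has_pdiff_const: "has_pdiff v (\<lambda>_. c) p 0"
  by (simp add: has_pdiff_def)

lemma has_pdiff_add: "has_pdiff v f p d \<Longrightarrow> has_pdiff v g p e \<Longrightarrow> has_pdiff v (\<lambda>q. f q + g q) p (d + e)"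
  unfolding has_pdiff_def by (rule DERIV_add)

lemma has_pdiff_diff: "has_pdiff v f p d \<Longrightarrow> has_pdiff v g p e \<Longrightarrow> has_pdiff v (\<lambda>q. f q - g q) p (d - e)"
  unfolding has_pdiff_def by (rule DERIV_diff)

lemma has_pdiff_mult:
  "has_pdiff v f p d \<Longrightarrow> has_pdiff v g p e \<Longrightarrow> has_pdiff v (\<lambda>q. f q * g q) p (d * g p + f p * e)"
  unfolding has_pdiff_def by (drule (1) DERIV_mult) (simp add: mult.commute)

lemma has_pdiff_power:
  "has_pdiff v f p d \<Longrightarrow> has_pdiff v (\<lambda>q. f q ^ n) p (real n * f p ^ (n - 1) * d)"
  unfolding has_pdiff_def by (drule DERIV_power[where n=n]) (simp add: mult_ac)

lemma has_pdiff_sum: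
  "(\<And>i. i \<in> I \<Longrightarrow> has_pdiff v (f i) p (d i)) \<Longrightarrow> has_pdiff v (\<lambda>q. \<Sum>i\<in>I. f i q) p (\<Sum>i\<in>I. d i)"
  unfolding has_pdiff_def by (rule DERIV_sum)

lemma has_pdiff_radial:
  assumes "(g has_real_derivative d) (at (fst p))" shows "has_pdiff dir_r (\<lambda>q. g (fst q)) p d"
  using DERIV_shift[of g d 0 "fst p"] assms by (simp add: has_pdiff_def add.commute)

lemma has_pdiff_radial_tangential: "fst v = 0 \<Longrightarrow> has_pdiff v (\<lambda>q. g (fst q)) p 0"
  by (simp add: has_pdiff_def)

text \<open>For functions constant along rays, \<open>rho2\<close> times the Euclidean Laplacian is
  the spherical Laplacian at \<open>x / norm x\<close>, and \<open>rho2\<close> times the squared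
  Euclidean gradient is the squared spherical gradient.\<close>

definition rho2 :: "real \<times> real \<times> (real^3) \<Rightarrow> real" where "rho2 p = snd (snd p) \<bullet> snd (snd p)"

lemma has_pdiff_rho2:
  "has_pdiff dir_r rho2 p 0" "has_pdiff dir_t rho2 p 0" "has_pdiff (dir_x i) rho2 p (2 * snd (snd p) $ i)"
proof -
  have eq: "rho2 (p + u *\<^sub>R dir_x i) = rho2 p + 2 * u * snd (snd p) $ i + u\<^sup>2" for u
    by (simp add: rho2_def inner_add_left inner_add_right inner_axis inner_axis' power2_eq_square algebra_simps)
  show "has_pdiff (dir_x i) rho2 p (2 * snd (snd p) $ i)"
    unfolding has_pdiff_def eq by (rule derivative_eq_intros refl | simp)+
qed (simp_all add: has_pdiff_def rho2_def)

lemma smooth_on_fst: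
  assumes "open U" shows "smooth_on U (\<lambda>p :: real \<times> real \<times> (real^3). fst p)"
proof -
  have "p \<bullet> dir_r = fst p" for p :: "real \<times> real \<times> (real^3)" by (simp add: inner_prod_def)
  then show ?thesis using smooth_on_inner[OF assms, of dir_r] by simp
qed

lemma smooth_on_rho2:
  assumes "open U" shows "smooth_on U rho2"
proof -
  have 1: "p \<bullet> dir_x i = snd (snd p) $ i" for p and i by (simp add: inner_prod_def inner_axis)
  have 2: "rho2 = (\<lambda>p. \<Sum>i\<in>UNIV. (p \<bullet> dir_x i) ^ 2)"
    unfolding 1 by (simp add: fun_eq_iff rho2_def inner_vec_def power2_eq_square)
  show ?thesis
    unfolding 2 by (rule smooth_on_sum[OF finite assms]) (rule smooth_on_power[OF smooth_on_inner[OF assms]])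
qed

lemma open_punctured: "open (punctured R)"
proof -
  have "punctured R = {p. fst p > R} \<inter> {p. snd (snd p) \<noteq> 0}" by auto
  then show ?thesis
    by (simp only:) (intro open_Int open_Collect_less open_Collect_neq continuous_intros)
qed

definition laplace_x :: "(real \<times> real \<times> (real^3) \<Rightarrow> real) \<Rightarrow> real \<times> real \<times> (real^3) \<Rightarrow> real" where
  "laplace_x f p = (\<Sum>i\<in>UNIV. pdiff (dir_x i) (pdiff (dir_x i) f) p)"

lemma pdiff_pdiff_cong:
  fixes f g :: "'a::real_normed_vector \<Rightarrow> real"
  assumes "open U" "p \<in> U" "\<And>q. q \<in> U \<Longrightarrow> f q = g q"
  shows "pdiff v (pdiff w f) p = pdiff v (pdiff w g) p"
  by (rule pdiff_cong[OF assms(1,2)]) (rule pdiff_cong[OF assms(1) _ assms(3)])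

lemma pdiff_commute2:
  assumes "smooth_on U f" "p \<in> U" "v \<in> Basis" "w \<in> Basis"
  shows "pdiff v (pdiff w (pdiff w f)) p = pdiff w (pdiff w (pdiff v f)) p"
proof -
  have "pdiff v (pdiff w (pdiff w f)) p = pdiff w (pdiff v (pdiff w f)) p"
    by (rule pdiff_commute[OF smooth_on_pdiff[OF assms(1,4)] assms(2,3,4)])
  also have "\<dots> = pdiff w (pdiff w (pdiff v f)) p"
    by (rule pdiff_cong[OF smooth_on_open[OF assms(1)] assms(2)]) (rule pdiff_commute[OF assms(1) _ assms(3,4)])
  finally show ?thesis .
qed

lemma pdiff_radial_mult:
  assumes "smooth_on U f" "p \<in> U" "v \<in> Basis" "fst v = 0"
  shows "pdiff v (\<lambda>q. g (fst q) * f q) p = g (fst p) * pdiff v f p"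
  by (rule has_pdiff_imp[OF has_pdiff_mult[OF has_pdiff_radial_tangential[OF assms(4)] has_pdiff_smooth[OF assms(1-3)]]]) simp

lemma pdiff_pdiff_radial_mult:
  assumes "smooth_on U f" "p \<in> U" "v \<in> Basis" "fst v = 0"
  shows "pdiff v (pdiff v (\<lambda>q. g (fst q) * f q)) p = g (fst p) * pdiff v (pdiff v f) p"
proof -
  have "pdiff v (pdiff v (\<lambda>q. g (fst q) * f q)) p = pdiff v (\<lambda>q. g (fst q) * pdiff v f q) p"
    by (rule pdiff_cong[OF smooth_on_open[OF assms(1)] assms(2)]) (rule pdiff_radial_mult[OF assms(1) _ assms(3,4)])
  also have "\<dots> = g (fst p) * pdiff v (pdiff v f) p"
    by (rule pdiff_radial_mult[OF smooth_on_pdiff[OF assms(1,3)] assms(2-4)])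
  finally show ?thesis .
qed

locale sds =
  fixes \<Lambda> m :: real
  assumes \<Lambda>: "\<Lambda> > 0" and m: "m > 0" and subextremal: "3 * m < 1 / sqrt \<Lambda>"
begin

abbreviation "D \<equiv> SdS_D \<Lambda> m"
abbreviation "rC \<equiv> SdS_rC \<Lambda> m"

text \<open>The origin of \<open>qq\<close> is the identity
  \<open>(D r / r^2)' = qq r / r^3\<close>. Since \<open>sg\<close> is the inverse square root of
  \<open>D r / r^2\<close>, its derivative is a polynomial in \<open>qq\<close>, \<open>sg\<close>,
  \<open>io\<close>, and these three functions, with \<open>m\<close>, generate all coefficients
  below.\<close>

definition sg :: "real \<Rightarrow> real" where "sg r = r * (1 / sqrt (D r))"
definition io :: "real \<Rightarrow> real" where "io r = 1 / r"
definition qq :: "real \<Rightarrow> real" where "qq r = 2 - 6 * m * io r"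

text \<open>In the variable \<open>y = 1 / r\<close> the quotient is
  \<open>\<Lambda> / 3 - y^2 + 2 m y^3\<close>, decreasing as long as \<open>3 m y \<le> 1\<close>.
  The proof factors \<open>y - z\<close> out of the difference of two values.\<close>

lemma D_over_r2_strict_mono:
  assumes "3 * m \<le> r" "r < s" shows "D r / r\<^sup>2 < D s / s\<^sup>2"
proof -
  define y where "y = 1 / r" define z where "z = 1 / s"
  have pos: "r > 0" "s > 0" using assms m by auto
  have yz: "z < y" "z > 0" using pos assms by (simp_all add: y_def z_def frac_less2)
  have y3: "3 * m * y \<le> 1" using assms pos by (simp add: y_def field_simps)
  have eq: "D r / r\<^sup>2 = \<Lambda> / 3 - y\<^sup>2 + 2 * m * y ^ 3" "D s / s\<^sup>2 = \<Lambda> / 3 - z\<^sup>2 + 2 * m * z ^ 3"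
    using pos by (simp_all add: SdS_D_def y_def z_def field_simps power2_eq_square power3_eq_cube)
  have "2 * m * (y\<^sup>2 + y * z + z\<^sup>2) < y + z"
  proof -
    define a b c where "a = 3 * m * (y * y)" and "b = 3 * m * (y * z)" and "c = 3 * m * (z * z)"
    have "a \<le> y" "b \<le> z"
      using mult_right_mono[OF y3, of y] mult_right_mono[OF y3, of z] yz by (simp_all add: a_def b_def mult_ac)
    moreover have "c < b" using yz m by (simp add: b_def c_def)
    ultimately have "2 * a + 2 * b + 2 * c < 3 * y + 3 * z" using yz by argo
    moreover have "3 * (2 * m * (y\<^sup>2 + y * z + z\<^sup>2)) = 2 * a + 2 * b + 2 * c"
      by (simp add: power2_eq_square algebra_simps a_def b_def c_def)
    ultimately show ?thesis by simp
  qed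
  then have "(y - z) * (2 * m * (y\<^sup>2 + y * z + z\<^sup>2)) < (y - z) * (y + z)" using yz by simp
  then show ?thesis unfolding eq by (simp add: power2_eq_square power3_eq_cube algebra_simps)
qed

text \<open>The value is \<open>3 \<Lambda> m^2 - 1/3\<close>, negative precisely because of
  subextremality.\<close>

lemma D_3m_neg: "D (3 * m) < 0"
proof -
  have "3 * m * sqrt \<Lambda> < 1" using subextremal \<Lambda> by (simp add: field_simps)
  then have "(3 * m * sqrt \<Lambda>)\<^sup>2 < 1" using m \<Lambda> by (simp add: power_less_one_iff)
  then have "9 * m\<^sup>2 * \<Lambda> < 1" using \<Lambda> by (simp add: power_mult_distrib)
  then show ?thesis using m by (simp add: SdS_D_def power2_eq_square field_simps)
qed

text \<open>\<open>D\<close> is negative at \<open>3 m\<close>, and \<open>D / r^2\<close> increases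
  strictly from there on, so \<open>D\<close> has exactly one root beyond \<open>3 m\<close>. It is
  the greatest root, which also shows that the \<open>GREATEST\<close> in the definition is
  attained.\<close>

lemma rC_root: "rC > 3 * m" "D rC = 0"
proof -
  \<comment> \<open>This \<open>R\<close> satisfies \<open>R > 1\<close> and
    \<open>R * \<Lambda> > 3\<close>, so the quadratic term of \<open>D R\<close> already exceeds
    1.\<close>
  define R where "R = 3 * m + 3 / \<Lambda> + 1"
  have R: "R > 3 * m" "R > 1" "R * \<Lambda> > 3" using \<Lambda> m by (simp_all add: R_def field_simps add_pos_pos)
  have "R * \<Lambda> * R > 3 * 1" using R by (intro mult_strict_mono) auto
  moreover have "2 * m / R > 0" "\<Lambda> / 3 * R\<^sup>2 = R * \<Lambda> * R / 3" using R m by (simp_all add: power2_eq_square)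
  ultimately have "D R \<ge> 0" unfolding SdS_D_def by linarith
  moreover have "continuous_on {3 * m..R} D" unfolding SdS_D_def[abs_def]
    using m by (auto intro!: continuous_intros)
  ultimately obtain z where z: "3 * m \<le> z" "z \<le> R" "D z = 0"
    using IVT'[of D "3 * m" 0 R] D_3m_neg R by auto
  have z3: "z > 3 * m" using z D_3m_neg by (cases "z = 3 * m") auto
  have "rC = z" unfolding SdS_rC_def
  proof (rule Greatest_equality)
    show "z > 0 \<and> D z = 0" using z z3 m by simp
    fix y assume y: "y > 0 \<and> D y = 0"
    show "y \<le> z"
    proof (rule ccontr)
      assume "\<not> y \<le> z"
      then have "D z / z\<^sup>2 < D y / y\<^sup>2" using z3 by (intro D_over_r2_strict_mono) auto
      then show False using y z by simp
    qed
  qed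
  then show "rC > 3 * m" "D rC = 0" using z z3 by auto
qed

lemma beyond_rC:
  assumes "r > rC" shows "r > 0" "r > 3 * m" "D r > 0"
proof -
  show r: "r > 0" "r > 3 * m" using assms rC_root m by auto
  have "D rC / rC\<^sup>2 < D r / r\<^sup>2" using assms rC_root by (intro D_over_r2_strict_mono) auto
  then show "D r > 0" using rC_root r by (simp add: zero_less_divide_iff)
qed

lemma io_deriv: "r > rC \<Longrightarrow> (io has_real_derivative - (io r)\<^sup>2) (at r)"
  unfolding io_def[abs_def] using beyond_rC[of r]
  by (auto intro!: derivative_eq_intros simp: power2_eq_square)

lemma qq_deriv: "r > rC \<Longrightarrow> (qq has_real_derivative 6 * m * (io r)\<^sup>2) (at r)"
  unfolding qq_def[abs_def] by (auto intro!: derivative_eq_intros io_deriv)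

lemma sg_pos: "r > rC \<Longrightarrow> sg r > 0"
  using beyond_rC[of r] by (simp add: sg_def)

lemma sg_square: "r > rC \<Longrightarrow> (sg r)\<^sup>2 = r\<^sup>2 / D r"
  using beyond_rC[of r] by (simp add: sg_def power_divide)

lemma sg_deriv:
  assumes "r > rC" shows "(sg has_real_derivative - (qq r * sg r ^ 3 * io r ^ 3 / 2)) (at r)"
proof -
  note pos = beyond_rC[OF assms]
  have dD: "(D has_real_derivative (\<Lambda> / 3 * (2 * r) - 2 * m / r\<^sup>2)) (at r)"
    unfolding SdS_D_def[abs_def] using pos
    by (auto intro!: derivative_eq_intros simp: power2_eq_square field_simps)
  define w where "w = sqrt (D r)"
  have w: "w > 0" "D r = w * w" using pos by (simp_all add: w_def)
  have "(sg has_real_derivative 1 / w - r * ((\<Lambda> / 3 * (2 * r) - 2 * m / r\<^sup>2) * (inverse w / 2)) / (w * w)) (at r)"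
    unfolding sg_def[abs_def]
    by (rule derivative_eq_intros dD refl | use pos w_def in simp)+
  then show ?thesis
  proof (rule DERIV_cong)
    \<comment> \<open>The terms with \<Lambda> cancel in \<open>2 D - r D'\<close>; hence
      \<open>qq\<close> depends on \<open>m\<close> and \<open>r\<close> only.\<close>
    have "2 * D r - r * (\<Lambda> / 3 * (2 * r) - 2 * m / r\<^sup>2) = - qq r"
      using pos by (simp add: SdS_D_def qq_def io_def power2_eq_square field_simps)
    then have *: "2 * (w * w) - r * (\<Lambda> / 3 * (2 * r) - 2 * m / r\<^sup>2) = - qq r" by (simp add: w)
    have "1 / w - r * ((\<Lambda> / 3 * (2 * r) - 2 * m / r\<^sup>2) * (inverse w / 2)) / (w * w)
      = (2 * (w * w) - r * (\<Lambda> / 3 * (2 * r) - 2 * m / r\<^sup>2)) / (2 * w ^ 3)"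
      using w(1) by (simp add: divide_simps power3_eq_cube)
    also have "\<dots> = - (qq r * sg r ^ 3 * io r ^ 3 / 2)"
      unfolding * using pos w by (simp add: sg_def io_def power_divide power_mult_distrib flip: w_def)
    finally show "1 / w - r * ((\<Lambda> / 3 * (2 * r) - 2 * m / r\<^sup>2) * (inverse w / 2)) / (w * w)
      = - (qq r * sg r ^ 3 * io r ^ 3 / 2)" .
  qed
qed

abbreviation "U \<equiv> punctured rC"

lemma smooth_io: "smooth_on U (\<lambda>p. io (fst p))"
proof -
  \<comment> \<open>Writing \<open>1 / r\<close> as an inverse square root reduces it to the closure
    rule that \<open>sg\<close> needs anyway.\<close>
  have "smooth_on U (\<lambda>p. 1 / sqrt (fst p * fst p))"
    by (intro smooth_on_rsqrt smooth_on_mult smooth_on_fst open_punctured) (use beyond_rC in fastforce)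
  then show ?thesis by (rule smooth_on_cong) (use beyond_rC(1) in \<open>force simp: io_def\<close>)
qed

lemma smooth_D: "smooth_on U (\<lambda>p. D (fst p))"
proof -
  have "smooth_on U (\<lambda>p. \<Lambda> / 3 * (fst p)\<^sup>2 - 1 + 2 * m * io (fst p))"
    by (intro smooth_on_add smooth_on_diff smooth_on_mult smooth_on_const smooth_on_power smooth_on_fst open_punctured smooth_io)
  then show ?thesis by (rule smooth_on_cong) (simp add: SdS_D_def io_def)
qed

lemma smooth_qq: "smooth_on U (\<lambda>p. qq (fst p))"
  unfolding qq_def by (intro smooth_on_diff smooth_on_mult smooth_on_const open_punctured smooth_io)

lemma smooth_sg: "smooth_on U (\<lambda>p. sg (fst p))"
  unfolding sg_def
  by (intro smooth_on_mult smooth_on_rsqrt smooth_on_fst open_punctured smooth_D) (use beyond_rC in auto)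

lemmas smooth_intros = smooth_on_add smooth_on_diff smooth_on_mult smooth_on_power
  smooth_io smooth_qq smooth_sg smooth_on_rho2[OF open_punctured] smooth_on_const[OF open_punctured]

lemma coefficient_pdiff:
  assumes "p \<in> U"
  shows "has_pdiff dir_r (\<lambda>q. io (fst q)) p (- (io (fst p))\<^sup>2)"
    "has_pdiff dir_r (\<lambda>q. qq (fst q)) p (6 * m * (io (fst p))\<^sup>2)"
    "has_pdiff dir_r (\<lambda>q. sg (fst q)) p (- (qq (fst p) * sg (fst p) ^ 3 * io (fst p) ^ 3 / 2))"
  using assms by (auto intro!: has_pdiff_radial io_deriv qq_deriv sg_deriv)

lemma coefficient_pdiff_tangential:
  assumes "fst v = 0"
  shows "has_pdiff v (\<lambda>q. io (fst q)) p 0" "has_pdiff v (\<lambda>q. qq (fst q)) p 0" "has_pdiff v (\<lambda>q. sg (fst q)) p 0"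
  using assms by (auto intro: has_pdiff_radial_tangential)

end

subsection \<open>Energy identities\<close>

context sds
begin

definition kp :: "real \<Rightarrow> real" where "kp r = sg r * (io r)\<^sup>2"

lemma smooth_kp: "smooth_on U (\<lambda>p. kp (fst p))"
  unfolding kp_def by (intro smooth_intros)

lemma kp_pos: "r > rC \<Longrightarrow> kp r > 0"
  using sg_pos[of r] beyond_rC(1)[of r] by (simp add: kp_def io_def)

lemma has_pdiff_kp_tangential: "fst v = 0 \<Longrightarrow> has_pdiff v (\<lambda>q. kp (fst q)) p 0"
  by (rule has_pdiff_radial_tangential)

lemmas has_pdiff_rules = has_pdiff_const has_pdiff_add has_pdiff_diff has_pdiff_mult has_pdiff_power has_pdiff_sum

lemma pdiff_r_tangential:
  assumes \<phi>: "smooth_on U \<phi>" and a: "smooth_on U a" and p: "p \<in> U" and v: "v \<in> Basis" "fst v = 0"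
    and \<phi>_r: "\<And>q. q \<in> U \<Longrightarrow> pdiff dir_r \<phi> q = g (fst q) * a q"
  shows "pdiff dir_r (pdiff v \<phi>) p = g (fst p) * pdiff v a p"
proof -
  have "pdiff dir_r (pdiff v \<phi>) p = pdiff v (pdiff dir_r \<phi>) p"
    by (rule pdiff_commute[OF \<phi> p]) (use v in auto)
  also have "\<dots> = pdiff v (\<lambda>q. g (fst q) * a q) p"
    by (rule pdiff_cong[OF open_punctured p \<phi>_r])
  also have "\<dots> = g (fst p) * pdiff v a p" by (rule pdiff_radial_mult[OF a p v])
  finally show ?thesis .
qed

lemma pdiff_r_tangential2:
  assumes \<phi>: "smooth_on U \<phi>" and a: "smooth_on U a" and p: "p \<in> U" and v: "v \<in> Basis" "fst v = 0"
    and \<phi>_r: "\<And>q. q \<in> U \<Longrightarrow> pdiff dir_r \<phi> q = g (fst q) * a q"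
  shows "pdiff dir_r (pdiff v (pdiff v \<phi>)) p = g (fst p) * pdiff v (pdiff v a) p"
proof -
  have "pdiff dir_r (pdiff v (pdiff v \<phi>)) p = pdiff v (pdiff v (pdiff dir_r \<phi>)) p"
    by (rule pdiff_commute2[OF \<phi> p]) (use v in auto)
  also have "\<dots> = pdiff v (pdiff v (\<lambda>q. g (fst q) * a q)) p"
    by (rule pdiff_pdiff_cong[OF open_punctured p \<phi>_r])
  also have "\<dots> = g (fst p) * pdiff v (pdiff v a) p" by (rule pdiff_pdiff_radial_mult[OF a p v])
  finally show ?thesis .
qed

lemma smooth_laplace_x: "smooth_on U \<phi> \<Longrightarrow> smooth_on U (laplace_x \<phi>)"
  unfolding laplace_x_def[abs_def] by (intro smooth_on_sum open_punctured smooth_on_pdiff) auto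

lemma pdiff_r_laplace_x:
  assumes \<phi>: "smooth_on U \<phi>" and a: "smooth_on U a" and p: "p \<in> U"
    and \<phi>_r: "\<And>q. q \<in> U \<Longrightarrow> pdiff dir_r \<phi> q = g (fst q) * a q"
  shows "pdiff dir_r (laplace_x \<phi>) p = g (fst p) * laplace_x a p"
proof -
  have "pdiff dir_r (laplace_x \<phi>) p = (\<Sum>i\<in>UNIV. pdiff dir_r (pdiff (dir_x i) (pdiff (dir_x i) \<phi>)) p)"
    unfolding laplace_x_def[abs_def]
    by (rule pdiff_sum[where U=U]) (use p \<phi> in \<open>auto intro!: smooth_on_pdiff\<close>)
  also have "\<dots> = (\<Sum>i\<in>UNIV. g (fst p) * pdiff (dir_x i) (pdiff (dir_x i) a) p)"
    by (intro sum.cong refl pdiff_r_tangential2[OF \<phi> a p _ _ \<phi>_r]) auto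
  finally show ?thesis by (simp add: laplace_x_def sum_distrib_left)
qed

text \<open>With \<open>a = Yf \<phi>\<close> this is the integrand of the energy. The argument
  \<open>a\<close> is separate so that \<open>z\<close> can stand for \<open>Yf f\<close>.\<close>

definition edensity where
  "edensity a \<phi> q = (a q)\<^sup>2 + (sg (fst q))\<^sup>2 * (pdiff dir_t \<phi> q)\<^sup>2 + rho2 q * (\<Sum>i\<in>UNIV. (pdiff (dir_x i) \<phi> q)\<^sup>2)"

definition eflux where
  "eflux a \<phi> q = 2 * kp (fst q) * (sg (fst q))\<^sup>2 * (a q * pdiff dir_t \<phi> q)"

definition aflux where
  "aflux a \<phi> i q = 2 * kp (fst q) * (rho2 q * (a q * pdiff (dir_x i) \<phi> q))"

definition cross where "cross P \<phi> \<psi> q = P (fst q) * (pdiff dir_t \<phi> q * pdiff dir_t \<psi> q)"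

definition cflux where "cflux P a \<psi> q = kp (fst q) * P (fst q) * (a q * pdiff dir_t \<psi> q)"

text \<open>The multiplier is \<open>2 a\<close>. Together with
  \<open>pdiff dir_r \<phi> = kp a\<close>, the second-order terms combine into exact t- and
  x-derivatives. The term with \<open>qq\<close> comes from the r-derivative of \<open>sg^2\<close>;
  \<open>S\<close> collects whatever the equation adds to the principal part.\<close>

lemma energy_identity:
  assumes \<phi>: "smooth_on U \<phi>" and a: "smooth_on U a" and p: "p \<in> U"
    and \<phi>_r': "\<forall>q\<in>U. pdiff dir_r \<phi> q = kp (fst q) * a q"
    and a_r: "pdiff dir_r a p = kp (fst p) * ((sg (fst p))\<^sup>2 * pdiff dir_t (pdiff dir_t \<phi>) p + rho2 p * laplace_x \<phi> p + S)"
    and euler: "(\<Sum>i\<in>UNIV. snd (snd p) $ i * pdiff (dir_x i) \<phi> p) = 0"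
  shows "pdiff dir_r (edensity a \<phi>) p = pdiff dir_t (eflux a \<phi>) p + (\<Sum>i\<in>UNIV. pdiff (dir_x i) (aflux a \<phi> i) p)
    + kp (fst p) * (2 * a p * S - qq (fst p) * sg (fst p) ^ 3 * io (fst p) * (pdiff dir_t \<phi> p)\<^sup>2)"
proof -
  note \<phi>_r = bspec[OF \<phi>_r']
  let ?k = "kp (fst p)" and ?s = "sg (fst p)" and ?i = "io (fst p)" and ?q = "qq (fst p)"
  have sm: "smooth_on U (pdiff dir_t \<phi>)" "smooth_on U (pdiff (dir_x i) \<phi>)" for i
    using \<phi> by (auto intro: smooth_on_pdiff)
  note has = has_pdiff_smooth[OF a p] has_pdiff_smooth[OF sm(1) p] has_pdiff_smooth[OF sm(2) p]
  have t: "pdiff dir_r (pdiff dir_t \<phi>) p = ?k * pdiff dir_t a p"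
    by (rule pdiff_r_tangential[OF \<phi> a p _ _ \<phi>_r]) auto
  have x: "pdiff dir_r (pdiff (dir_x i) \<phi>) p = ?k * pdiff (dir_x i) a p" for i
    by (rule pdiff_r_tangential[OF \<phi> a p _ _ \<phi>_r]) auto
  have 1: "pdiff dir_r (edensity a \<phi>) p = 2 * a p * pdiff dir_r a p
      + (2 * ?s * - (?q * ?s ^ 3 * ?i ^ 3 / 2) * (pdiff dir_t \<phi> p)\<^sup>2 + ?s\<^sup>2 * (2 * pdiff dir_t \<phi> p * (?k * pdiff dir_t a p)))
      + rho2 p * (\<Sum>i\<in>UNIV. 2 * pdiff (dir_x i) \<phi> p * (?k * pdiff (dir_x i) a p))"
    unfolding edensity_def[abs_def]
    by (rule has_pdiff_imp, (rule has_pdiff_rules coefficient_pdiff[OF p] has_pdiff_rho2 has dir_in_Basis)+)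
      (simp add: t x)
  have 2: "pdiff dir_t (eflux a \<phi>) p =
     2 * ?k * ?s\<^sup>2 * (pdiff dir_t a p * pdiff dir_t \<phi> p + a p * pdiff dir_t (pdiff dir_t \<phi>) p)"
    unfolding eflux_def[abs_def]
    by (rule has_pdiff_imp, (rule has_pdiff_rules has_pdiff_kp_tangential coefficient_pdiff_tangential has dir_in_Basis | simp)+)
  \<comment> \<open>The derivative of \<open>rho2\<close> contributes a multiple of
    \<open>x $ i * pdiff (dir_x i) \<phi> p\<close>, whose sum over \<open>i\<close> is zero by
    Euler's identity.\<close>
  have 3: "pdiff (dir_x i) (aflux a \<phi> i) p =
     2 * ?k * (2 * a p * (snd (snd p) $ i * pdiff (dir_x i) \<phi> p)
        + rho2 p * (pdiff (dir_x i) a p * pdiff (dir_x i) \<phi> p + a p * pdiff (dir_x i) (pdiff (dir_x i) \<phi>) p))" for i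
    unfolding aflux_def[abs_def]
    by (rule has_pdiff_imp, (rule has_pdiff_rules has_pdiff_kp_tangential has_pdiff_rho2 has dir_in_Basis | simp add: algebra_simps)+)
  have 4: "(\<Sum>i\<in>UNIV. pdiff (dir_x i) (aflux a \<phi> i) p) = 2 * ?k * (2 * a p * (\<Sum>i\<in>UNIV. snd (snd p) $ i * pdiff (dir_x i) \<phi> p)
      + rho2 p * ((\<Sum>i\<in>UNIV. pdiff (dir_x i) a p * pdiff (dir_x i) \<phi> p) + a p * laplace_x \<phi> p))"
    unfolding 3 laplace_x_def by (simp add: sum.distrib flip: sum_distrib_left)
  have 5: "(\<Sum>i\<in>UNIV. 2 * pdiff (dir_x i) \<phi> p * (?k * pdiff (dir_x i) a p))
     = 2 * ?k * (\<Sum>i\<in>UNIV. pdiff (dir_x i) a p * pdiff (dir_x i) \<phi> p)"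
    by (simp add: sum_distrib_left mult_ac)
  show ?thesis
    unfolding 1 2 4 5 euler a_r by (simp add: kp_def algebra_simps power2_eq_square power3_eq_cube)
qed

text \<open>The term \<open>- P a \<psi>_tt\<close> on the right is the one that a source
  \<open>- P / 2 * \<psi>_tt\<close> creates in the energy identity for \<open>a\<close>.
  Subtracting the cross term removes it, at the price of products of first derivatives.\<close>

lemma cross_identity:
  assumes \<phi>: "smooth_on U \<phi>" and a: "smooth_on U a" and \<psi>: "smooth_on U \<psi>" and b: "smooth_on U b" and p: "p \<in> U"
    and \<phi>_r': "\<forall>q\<in>U. pdiff dir_r \<phi> q = kp (fst q) * a q"
    and \<psi>_r': "\<forall>q\<in>U. pdiff dir_r \<psi> q = kp (fst q) * b q"
    and P: "has_pdiff dir_r (\<lambda>q. P (fst q)) p (kp (fst p) * Q)"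
  shows "pdiff dir_r (cross P \<phi> \<psi>) p = pdiff dir_t (cflux P a \<psi>) p
    + kp (fst p) * (Q * (pdiff dir_t \<phi> p * pdiff dir_t \<psi> p) + P (fst p) * (pdiff dir_t \<phi> p * pdiff dir_t b p)
        - P (fst p) * (a p * pdiff dir_t (pdiff dir_t \<psi>) p))"
proof -
  note \<phi>_r = bspec[OF \<phi>_r'] and \<psi>_r = bspec[OF \<psi>_r']
  let ?k = "kp (fst p)"
  have sm: "smooth_on U (pdiff dir_t \<phi>)" "smooth_on U (pdiff dir_t \<psi>)"
    using \<phi> \<psi> by (auto intro: smooth_on_pdiff)
  note has = has_pdiff_smooth[OF a p] has_pdiff_smooth[OF sm(1) p] has_pdiff_smooth[OF sm(2) p]
  have t: "pdiff dir_r (pdiff dir_t \<phi>) p = ?k * pdiff dir_t a p"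
    by (rule pdiff_r_tangential[OF \<phi> a p _ _ \<phi>_r]) auto
  have t': "pdiff dir_r (pdiff dir_t \<psi>) p = ?k * pdiff dir_t b p"
    by (rule pdiff_r_tangential[OF \<psi> b p _ _ \<psi>_r]) auto
  have 1: "pdiff dir_r (cross P \<phi> \<psi>) p = ?k * Q * (pdiff dir_t \<phi> p * pdiff dir_t \<psi> p)
     + P (fst p) * (?k * pdiff dir_t a p * pdiff dir_t \<psi> p + pdiff dir_t \<phi> p * (?k * pdiff dir_t b p))"
    unfolding cross_def[abs_def]
    by (rule has_pdiff_imp, (rule has_pdiff_mult P has dir_in_Basis)+) (simp add: t t')
  have 2: "pdiff dir_t (cflux P a \<psi>) p = ?k * P (fst p) * (pdiff dir_t a p * pdiff dir_t \<psi> p + a p * pdiff dir_t (pdiff dir_t \<psi>) p)"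
    unfolding cflux_def[abs_def]
    by (rule has_pdiff_imp, (rule has_pdiff_mult has_pdiff_kp_tangential has_pdiff_radial_tangential[where g=P] has dir_in_Basis | simp)+)
  show ?thesis unfolding 1 2 by (simp add: algebra_simps)
qed

lemma smooth_densities:
  assumes "smooth_on U \<phi>" "smooth_on U a" "smooth_on U \<psi>" "smooth_on U (\<lambda>q. P (fst q))"
  shows "smooth_on U (edensity a \<phi>)" "smooth_on U (eflux a \<phi>)" "smooth_on U (aflux a \<phi> i)"
    "smooth_on U (cross P \<phi> \<psi>)" "smooth_on U (cflux P a \<psi>)"
proof -
  have s: "smooth_on U (\<lambda>q. pdiff dir_t \<phi> q)" "smooth_on U (\<lambda>q. pdiff dir_t \<psi> q)" "smooth_on U (\<lambda>q. pdiff (dir_x i) \<phi> q)"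
    "smooth_on U (\<lambda>q. a q)" for i
    using assms by (auto intro: smooth_on_pdiff)
  show "smooth_on U (edensity a \<phi>)" "smooth_on U (eflux a \<phi>)" "smooth_on U (aflux a \<phi> i)"
    "smooth_on U (cross P \<phi> \<psi>)" "smooth_on U (cflux P a \<psi>)"
    unfolding edensity_def[abs_def] eflux_def[abs_def] aflux_def[abs_def] cross_def[abs_def] cflux_def[abs_def]
    by (intro smooth_intros smooth_kp smooth_on_sum[OF finite open_punctured] s assms(4))+
qed

section \<open>Coefficients of the cross terms\<close>

text \<open>\<open>P1 / 2\<close> is the size of the source \<open>f_tt\<close> in the equation for
  \<open>v\<close>, and \<open>P2 / 2\<close>, \<open>P3 / 2\<close> are those of
  \<open>u_tt\<close> and \<open>f_tt\<close> in the equation for \<open>w\<close>; the halves match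
  the multiplier \<open>2 a\<close>. Each \<open>Q\<close> is the r-derivative of its
  \<open>P\<close> divided by \<open>kp\<close>. That \<open>Q1\<close> is \<open>P3\<close> is no
  accident: the source \<open>P3\<close> arises when \<open>Y\<close> falls on the coefficient
  \<open>P1\<close>.\<close>

definition P1 where "P1 r = 2 * qq r * (sg r)\<^sup>2"
definition P2 where "P2 r = 4 * qq r * sg r ^ 3 * io r"
definition P3 where "P3 r = 2 * (6 * m * sg r - (qq r)\<^sup>2 * sg r ^ 3 * io r)"
definition Q1 where "Q1 r = P3 r"
definition Q2 where "Q2 r = 4 * (6 * m * (sg r)\<^sup>2 * io r - 3 / 2 * (qq r)\<^sup>2 * sg r ^ 4 * (io r)\<^sup>2 - qq r * (sg r)\<^sup>2)"
definition Q3 where "Q3 r = 2 * (- 15 * m * qq r * (sg r)\<^sup>2 * io r + 3 / 2 * qq r ^ 3 * sg r ^ 4 * (io r)\<^sup>2 + (qq r)\<^sup>2 * (sg r)\<^sup>2)"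

lemma has_pdiff_P:
  assumes p: "p \<in> U"
  shows "has_pdiff dir_r (\<lambda>q. P1 (fst q)) p (kp (fst p) * Q1 (fst p))"
    "has_pdiff dir_r (\<lambda>q. P2 (fst q)) p (kp (fst p) * Q2 (fst p))"
    "has_pdiff dir_r (\<lambda>q. P3 (fst q)) p (kp (fst p) * Q3 (fst p))"
proof -
  have trans: "has_pdiff v f p d \<Longrightarrow> d = e \<Longrightarrow> has_pdiff v f p e" for v :: "real \<times> real \<times> (real^3)" and f d e by simp
  show "has_pdiff dir_r (\<lambda>q. P1 (fst q)) p (kp (fst p) * Q1 (fst p))"
    unfolding P1_def
    by (rule trans, (rule has_pdiff_rules coefficient_pdiff[OF p])+)
      (simp add: kp_def Q1_def P3_def power2_eq_square power3_eq_cube power4_eq_xxxx algebra_simps)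
  show "has_pdiff dir_r (\<lambda>q. P2 (fst q)) p (kp (fst p) * Q2 (fst p))"
    unfolding P2_def
    by (rule trans, (rule has_pdiff_rules coefficient_pdiff[OF p])+)
      (simp add: kp_def Q2_def power2_eq_square power3_eq_cube power4_eq_xxxx algebra_simps)
  show "has_pdiff dir_r (\<lambda>q. P3 (fst q)) p (kp (fst p) * Q3 (fst p))"
    unfolding P3_def
    by (rule trans, (rule has_pdiff_rules coefficient_pdiff[OF p])+)
      (simp add: kp_def Q3_def power2_eq_square power3_eq_cube power4_eq_xxxx algebra_simps)
qed

lemma smooth_P: "smooth_on U (\<lambda>q. P1 (fst q))" "smooth_on U (\<lambda>q. P2 (fst q))" "smooth_on U (\<lambda>q. P3 (fst q))"
  unfolding P1_def P2_def P3_def by (intro smooth_intros)+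

text \<open>This is minus \<open>Y\<close> applied to \<open>qq * sg * io / 2\<close>, the
  coefficient with which \<open>v\<close> enters \<open>laplace_u\<close>.\<close>

definition b_coeff :: "real \<Rightarrow> real" where
  "b_coeff r = 1 - 6 * m * io r + (qq r)\<^sup>2 * (sg r)\<^sup>2 * (io r)\<^sup>2 / 4"

definition Xf where "Xf f p = fst p * D (fst p) * pdiff dir_r f p"
definition Yf where "Yf f p = fst p * sqrt (D (fst p)) * pdiff dir_r f p"

lemma Yf_eq: "p \<in> U \<Longrightarrow> pdiff dir_r f p = kp (fst p) * Yf f p"
  using beyond_rC(1,3)[of "fst p"] by (auto simp: Yf_def kp_def sg_def io_def power2_eq_square)

lemma Xf_eq: "p \<in> U \<Longrightarrow> Yf f p = sg (fst p) * io (fst p) * Xf f p"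
  using beyond_rC(1,3)[of "fst p"] by (auto simp: Yf_def Xf_def sg_def io_def real_div_sqrt field_simps)

lemma smooth_Xf: "smooth_on U f \<Longrightarrow> smooth_on U (Xf f)"
  unfolding Xf_def[abs_def]
  by (intro smooth_intros smooth_on_fst open_punctured smooth_D smooth_on_pdiff) auto

lemma smooth_Yf: "smooth_on U f \<Longrightarrow> smooth_on U (Yf f)"
proof -
  assume f: "smooth_on U f"
  \<comment> \<open>The root is written as \<open>D * (1 / sqrt D)\<close>, since only inverse
    square roots have a closure rule.\<close>
  have "smooth_on U (\<lambda>p. fst p * (D (fst p) * (1 / sqrt (D (fst p)))) * pdiff dir_r f p)"
    by (intro smooth_on_mult smooth_on_rsqrt smooth_on_fst open_punctured smooth_D smooth_on_pdiff[OF f])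
      (use beyond_rC in auto)
  then show ?thesis
  proof (rule smooth_on_cong)
    fix p assume "p \<in> U"
    then have "D (fst p) * (1 / sqrt (D (fst p))) = sqrt (D (fst p))"
      using beyond_rC(3)[of "fst p"] by (auto simp: real_div_sqrt)
    then show "fst p * (D (fst p) * (1 / sqrt (D (fst p)))) * pdiff dir_r f p = Yf f p"
      by (simp only: Yf_def)
  qed
qed

end

subsection \<open>The commuted equations\<close>

text \<open>The wave equation multiplied by \<open>r^2\<close> and solved for the spherical
  Laplacian; \<open>f_hom\<close> says that \<open>f\<close> comes from a function on the
  sphere.\<close>

locale wave_solution = sds +
  fixes f :: "real \<times> real \<times> (real^3) \<Rightarrow> real"
  assumes smooth_f: "smooth_on U f"
    and f_hom: "\<And>c r t x. c > 0 \<Longrightarrow> f (r, t, c *\<^sub>R x) = f (r, t, x)"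
    and wave_eq: "\<And>p. p \<in> U \<Longrightarrow> rho2 p * laplace_x f p =
      Xf f p + fst p * pdiff dir_r (Xf f) p - (sg (fst p))\<^sup>2 * pdiff dir_t (pdiff dir_t f) p"
begin

definition "u = Xf f"
definition "v = Yf u"
definition "w = Yf v"
text \<open>On the region this is \<open>Yf f\<close>. In this form its tangential derivatives are
  multiples of those of \<open>u\<close>, so they are controlled by the next energy in the
  hierarchy.\<close>

definition "z q = sg (fst q) * io (fst q) * u q"

lemma smooth_u: "smooth_on U u" and smooth_v: "smooth_on U v" and smooth_w: "smooth_on U w" and smooth_z: "smooth_on U z"
proof -
  show u: "smooth_on U u" unfolding u_def by (rule smooth_Xf[OF smooth_f])
  show v: "smooth_on U v" unfolding v_def by (rule smooth_Yf[OF u])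
  show "smooth_on U w" unfolding w_def by (rule smooth_Yf[OF v])
  show "smooth_on U z" unfolding z_def[abs_def] by (intro smooth_intros u)
qed

lemma f_r: "q \<in> U \<Longrightarrow> pdiff dir_r f q = kp (fst q) * z q"
  using Yf_eq[of q f] Xf_eq[of q f] by (simp add: z_def u_def)

lemma f_r': "q \<in> U \<Longrightarrow> pdiff dir_r f q = (kp (fst q) * sg (fst q) * io (fst q)) * u q"
  using f_r by (simp add: z_def)

lemma u_r: "q \<in> U \<Longrightarrow> pdiff dir_r u q = kp (fst q) * v q"
  unfolding v_def by (rule Yf_eq)

lemma v_r: "q \<in> U \<Longrightarrow> pdiff dir_r v q = kp (fst q) * w q"
  unfolding w_def by (rule Yf_eq)

lemma hom_pdiff_r:
  assumes "\<And>c r t x. c > 0 \<Longrightarrow> g (r, t, c *\<^sub>R x) = g (r, t, x)" "c > 0"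
  shows "pdiff dir_r g (r, t, c *\<^sub>R x) = pdiff dir_r g (r, t, x)"
  using assms by (simp add: pdiff_def)

lemma u_hom: "c > 0 \<Longrightarrow> u (r, t, c *\<^sub>R x) = u (r, t, x)"
  unfolding u_def Xf_def using hom_pdiff_r[OF f_hom] by simp

lemma v_hom: "c > 0 \<Longrightarrow> v (r, t, c *\<^sub>R x) = v (r, t, x)"
  unfolding v_def Yf_def using hom_pdiff_r[OF u_hom] by simp

lemma euler:
  assumes "p \<in> U"
  shows "(\<Sum>i\<in>UNIV. snd (snd p) $ i * pdiff (dir_x i) f p) = 0"
    "(\<Sum>i\<in>UNIV. snd (snd p) $ i * pdiff (dir_x i) u p) = 0"
    "(\<Sum>i\<in>UNIV. snd (snd p) $ i * pdiff (dir_x i) v p) = 0"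
  using assms euler_identity[OF smooth_f _ _ f_hom] euler_identity[OF smooth_u _ _ u_hom] euler_identity[OF smooth_v _ _ v_hom]
  by (cases p, simp)+

lemma laplace_f:
  assumes "p \<in> U"
  shows "rho2 p * laplace_x f p = u p + sg (fst p) * io (fst p) * v p - (sg (fst p))\<^sup>2 * pdiff dir_t (pdiff dir_t f) p"
proof -
  have "fst p * kp (fst p) = sg (fst p) * io (fst p)"
    using assms beyond_rC(1)[of "fst p"] by (auto simp: kp_def io_def power2_eq_square)
  then have "fst p * pdiff dir_r u p = sg (fst p) * io (fst p) * v p"
    unfolding u_r[OF assms] by (metis mult.assoc)
  then show ?thesis using wave_eq[OF assms] by (simp add: u_def[symmetric])
qed

text \<open>The r-derivative of \<open>laplace_f\<close>. The \<open>kp v\<close> coming from the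
  r-derivative of \<open>u\<close> cancels against the derivative of \<open>io\<close> in
  \<open>sg * io * v\<close>, so that every remaining term carries the factor
  \<open>g = kp * sg * io\<close>, which is then divided out.\<close>

lemma laplace_u:
  assumes p: "p \<in> U"
  shows "rho2 p * laplace_x u p = w p - qq (fst p) * sg (fst p) * io (fst p) / 2 * v p
     + qq (fst p) * (sg (fst p))\<^sup>2 * pdiff dir_t (pdiff dir_t f) p - (sg (fst p))\<^sup>2 * pdiff dir_t (pdiff dir_t u) p"
proof -
  let ?s = "sg (fst p)" and ?i = "io (fst p)" and ?q = "qq (fst p)"
  let ?ftt = "pdiff dir_t (pdiff dir_t f)"
  define g where "g r = kp r * sg r * io r" for r
  have g: "pdiff dir_r f q = g (fst q) * u q" if "q \<in> U" for q using f_r'[OF that] by (simp add: g_def)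
  have sm: "smooth_on U (laplace_x f)" "smooth_on U ?ftt"
    by (intro smooth_laplace_x smooth_on_pdiff smooth_f dir_in_Basis)+
  have l: "pdiff dir_r (laplace_x f) p = g (fst p) * laplace_x u p"
    by (rule pdiff_r_laplace_x[OF smooth_f smooth_u p g])
  have t: "pdiff dir_r ?ftt p = g (fst p) * pdiff dir_t (pdiff dir_t u) p"
    by (rule pdiff_r_tangential2[OF smooth_f smooth_u p _ _ g]) auto
  note has = has_pdiff_smooth[OF sm(1) p] has_pdiff_smooth[OF sm(2) p] has_pdiff_smooth[OF smooth_u p] has_pdiff_smooth[OF smooth_v p]
  have 1: "pdiff dir_r (\<lambda>q. rho2 q * laplace_x f q) p = rho2 p * (g (fst p) * laplace_x u p)"
    by (rule has_pdiff_imp, (rule has_pdiff_rules has_pdiff_rho2 has dir_in_Basis)+) (simp add: l)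
  have 2: "pdiff dir_r (\<lambda>q. u q + sg (fst q) * io (fst q) * v q - (sg (fst q))\<^sup>2 * ?ftt q) p =
     kp (fst p) * v p + ((- (?q * ?s ^ 3 * ?i ^ 3 / 2) * ?i - ?s * ?i\<^sup>2) * v p + ?s * ?i * (kp (fst p) * w p))
     - (2 * ?s * - (?q * ?s ^ 3 * ?i ^ 3 / 2) * ?ftt p + ?s\<^sup>2 * (g (fst p) * pdiff dir_t (pdiff dir_t u) p))"
    by (rule has_pdiff_imp, (rule has_pdiff_rules coefficient_pdiff[OF p] has dir_in_Basis)+)
      (simp add: t u_r[OF p] v_r[OF p])
  have 3: "pdiff dir_r (\<lambda>q. rho2 q * laplace_x f q) p = pdiff dir_r (\<lambda>q. u q + sg (fst q) * io (fst q) * v q - (sg (fst q))\<^sup>2 * ?ftt q) p"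
    by (rule pdiff_cong[OF open_punctured p laplace_f])
  have "fst p > rC" using p by auto
  then have pos: "g (fst p) \<noteq> 0" using kp_pos sg_pos beyond_rC(1) by (force simp: g_def io_def)
  have "g (fst p) * (rho2 p * laplace_x u p) = g (fst p) * (w p - ?q * ?s * ?i / 2 * v p
     + ?q * ?s\<^sup>2 * ?ftt p - ?s\<^sup>2 * pdiff dir_t (pdiff dir_t u) p)"
    using 3 unfolding 1 2
    by (simp add: g_def kp_def power2_eq_square power3_eq_cube algebra_simps)
  then show ?thesis using pos by simp
qed

text \<open>These are the sources relative to the principal part \<open>sg^2\<close> times the
  second t-derivative plus the spherical Laplacian, which is the shape that
  \<open>energy_identity\<close> expects.\<close>

definition "S0 p = - ((qq (fst p) * (sg (fst p))\<^sup>2 * (io (fst p))\<^sup>2 / 2 + 2) * u p)"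
definition "S1 p = qq (fst p) * sg (fst p) * io (fst p) / 2 * v p - P1 (fst p) / 2 * pdiff dir_t (pdiff dir_t f) p"
definition "S2 p = qq (fst p) * sg (fst p) * io (fst p) / 2 * w p - P2 (fst p) / 2 * pdiff dir_t (pdiff dir_t u) p
    - P3 (fst p) / 2 * pdiff dir_t (pdiff dir_t f) p - b_coeff (fst p) * v p"

lemma z_r:
  assumes p: "p \<in> U"
  shows "pdiff dir_r z p = kp (fst p) * ((sg (fst p))\<^sup>2 * pdiff dir_t (pdiff dir_t f) p + rho2 p * laplace_x f p + S0 p)"
proof -
  have "pdiff dir_r z p = (- (qq (fst p) * sg (fst p) ^ 3 * io (fst p) ^ 3 / 2) * io (fst p) - sg (fst p) * (io (fst p))\<^sup>2) * u p
     + sg (fst p) * io (fst p) * (kp (fst p) * v p)"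
    unfolding z_def[abs_def]
    by (rule has_pdiff_imp, (rule has_pdiff_rules coefficient_pdiff[OF p] has_pdiff_smooth[OF smooth_u p] dir_in_Basis)+)
      (simp add: u_r[OF p])
  then show ?thesis unfolding laplace_f[OF p] S0_def
    by (simp add: kp_def power2_eq_square power3_eq_cube algebra_simps)
qed

lemma v_r_energy:
  assumes p: "p \<in> U"
  shows "pdiff dir_r v p = kp (fst p) * ((sg (fst p))\<^sup>2 * pdiff dir_t (pdiff dir_t u) p + rho2 p * laplace_x u p + S1 p)"
  unfolding v_r[OF p] laplace_u[OF p] S1_def P1_def by simp

text \<open>The r-derivative of \<open>laplace_u\<close>, solved for the r-derivative of
  \<open>w\<close>. The source \<open>u_tt\<close> has two origins: \<open>f_tt\<close>
  differentiated in \<open>r\<close>, and the derivative of \<open>sg^2\<close>.\<close>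

lemma w_r:
  assumes p: "p \<in> U"
  shows "pdiff dir_r w p = kp (fst p) * ((sg (fst p))\<^sup>2 * pdiff dir_t (pdiff dir_t v) p + rho2 p * laplace_x v p + S2 p)"
proof -
  let ?s = "sg (fst p)" and ?i = "io (fst p)" and ?q = "qq (fst p)"
  let ?ftt = "pdiff dir_t (pdiff dir_t f)" and ?utt = "pdiff dir_t (pdiff dir_t u)"
  define g where "g r = kp r * sg r * io r" for r
  have g: "pdiff dir_r f q = g (fst q) * u q" if "q \<in> U" for q using f_r'[OF that] by (simp add: g_def)
  have sm: "smooth_on U (laplace_x u)" "smooth_on U ?ftt" "smooth_on U ?utt"
    by (intro smooth_laplace_x smooth_on_pdiff smooth_f smooth_u dir_in_Basis)+
  have l: "pdiff dir_r (laplace_x u) p = kp (fst p) * laplace_x v p"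
    by (rule pdiff_r_laplace_x[OF smooth_u smooth_v p u_r])
  have t: "pdiff dir_r ?ftt p = g (fst p) * pdiff dir_t (pdiff dir_t u) p"
    by (rule pdiff_r_tangential2[OF smooth_f smooth_u p _ _ g]) auto
  have t': "pdiff dir_r ?utt p = kp (fst p) * pdiff dir_t (pdiff dir_t v) p"
    by (rule pdiff_r_tangential2[OF smooth_u smooth_v p _ _ u_r]) auto
  note has = has_pdiff_smooth[OF sm(1) p] has_pdiff_smooth[OF sm(2) p] has_pdiff_smooth[OF sm(3) p]
    has_pdiff_smooth[OF smooth_v p] has_pdiff_smooth[OF smooth_w p]
  have 1: "pdiff dir_r (\<lambda>q. rho2 q * laplace_x u q) p = rho2 p * (kp (fst p) * laplace_x v p)"
    by (rule has_pdiff_imp, (rule has_pdiff_rules has_pdiff_rho2 has dir_in_Basis)+) (simp add: l)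
  have 2: "pdiff dir_r (\<lambda>q. w q - (1 / 2) * (qq (fst q) * sg (fst q) * io (fst q)) * v q
     + qq (fst q) * (sg (fst q))\<^sup>2 * ?ftt q - (sg (fst q))\<^sup>2 * ?utt q) p = 
     pdiff dir_r w p - ((1 / 2) * ((6 * m * ?i\<^sup>2 * ?s + ?q * - (?q * ?s ^ 3 * ?i ^ 3 / 2)) * ?i - ?q * ?s * ?i\<^sup>2) * v p
        + (1 / 2) * (?q * ?s * ?i) * (kp (fst p) * w p))
     + ((6 * m * ?i\<^sup>2 * ?s\<^sup>2 + ?q * (2 * ?s * - (?q * ?s ^ 3 * ?i ^ 3 / 2))) * ?ftt p + ?q * ?s\<^sup>2 * (g (fst p) * ?utt p))
     - (2 * ?s * - (?q * ?s ^ 3 * ?i ^ 3 / 2) * ?utt p + ?s\<^sup>2 * (kp (fst p) * pdiff dir_t (pdiff dir_t v) p))"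
    by (rule has_pdiff_imp, (rule has_pdiff_rules coefficient_pdiff[OF p] has dir_in_Basis)+)
      (simp add: t t' v_r[OF p])
  have 3: "pdiff dir_r (\<lambda>q. rho2 q * laplace_x u q) p = pdiff dir_r (\<lambda>q. w q - (1 / 2) * (qq (fst q) * sg (fst q) * io (fst q)) * v q
     + qq (fst q) * (sg (fst q))\<^sup>2 * ?ftt q - (sg (fst q))\<^sup>2 * ?utt q) p"
    by (rule pdiff_cong[OF open_punctured p]) (simp add: laplace_u)
  \<comment> \<open>\<open>qq\<close> stays folded, so its relation to \<open>m * io\<close> has to
    be supplied by hand before the coefficients can be compared as polynomials.\<close>
  have four: "6 * m * ?i = 2 - ?q" by (simp add: qq_def)
  have b: "?s * ?i\<^sup>2 * b_coeff (fst p) = (?q - 1) * ?s * ?i\<^sup>2 + ?q\<^sup>2 * ?s ^ 3 * ?i ^ 4 / 4"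
    unfolding b_coeff_def four by (simp add: power2_eq_square power3_eq_cube power4_eq_xxxx algebra_simps)
  have m6: "6 * m * ?i\<^sup>2 = (2 - ?q) * ?i" unfolding four[symmetric] by (simp add: power2_eq_square)
  have kb: "kp (fst p) * (b_coeff (fst p) * v p) = ((?q - 1) * ?s * ?i\<^sup>2 + ?q\<^sup>2 * ?s ^ 3 * ?i ^ 4 / 4) * v p"
    using b unfolding kp_def mult.assoc[symmetric] by simp
  have "kp (fst p) * (P3 (fst p) / 2) = (6 * m * ?i\<^sup>2) * ?s\<^sup>2 - ?q\<^sup>2 * ?s ^ 4 * ?i ^ 3"
    by (simp add: kp_def P3_def power2_eq_square power3_eq_cube power4_eq_xxxx field_simps)
  then have kP3: "kp (fst p) * (P3 (fst p) / 2 * ?ftt p) = ((2 - ?q) * ?i * ?s\<^sup>2 - ?q\<^sup>2 * ?s ^ 4 * ?i ^ 3) * ?ftt p"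
    unfolding m6 mult.assoc[symmetric] by simp
  have "pdiff dir_r w p = kp (fst p) * (?s\<^sup>2 * pdiff dir_t (pdiff dir_t v) p + rho2 p * laplace_x v p
     + ?q * ?s * ?i / 2 * w p - P2 (fst p) / 2 * ?utt p) - kp (fst p) * (P3 (fst p) / 2 * ?ftt p)
     - kp (fst p) * (b_coeff (fst p) * v p)"
    using 3 unfolding 1 2 kb kP3 m6
    by (simp add: g_def kp_def P2_def power2_eq_square power3_eq_cube power4_eq_xxxx algebra_simps) 
  then show ?thesis unfolding S2_def by (simp add: algebra_simps)
qed

end

subsection \<open>Coefficient bounds\<close>

definition bounded_from :: "real \<Rightarrow> (real \<Rightarrow> real) \<Rightarrow> bool" where
  "bounded_from r0 c \<longleftrightarrow> (\<exists>N. \<forall>r\<ge>r0. \<bar>c r\<bar> \<le> N)"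

lemma bounded_from_const: "bounded_from r0 (\<lambda>_. k)"
  by (auto simp: bounded_from_def)

lemma bounded_from_add:
  assumes "bounded_from r0 c" "bounded_from r0 d" shows "bounded_from r0 (\<lambda>r. c r + d r)"
proof -
  obtain N M where "\<forall>r\<ge>r0. \<bar>c r\<bar> \<le> N" "\<forall>r\<ge>r0. \<bar>d r\<bar> \<le> M" using assms by (auto simp: bounded_from_def)
  then show ?thesis unfolding bounded_from_def
    by (intro exI[of _ "N + M"]) (meson abs_triangle_ineq add_mono order_trans)
qed

lemma bounded_from_mult:
  assumes "bounded_from r0 c" "bounded_from r0 d" shows "bounded_from r0 (\<lambda>r. c r * d r)"
proof -
  obtain N M where NM: "\<forall>r\<ge>r0. \<bar>c r\<bar> \<le> N" "\<forall>r\<ge>r0. \<bar>d r\<bar> \<le> M" using assms by (auto simp: bounded_from_def)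
  have "\<bar>c r * d r\<bar> \<le> N * M" if "r \<ge> r0" for r
    unfolding abs_mult using NM that by (intro mult_mono) (auto intro: order_trans[OF abs_ge_zero])
  then show ?thesis unfolding bounded_from_def by blast
qed

lemma bounded_from_diff:
  assumes "bounded_from r0 c" "bounded_from r0 d" shows "bounded_from r0 (\<lambda>r. c r - d r)"
  using bounded_from_add[OF assms(1) bounded_from_mult[OF bounded_from_const[of _ "-1"] assms(2)]] by simp

lemma bounded_from_power:
  assumes "bounded_from r0 c" shows "bounded_from r0 (\<lambda>r. c r ^ n)"
  by (induction n) (auto intro: bounded_from_const bounded_from_mult assms)

lemma bounded_from_list:
  "\<forall>c\<in>set cs. bounded_from r0 c \<Longrightarrow> \<exists>N\<ge>0. \<forall>c\<in>set cs. \<forall>r\<ge>r0. \<bar>c r\<bar> \<le> N"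
proof (induction cs)
  case (Cons c cs)
  obtain N where N: "N \<ge> 0" "\<forall>c\<in>set cs. \<forall>r\<ge>r0. \<bar>c r\<bar> \<le> N" using Cons by auto
  obtain M where M: "\<forall>r\<ge>r0. \<bar>c r\<bar> \<le> M" using Cons.prems by (auto simp: bounded_from_def)
  show ?case
    using N M by (intro exI[of _ "max N M"]) (auto intro: max.coboundedI1 max.coboundedI2)
qed auto

context sds
begin

text \<open>The monotonicity of \<open>D / r^2\<close> makes \<open>sg\<close> nonincreasing, hence
  at most \<open>sg r0\<close>; and \<open>2 m / r \<le> 1\<close> gives
  \<open>D \<le> \<Lambda> / 3 * r^2\<close>, which bounds \<open>sg\<close> from below.\<close>

lemma bounded_sg:
  assumes "r0 > rC"
  shows "bounded_from r0 io" "bounded_from r0 sg" "bounded_from r0 (\<lambda>r. 1 / sg r)"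
proof -
  note r0 = beyond_rC[OF assms]
  have "\<bar>io r\<bar> \<le> 1 / r0" if "r \<ge> r0" for r using that r0 by (simp add: io_def frac_le)
  then show "bounded_from r0 io" unfolding bounded_from_def by blast
  have "\<bar>sg r\<bar> \<le> sg r0" if "r \<ge> r0" for r
  proof -
    note r = beyond_rC[of r]
    have "D r0 / r0\<^sup>2 \<le> D r / r\<^sup>2" using D_over_r2_strict_mono[of r0 r] that r0 by (cases "r = r0") auto
    then have "r\<^sup>2 / D r \<le> r0\<^sup>2 / D r0" using r r0 that assms by (simp add: field_simps)
    then have "(sg r)\<^sup>2 \<le> (sg r0)\<^sup>2" using that assms by (simp add: sg_square)
    then have "sg r \<le> sg r0" by (rule power2_le_imp_le) (use sg_pos[OF assms] in simp)
    then show ?thesis using sg_pos[of r] that assms by simp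
  qed
  then show "bounded_from r0 sg" unfolding bounded_from_def by blast
  have "\<bar>1 / sg r\<bar> \<le> sqrt (\<Lambda> / 3)" if "r \<ge> r0" for r
  proof -
    have rr: "r > rC" using that assms by simp
    note r = beyond_rC[OF rr]
    have "2 * m / r \<le> 1" using r m by (simp add: field_simps)
    then have "D r \<le> \<Lambda> / 3 * r\<^sup>2" by (simp add: SdS_D_def)
    then have "D r / r\<^sup>2 \<le> \<Lambda> / 3" using r by (simp add: field_simps)
    moreover have "(1 / sg r)\<^sup>2 = D r / r\<^sup>2" by (simp add: power_divide sg_square[OF rr])
    ultimately have "(1 / sg r)\<^sup>2 \<le> \<Lambda> / 3" by simp
    then have "1 / sg r \<le> sqrt (\<Lambda> / 3)" by (rule real_le_rsqrt)
    then show ?thesis using sg_pos[OF rr] by simp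
  qed
  then show "bounded_from r0 (\<lambda>r. 1 / sg r)" unfolding bounded_from_def by blast
qed

text \<open>The coefficients are taken relative to the normalised time derivatives \<open>\<sigma> \<partial>\<^sub>t\<close>.\<close>
definition coefficients :: "(real \<Rightarrow> real) list" where
  "coefficients = [\<lambda>r. qq r * sg r * io r, \<lambda>r. 2 * b_coeff r, \<lambda>r. Q1 r * (1 / sg r)\<^sup>2, \<lambda>r. Q2 r * (1 / sg r)\<^sup>2,
     \<lambda>r. Q3 r * (1 / sg r)\<^sup>2, \<lambda>r. P1 r * (1 / sg r)\<^sup>2, \<lambda>r. P2 r * (1 / sg r)\<^sup>2, \<lambda>r. P3 r * (1 / sg r)\<^sup>2,
     \<lambda>r. P1 r * io r * (1 / sg r), \<lambda>r. P3 r * io r * (1 / sg r),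
     \<lambda>r. P1 r * (1 / sg r), \<lambda>r. P2 r * (1 / sg r), \<lambda>r. P3 r * (1 / sg r), \<lambda>r. 2 * sg r, \<lambda>r. sg r]"

lemma bounded_coefficients:
  assumes "r0 > rC" shows "\<exists>N\<ge>0. \<forall>c\<in>set coefficients. \<forall>r\<ge>r0. \<bar>c r\<bar> \<le> N"
proof (rule bounded_from_list)
  have q: "bounded_from r0 (\<lambda>r. qq r)"
    unfolding qq_def by (intro bounded_from_diff bounded_from_mult bounded_from_const bounded_sg[OF assms])
  have b: "bounded_from r0 (\<lambda>r. b_coeff r)"
  proof -
    have "b_coeff = (\<lambda>r. 1 - 6 * m * io r + (1 / 4) * (qq r)\<^sup>2 * (sg r)\<^sup>2 * (io r)\<^sup>2)"
      by (simp add: fun_eq_iff b_coeff_def)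
    then show ?thesis
      by (simp only:) (intro bounded_from_add bounded_from_diff bounded_from_mult bounded_from_power bounded_from_const bounded_sg[OF assms] q)
  qed
  note rules = bounded_from_add bounded_from_diff bounded_from_mult bounded_from_power bounded_from_const bounded_sg[OF assms] q b
  have P: "bounded_from r0 (\<lambda>r. P1 r)" "bounded_from r0 (\<lambda>r. P2 r)" "bounded_from r0 (\<lambda>r. P3 r)"
    unfolding P1_def P2_def P3_def by (intro rules)+
  have Q: "bounded_from r0 (\<lambda>r. Q1 r)" "bounded_from r0 (\<lambda>r. Q2 r)" "bounded_from r0 (\<lambda>r. Q3 r)"
    unfolding Q1_def Q2_def Q3_def by (intro rules P)+
  show "\<forall>c\<in>set coefficients. bounded_from r0 c"
    unfolding coefficients_def list.set ball_simps by (intro conjI TrueI rules P Q)+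
qed

end

lemma abs_mult_le_of_squares:
  fixes x y e :: real
  assumes "x\<^sup>2 \<le> e" "y\<^sup>2 \<le> e" shows "\<bar>x * y\<bar> \<le> e"
proof -
  have "2 * \<bar>x * y\<bar> \<le> x\<^sup>2 + y\<^sup>2"
    using sum_squares_bound[of "\<bar>x\<bar>" "\<bar>y\<bar>"] by (simp add: abs_mult)
  then show ?thesis using assms by simp
qed

lemma abs_coeff_mult_le:
  fixes c N x y e :: real
  assumes "\<bar>c\<bar> \<le> N" "x\<^sup>2 \<le> e" "y\<^sup>2 \<le> e" shows "\<bar>c * (x * y)\<bar> \<le> N * e"
  using mult_mono[OF assms(1) abs_mult_le_of_squares[OF assms(2,3)]] assms(1) by (simp add: abs_mult)

section \<open>The modified energy density and its coercivity\<close>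

context wave_solution
begin

definition "Etot q = edensity w v q + edensity v u q + edensity z f q"

definition "G K1 K0 q = edensity w v q - cross P2 v u q - cross P3 v f q
  + K1 * (edensity v u q - cross P1 u f q) + K0 * edensity z f q"

definition "\<Phi> K1 K0 q = eflux w v q - cflux P2 w u q - cflux P3 w f q
  + K1 * (eflux v u q - cflux P1 v f q) + K0 * eflux z f q"

definition "J K1 K0 i q = aflux w v i q + K1 * aflux v u i q + K0 * aflux z f i q"

text \<open>The remainders of the energy identities minus those of the cross identities, weighted as
  in \<open>G\<close> and stripped of the common factor \<open>kp\<close>.\<close>

definition "bulk K1 K0 p = (2 * w p * S2 p - qq (fst p) * sg (fst p) ^ 3 * io (fst p) * (pdiff dir_t v p)\<^sup>2)
  - (Q2 (fst p) * (pdiff dir_t v p * pdiff dir_t u p) + P2 (fst p) * (pdiff dir_t v p * pdiff dir_t v p)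
        - P2 (fst p) * (w p * pdiff dir_t (pdiff dir_t u) p))
  - (Q3 (fst p) * (pdiff dir_t v p * pdiff dir_t f p) + P3 (fst p) * (pdiff dir_t v p * pdiff dir_t z p)
        - P3 (fst p) * (w p * pdiff dir_t (pdiff dir_t f) p))
  + K1 * ((2 * v p * S1 p - qq (fst p) * sg (fst p) ^ 3 * io (fst p) * (pdiff dir_t u p)\<^sup>2)
    - (Q1 (fst p) * (pdiff dir_t u p * pdiff dir_t f p) + P1 (fst p) * (pdiff dir_t u p * pdiff dir_t z p)
        - P1 (fst p) * (v p * pdiff dir_t (pdiff dir_t f) p)))
  + K0 * (2 * z p * S0 p - qq (fst p) * sg (fst p) ^ 3 * io (fst p) * (pdiff dir_t f p)\<^sup>2)"

lemmas smooth_E =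
  smooth_densities[OF smooth_v smooth_w smooth_u smooth_P(2)]
  smooth_densities[OF smooth_v smooth_w smooth_f smooth_P(3)]
  smooth_densities[OF smooth_u smooth_v smooth_f smooth_P(1)]
  smooth_densities[OF smooth_f smooth_z smooth_f smooth_P(1)]

lemma smooth_G: "smooth_on U (G K1 K0)" "smooth_on U (\<Phi> K1 K0)" "smooth_on U (J K1 K0 i)" "smooth_on U Etot"
  unfolding G_def[abs_def] \<Phi>_def[abs_def] J_def[abs_def] Etot_def[abs_def]
  by (intro smooth_on_add smooth_on_diff smooth_on_mult smooth_on_const open_punctured smooth_E)+

lemma pdiff_r_G:
  assumes p: "p \<in> U"
  shows "pdiff dir_r (G K1 K0) p = pdiff dir_t (\<Phi> K1 K0) p + (\<Sum>i\<in>UNIV. pdiff (dir_x i) (J K1 K0 i) p)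
    + kp (fst p) * bulk K1 K0 p"
proof -
  note has = smooth_E[THEN has_pdiff_smooth, OF p dir_in_Basis(1)] smooth_E[THEN has_pdiff_smooth, OF p dir_in_Basis(2)]
    smooth_E[THEN has_pdiff_smooth, OF p dir_in_Basis(3)]
  have 1: "pdiff dir_r (G K1 K0) p = pdiff dir_r (edensity w v) p - pdiff dir_r (cross P2 v u) p - pdiff dir_r (cross P3 v f) p
     + K1 * (pdiff dir_r (edensity v u) p - pdiff dir_r (cross P1 u f) p) + K0 * pdiff dir_r (edensity z f) p"
    unfolding G_def[abs_def]
    by (rule has_pdiff_imp, (rule has_pdiff_rules has)+) simp
  have 2: "pdiff dir_t (\<Phi> K1 K0) p = pdiff dir_t (eflux w v) p - pdiff dir_t (cflux P2 w u) p - pdiff dir_t (cflux P3 w f) p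
     + K1 * (pdiff dir_t (eflux v u) p - pdiff dir_t (cflux P1 v f) p) + K0 * pdiff dir_t (eflux z f) p"
    unfolding \<Phi>_def[abs_def]
    by (rule has_pdiff_imp, (rule has_pdiff_rules has)+) simp
  have 3: "pdiff (dir_x i) (J K1 K0 i) p = pdiff (dir_x i) (aflux w v i) p + K1 * pdiff (dir_x i) (aflux v u i) p
     + K0 * pdiff (dir_x i) (aflux z f i) p" for i
    unfolding J_def[abs_def]
    by (rule has_pdiff_imp, (rule has_pdiff_rules has)+) simp
  have 4: "(\<Sum>i\<in>UNIV. pdiff (dir_x i) (J K1 K0 i) p) = (\<Sum>i\<in>UNIV. pdiff (dir_x i) (aflux w v i) p)
     + K1 * (\<Sum>i\<in>UNIV. pdiff (dir_x i) (aflux v u i) p) + K0 * (\<Sum>i\<in>UNIV. pdiff (dir_x i) (aflux z f i) p)"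
    unfolding 3 by (simp add: sum.distrib sum_distrib_left)
  have r: "\<forall>q\<in>U. pdiff dir_r v q = kp (fst q) * w q" "\<forall>q\<in>U. pdiff dir_r u q = kp (fst q) * v q"
    "\<forall>q\<in>U. pdiff dir_r f q = kp (fst q) * z q"
    using v_r u_r f_r by blast+
  note e = energy_identity[OF smooth_v smooth_w p r(1) w_r[OF p] euler(3)[OF p]]
    energy_identity[OF smooth_u smooth_v p r(2) v_r_energy[OF p] euler(2)[OF p]]
    energy_identity[OF smooth_f smooth_z p r(3) z_r[OF p] euler(1)[OF p]]
    cross_identity[OF smooth_v smooth_w smooth_u smooth_v p r(1) r(2) has_pdiff_P(2)[OF p]]
    cross_identity[OF smooth_v smooth_w smooth_f smooth_z p r(1) r(3) has_pdiff_P(3)[OF p]]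
    cross_identity[OF smooth_u smooth_v smooth_f smooth_z p r(2) r(3) has_pdiff_P(1)[OF p]]
  have alg: "(d2 + s2 + k * b2) - (d2' + k * c2) - (d3' + k * c3) + K1 * ((d1 + s1 + k * b1) - (d1' + k * c1)) + K0 * (d0 + s0 + k * b0)
    = (d2 - d2' - d3' + K1 * (d1 - d1') + K0 * d0) + (s2 + K1 * s1 + K0 * s0)
      + k * (b2 - c2 - c3 + K1 * (b1 - c1) + K0 * b0)"
    for d2 s2 k b2 d2' c2 d3' c3 d1 s1 b1 d1' c1 d0 s0 b0 :: real
    by (simp add: algebra_simps)
  show ?thesis unfolding 1 2 4 e bulk_def by (rule alg)
qed

lemma tangential_J:
  assumes "p \<in> U" shows "(\<Sum>i\<in>UNIV. snd (snd p) $ i * J K1 K0 i p) = 0"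
proof -
  have "(\<Sum>i\<in>UNIV. snd (snd p) $ i * aflux a \<phi> i p) = 2 * kp (fst p) * rho2 p * a p * (\<Sum>i\<in>UNIV. snd (snd p) $ i * pdiff (dir_x i) \<phi> p)" for a \<phi>
    by (simp add: aflux_def sum_distrib_left mult_ac)
  note * = this
  have "(\<Sum>i\<in>UNIV. snd (snd p) $ i * J K1 K0 i p) = (\<Sum>i\<in>UNIV. snd (snd p) $ i * aflux w v i p)
      + K1 * (\<Sum>i\<in>UNIV. snd (snd p) $ i * aflux v u i p) + K0 * (\<Sum>i\<in>UNIV. snd (snd p) $ i * aflux z f i p)"
    by (simp add: J_def sum.distrib sum_distrib_left algebra_simps)
  then show ?thesis unfolding * euler[OF assms] by simp
qed

lemma edensity_bounds:
  assumes "p \<in> U"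
  shows "(a p)\<^sup>2 \<le> edensity a \<phi> p" "(sg (fst p) * pdiff dir_t \<phi> p)\<^sup>2 \<le> edensity a \<phi> p" "0 \<le> edensity a \<phi> p"
proof -
  have "rho2 p * (\<Sum>i\<in>UNIV. (pdiff (dir_x i) \<phi> p)\<^sup>2) \<ge> 0"
    by (intro mult_nonneg_nonneg sum_nonneg) (auto simp: rho2_def)
  then show "(a p)\<^sup>2 \<le> edensity a \<phi> p" "(sg (fst p) * pdiff dir_t \<phi> p)\<^sup>2 \<le> edensity a \<phi> p" "0 \<le> edensity a \<phi> p"
    by (simp_all add: edensity_def power_mult_distrib add_nonneg_nonneg)
qed

text \<open>Young's inequality bounds the two cross terms of the top level by
  \<open>e2 / 2 + N^2 * (e1 + e0)\<close> and the one of the middle level by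
  \<open>e1 / 2 + N^2 / 2 * e0\<close>. The weights solve \<open>K1 / 2 - N^2 = 1 / 2\<close> and
  \<open>K0 - N^2 - K1 * N^2 / 2 = 1 / 2\<close>, so half of every energy is left. In the last two
  bounds one factor \<open>N\<close> comes from \<open>kp \<le> N / r^2\<close>, the other from the
  coefficients; the integers count terms.\<close>

lemma estimates:
  assumes N: "\<forall>c\<in>set coefficients. \<forall>r\<ge>r0. \<bar>c r\<bar> \<le> N" and p: "p \<in> U" and r0: "r0 \<le> fst p"
  defines "K1 \<equiv> 2 * N\<^sup>2 + 1" and "K0 \<equiv> N\<^sup>2 + (2 * N\<^sup>2 + 1) * N\<^sup>2 / 2 + 1 / 2"
  shows "Etot p \<le> 2 * G K1 K0 p"
    and "G K1 K0 p \<le> (1 + 2 * N + K1 * (1 + N) + K0) * Etot p"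
    and "\<bar>\<Phi> K1 K0 p\<bar> \<le> (N * (3 + 2 * K1 + K0) * N / (fst p)\<^sup>2) * Etot p"
    and "kp (fst p) * bulk K1 K0 p \<le> (N * (7 + 4 * K1 + K0) * N / (fst p)\<^sup>2) * Etot p"
proof -
  let ?r = "fst p" and ?s = "sg (fst p)" and ?i = "io (fst p)"
  have rr: "?r > rC" using p by auto
  have s: "?s > 0" by (rule sg_pos[OF rr])
  have r: "?r > 0" by (rule beyond_rC(1)[OF rr])
  have q: "qq ?r \<ge> 0" using beyond_rC(2)[OF rr] r by (simp add: qq_def io_def field_simps)
  have i: "?i > 0" using r by (simp add: io_def)
  define y2 y1 y0 where "y2 = ?s * pdiff dir_t v p" and "y1 = ?s * pdiff dir_t u p" and "y0 = ?s * pdiff dir_t f p"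
  have y: "pdiff dir_t v p = y2 / ?s" "pdiff dir_t u p = y1 / ?s" "pdiff dir_t f p = y0 / ?s"
    using s by (simp_all add: y2_def y1_def y0_def)
  define e2 e1 e0 where "e2 = edensity w v p" and "e1 = edensity v u p" and "e0 = edensity z f p"
  have E: "Etot p = e2 + e1 + e0" by (simp add: Etot_def e2_def e1_def e0_def)
  have e: "0 \<le> e2" "0 \<le> e1" "0 \<le> e0" "(w p)\<^sup>2 \<le> e2" "(v p)\<^sup>2 \<le> e1" "(z p)\<^sup>2 \<le> e0"
      "y2\<^sup>2 \<le> e2" "y1\<^sup>2 \<le> e1" "y0\<^sup>2 \<le> e0"
    using edensity_bounds[OF p] by (simp_all add: e2_def e1_def e0_def y2_def y1_def y0_def)
  have sq: "(w p)\<^sup>2 \<le> Etot p" "(v p)\<^sup>2 \<le> Etot p" "(z p)\<^sup>2 \<le> Etot p"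
      "y2\<^sup>2 \<le> Etot p" "y1\<^sup>2 \<le> Etot p" "y0\<^sup>2 \<le> Etot p"
    using e unfolding E by linarith+
  define c1 c2 c3 c4 c5 c6 c7 c8 c9 c10 d1 d2 d3 d0 where
    "c1 = qq ?r * ?s * ?i" and "c2 = 2 * b_coeff ?r" and "c3 = Q1 ?r * (1 / ?s)\<^sup>2" and "c4 = Q2 ?r * (1 / ?s)\<^sup>2"
    and "c5 = Q3 ?r * (1 / ?s)\<^sup>2" and "c6 = P1 ?r * (1 / ?s)\<^sup>2" and "c7 = P2 ?r * (1 / ?s)\<^sup>2"
    and "c8 = P3 ?r * (1 / ?s)\<^sup>2" and "c9 = P1 ?r * ?i * (1 / ?s)" and "c10 = P3 ?r * ?i * (1 / ?s)"
    and "d1 = P1 ?r * (1 / ?s)" and "d2 = P2 ?r * (1 / ?s)" and "d3 = P3 ?r * (1 / ?s)" and "d0 = 2 * ?s"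
  have cN: "\<bar>c1\<bar> \<le> N" "\<bar>c2\<bar> \<le> N" "\<bar>c3\<bar> \<le> N" "\<bar>c4\<bar> \<le> N" "\<bar>c5\<bar> \<le> N" "\<bar>c6\<bar> \<le> N" "\<bar>c7\<bar> \<le> N"
    "\<bar>c8\<bar> \<le> N" "\<bar>c9\<bar> \<le> N" "\<bar>c10\<bar> \<le> N" "\<bar>d1\<bar> \<le> N" "\<bar>d2\<bar> \<le> N" "\<bar>d3\<bar> \<le> N" "\<bar>d0\<bar> \<le> N" "\<bar>?s\<bar> \<le> N"
    using N r0 unfolding coefficients_def c1_def c2_def c3_def c4_def c5_def c6_def c7_def c8_def c9_def c10_def d1_def d2_def d3_def d0_def
    by simp_all
  have N0: "N \<ge> 0" using cN(1) by simp
  have K: "K1 \<ge> 0" "K0 \<ge> 0" using N0 by (auto simp: K1_def K0_def)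
  have kpN: "0 \<le> kp ?r" "kp ?r \<le> N / ?r\<^sup>2"
    using kp_pos[OF rr] cN(15) s r by (simp_all add: kp_def io_def power_divide divide_right_mono)
  have t: "\<bar>c * (x * y)\<bar> \<le> N * Etot p" if "\<bar>c\<bar> \<le> N" "x\<^sup>2 \<le> Etot p" "y\<^sup>2 \<le> Etot p" for c x y
    by (rule abs_coeff_mult_le[OF that])
  have G: "G K1 K0 p = e2 - c7 * (y2 * y1) - c8 * (y2 * y0) + K1 * (e1 - c6 * (y1 * y0)) + K0 * e0"
    unfolding G_def cross_def e2_def[symmetric] e1_def[symmetric] e0_def[symmetric] y c6_def c7_def c8_def
    by (simp add: power2_eq_square)
  have young: "\<bar>c * (x * y)\<bar> \<le> k * x\<^sup>2 + N\<^sup>2 * y\<^sup>2 / (4 * k)" if "\<bar>c\<bar> \<le> N" "k > 0" for c x y k :: real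
  proof -
    have "\<bar>c * (x * y)\<bar> \<le> N * (\<bar>x\<bar> * \<bar>y\<bar>)" using that by (simp add: abs_mult mult_right_mono)
    moreover have "0 \<le> (2 * k * \<bar>x\<bar> - N * \<bar>y\<bar>)\<^sup>2 / (4 * k)" using that by simp
    moreover have "(2 * k * \<bar>x\<bar> - N * \<bar>y\<bar>)\<^sup>2 / (4 * k) = k * x\<^sup>2 + N\<^sup>2 * y\<^sup>2 / (4 * k) - N * (\<bar>x\<bar> * \<bar>y\<bar>)"
      using that by (simp add: power2_diff power_mult_distrib field_simps) (simp add: power2_eq_square)
    ultimately show ?thesis by linarith
  qed
  show "Etot p \<le> 2 * G K1 K0 p"
  proof -
    have 1: "c7 * (y2 * y1) \<le> e2 / 4 + N\<^sup>2 * e1"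
    proof -
      have "\<bar>c7 * (y2 * y1)\<bar> \<le> y2\<^sup>2 / 4 + N\<^sup>2 * y1\<^sup>2" using young[OF cN(7), of "1/4" y2 y1] by simp
      moreover have "N\<^sup>2 * y1\<^sup>2 \<le> N\<^sup>2 * e1" using e by (intro mult_left_mono) auto
      ultimately show ?thesis using e(7) by linarith
    qed
    have 2: "c8 * (y2 * y0) \<le> e2 / 4 + N\<^sup>2 * e0"
    proof -
      have "\<bar>c8 * (y2 * y0)\<bar> \<le> y2\<^sup>2 / 4 + N\<^sup>2 * y0\<^sup>2" using young[OF cN(8), of "1/4" y2 y0] by simp
      moreover have "N\<^sup>2 * y0\<^sup>2 \<le> N\<^sup>2 * e0" using e by (intro mult_left_mono) auto
      ultimately show ?thesis using e(7) by linarith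
    qed
    have 3: "c6 * (y1 * y0) \<le> e1 / 2 + N\<^sup>2 / 2 * e0"
    proof -
      have "\<bar>c6 * (y1 * y0)\<bar> \<le> y1\<^sup>2 / 2 + N\<^sup>2 / 2 * y0\<^sup>2" using young[OF cN(6), of "1/2" y1 y0] by simp
      moreover have "N\<^sup>2 / 2 * y0\<^sup>2 \<le> N\<^sup>2 / 2 * e0" using e by (intro mult_left_mono) auto
      ultimately show ?thesis using e(8) by linarith
    qed
    \<comment> \<open>The products with \<open>N\<close> and \<open>K1\<close> are replaced by
      atoms, which turns coercivity into a purely linear inequality.\<close>
    have lin: "e2 + e1 + e0 \<le> 2 * (e2 - x7 - x8 + y + k)"
      if "X \<le> a" "a = A + e1 / 2 + M" "y = 2 * A + e1 - X" "k = B + M + e0 / 2" "x7 \<le> e2 / 4 + A" "x8 \<le> e2 / 4 + B"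
      for X a A M y k B x7 x8 :: real
      using that by argo
    have c6: "K1 * (c6 * (y1 * y0)) \<le> K1 * (e1 / 2 + N\<^sup>2 / 2 * e0)" using 3 K(1) by (rule mult_left_mono)
    have K1s: "K1 * (e1 / 2 + N\<^sup>2 / 2 * e0) = N\<^sup>2 * e1 + e1 / 2 + K1 * (N\<^sup>2 / 2 * e0)"
      "K1 * (e1 - c6 * (y1 * y0)) = 2 * (N\<^sup>2 * e1) + e1 - K1 * (c6 * (y1 * y0))"
      "K0 * e0 = N\<^sup>2 * e0 + K1 * (N\<^sup>2 / 2 * e0) + e0 / 2"
      by (simp_all add: K1_def K0_def field_simps)
    show ?thesis unfolding E G by (rule lin[OF c6 K1s 1 2])
  qed
  show "G K1 K0 p \<le> (1 + 2 * N + K1 * (1 + N) + K0) * Etot p"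
  proof -
    have 1: "\<bar>c7 * (y2 * y1)\<bar> \<le> N * Etot p" "\<bar>c8 * (y2 * y0)\<bar> \<le> N * Etot p" "\<bar>c6 * (y1 * y0)\<bar> \<le> N * Etot p"
      by (intro t cN sq)+
    have "e1 - c6 * (y1 * y0) \<le> (1 + N) * Etot p" "e0 \<le> Etot p" "e2 \<le> Etot p"
      using 1(3) e unfolding E by (simp_all add: algebra_simps)
    then have "K1 * (e1 - c6 * (y1 * y0)) \<le> K1 * ((1 + N) * Etot p)" "K0 * e0 \<le> K0 * Etot p"
      using K by (auto intro: mult_left_mono)
    then show ?thesis using 1 \<open>e2 \<le> Etot p\<close> unfolding G by (simp add: algebra_simps)
  qed
  show "\<bar>\<Phi> K1 K0 p\<bar> \<le> (N * (3 + 2 * K1 + K0) * N / (fst p)\<^sup>2) * Etot p"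
  proof -
    have \<Phi>: "\<Phi> K1 K0 p = kp ?r * (d0 * (w p * y2) - d2 * (w p * y1) - d3 * (w p * y0)
        + K1 * (d0 * (v p * y1) - d1 * (v p * y0)) + K0 * (d0 * (z p * y0)))"
      unfolding \<Phi>_def eflux_def cflux_def y d0_def d1_def d2_def d3_def
      using s by (simp add: power2_eq_square algebra_simps)
    have 1: "\<bar>d0 * (w p * y2)\<bar> \<le> N * Etot p" "\<bar>d2 * (w p * y1)\<bar> \<le> N * Etot p" "\<bar>d3 * (w p * y0)\<bar> \<le> N * Etot p"
      "\<bar>d0 * (v p * y1)\<bar> \<le> N * Etot p" "\<bar>d1 * (v p * y0)\<bar> \<le> N * Etot p" "\<bar>d0 * (z p * y0)\<bar> \<le> N * Etot p"
      by (intro t cN sq)+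
    have 2: "\<bar>K1 * (d0 * (v p * y1) - d1 * (v p * y0))\<bar> \<le> K1 * (2 * (N * Etot p))"
      unfolding abs_mult[of K1] using 1(4,5) K by (intro mult_mono) auto
    have 3: "\<bar>K0 * (d0 * (z p * y0))\<bar> \<le> K0 * (N * Etot p)"
      unfolding abs_mult[of K0] using 1(6) K by (intro mult_mono) auto
    have "\<bar>d0 * (w p * y2) - d2 * (w p * y1) - d3 * (w p * y0)
        + K1 * (d0 * (v p * y1) - d1 * (v p * y0)) + K0 * (d0 * (z p * y0))\<bar>
        \<le> 3 * (N * Etot p) + K1 * (2 * (N * Etot p)) + K0 * (N * Etot p)"
      using 1(1,2,3) 2 3 by linarith
    then have "\<bar>\<Phi> K1 K0 p\<bar> \<le> N / ?r\<^sup>2 * (3 * (N * Etot p) + K1 * (2 * (N * Etot p)) + K0 * (N * Etot p))"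
      unfolding \<Phi> abs_mult[of "kp ?r"] using kpN by (intro mult_mono) auto
    then show ?thesis by (simp add: algebra_simps add_divide_distrib)
  qed
  show "kp (fst p) * bulk K1 K0 p \<le> (N * (7 + 4 * K1 + K0) * N / (fst p)\<^sup>2) * Etot p"
  proof -
    have zt: "pdiff dir_t z p = ?s * ?i * pdiff dir_t u p"
    proof -
      have "pdiff dir_t z p = pdiff dir_t (\<lambda>q. (\<lambda>r. sg r * io r) (fst q) * u q) p" by (simp add: z_def[abs_def])
      also have "\<dots> = ?s * ?i * pdiff dir_t u p" by (rule pdiff_radial_mult[OF smooth_u p]) auto
      finally show ?thesis .
    qed
    \<comment> \<open>All second time derivatives have cancelled here; apart from the term with
      \<open>S0\<close>, only products of quantities bounded by the energies remain.\<close>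
    have B: "bulk K1 K0 p = c1 * (w p * w p) - c2 * (w p * v p) - c1 * (y2 * y2) - c4 * (y2 * y1) - c7 * (y2 * y2)
        - c5 * (y2 * y0) - c10 * (y2 * y1)
        + K1 * (c1 * (v p * v p) - c1 * (y1 * y1) - c3 * (y1 * y0) - c9 * (y1 * y1))
        + K0 * (2 * z p * S0 p - c1 * (y0 * y0))"
      unfolding bulk_def zt y S1_def S2_def c1_def c2_def c3_def c4_def c5_def c7_def c9_def c10_def
      using s by (simp add: power2_eq_square power3_eq_cube algebra_simps)
    \<comment> \<open>\<open>S0\<close> is a multiple of \<open>u\<close>, which is not bounded by
      the energies uniformly in \<open>r\<close>. But \<open>z\<close> is a positive and
      \<open>S0\<close> a negative multiple of \<open>u\<close>, using \<open>qq \<ge> 0\<close>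
      beyond \<open>3 m\<close>.\<close>
    have z: "z p * S0 p \<le> 0"
    proof -
      have "z p * S0 p = - (?s * ?i * (qq ?r * ?s\<^sup>2 * ?i\<^sup>2 / 2 + 2) * (u p)\<^sup>2)"
        by (simp add: z_def S0_def power2_eq_square algebra_simps)
      then show ?thesis using s i q by simp
    qed
    have 1: "\<bar>c1 * (w p * w p)\<bar> \<le> N * Etot p" "\<bar>c2 * (w p * v p)\<bar> \<le> N * Etot p" "\<bar>c1 * (y2 * y2)\<bar> \<le> N * Etot p"
      "\<bar>c4 * (y2 * y1)\<bar> \<le> N * Etot p" "\<bar>c7 * (y2 * y2)\<bar> \<le> N * Etot p" "\<bar>c5 * (y2 * y0)\<bar> \<le> N * Etot p"
      "\<bar>c10 * (y2 * y1)\<bar> \<le> N * Etot p"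
      by (intro t cN sq)+
    have 2: "\<bar>c1 * (v p * v p)\<bar> \<le> N * Etot p" "\<bar>c1 * (y1 * y1)\<bar> \<le> N * Etot p" "\<bar>c3 * (y1 * y0)\<bar> \<le> N * Etot p"
      "\<bar>c9 * (y1 * y1)\<bar> \<le> N * Etot p" "\<bar>c1 * (y0 * y0)\<bar> \<le> N * Etot p"
      by (intro t cN sq)+
    have "c1 * (v p * v p) - c1 * (y1 * y1) - c3 * (y1 * y0) - c9 * (y1 * y1) \<le> 4 * (N * Etot p)"
      using 2 by linarith
    then have 3: "K1 * (c1 * (v p * v p) - c1 * (y1 * y1) - c3 * (y1 * y0) - c9 * (y1 * y1)) \<le> K1 * (4 * (N * Etot p))"
      using K(1) by (rule mult_left_mono)
    have "2 * z p * S0 p - c1 * (y0 * y0) \<le> N * Etot p" using z 2(5) by linarith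
    then have 4: "K0 * (2 * z p * S0 p - c1 * (y0 * y0)) \<le> K0 * (N * Etot p)" using K(2) by (rule mult_left_mono)
    have "bulk K1 K0 p \<le> 7 * (N * Etot p) + K1 * (4 * (N * Etot p)) + K0 * (N * Etot p)"
      unfolding B using 1 3 4 by linarith
    then have "kp ?r * bulk K1 K0 p \<le> kp ?r * (7 * (N * Etot p) + K1 * (4 * (N * Etot p)) + K0 * (N * Etot p))"
      using kpN by (intro mult_left_mono)
    also have "\<dots> \<le> N / ?r\<^sup>2 * (7 * (N * Etot p) + K1 * (4 * (N * Etot p)) + K0 * (N * Etot p))"
      using kpN N0 K e unfolding E by (intro mult_right_mono) auto
    finally show ?thesis by (simp add: algebra_simps add_divide_distrib)
  qed
qed

end

subsection \<open>Energies on the spheres\<close>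

context sds
begin

lemma edens_eq_edensity:
  assumes F: "smooth_on U (lift \<phi>)" and r: "r > rC" and x: "x \<noteq> 0"
  shows "edens \<Lambda> m \<phi> r t (x /\<^sub>R norm x) = edensity (Yf (lift \<phi>)) (lift \<phi>) (r, t, x)"
proof -
  have D: "D r > 0" using beyond_rC r by simp
  have "d_ang \<phi> i r t (x /\<^sub>R norm x) = norm x * pdiff (dir_x i) (lift \<phi>) (r, t, x)" for i
    using pdiff_x_homogeneous[OF F r x, of "1 / norm x" t 1 i] x lift_scale[of "1 / norm x" \<phi> r t]
    by (simp add: d_ang_eq_pdiff_lift divide_inverse)
  then have grad: "grad_S2_sq \<phi> r t (x /\<^sub>R norm x) = rho2 (r, t, x) * (\<Sum>i\<in>UNIV. (pdiff (dir_x i) (lift \<phi>) (r, t, x))\<^sup>2)"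
    by (simp add: grad_S2_sq_def power_mult_distrib rho2_def dot_square_norm sum_distrib_left)
  have "r\<^sup>2 * D r * (d_r \<phi> r t (x /\<^sub>R norm x))\<^sup>2 = (Yf (lift \<phi>) (r, t, x))\<^sup>2"
    using D by (simp add: Yf_def d_r_eq_pdiff_lift power_mult_distrib)
  moreover have "r\<^sup>2 * (1 / D r) * (d_t \<phi> r t (x /\<^sub>R norm x))\<^sup>2 = (sg r)\<^sup>2 * (pdiff dir_t (lift \<phi>) (r, t, x))\<^sup>2"
    using sg_square[OF r] by (simp add: d_t_eq_pdiff_lift)
  ultimately show ?thesis by (simp add: edens_def edensity_def grad)
qed

text \<open>Fubini's theorem merges the integrals over \<open>t\<close> and the ball. The origin, a
  null set, is removed from the ball because the ray-constant extension is smooth only away from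
  it.\<close>

lemma energy_eq:
  assumes F: "smooth_on U (lift \<phi>)" and r: "r > rC"
  shows "energy \<Lambda> m \<phi> r = ennreal (1 / 2) * (3 *
    (\<integral>\<^sup>+ p. indicator (ball 0 1 - {0}) (snd p) * ennreal (edensity (Yf (lift \<phi>)) (lift \<phi>) (r, p)) \<partial>lborel))"
proof -
  let ?e = "edensity (Yf (lift \<phi>)) (lift \<phi>)"
  let ?h = "\<lambda>p. indicator (ball 0 1 - {0}) (snd p) * ennreal (?e (r, p))"
  have sm: "smooth_on U ?e" by (rule smooth_densities[OF F smooth_Yf[OF F] F smooth_kp])
  have "?h \<in> borel_measurable borel" by (rule measurable_slice[OF sm r])
  then have meas: "?h \<in> borel_measurable (lborel \<Otimes>\<^sub>M lborel)" by (simp add: lborel_prod)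
  have "S2_integral (\<lambda>\<omega>. ennreal (edens \<Lambda> m \<phi> r t \<omega>)) = 3 * (\<integral>\<^sup>+ x. ?h (t, x) \<partial>lborel)" for t
  proof -
    have "AE x in lborel. x \<noteq> (0 :: real^3)" by (rule AE_lborel_singleton)
    then have "AE x in lborel. indicator (ball 0 1) x * ennreal (edens \<Lambda> m \<phi> r t (x /\<^sub>R norm x)) = ?h (t, x)"
    proof eventually_elim
      case (elim x)
      then show ?case using edens_eq_edensity[OF F r elim] by (simp add: indicator_def)
    qed
    then show ?thesis unfolding S2_integral_def by (intro arg_cong[where f="\<lambda>x. 3 * x"] nn_integral_cong_AE)
  qed
  then have "energy \<Lambda> m \<phi> r = ennreal (1 / 2) * (\<integral>\<^sup>+ t. 3 * (\<integral>\<^sup>+ x. ?h (t, x) \<partial>lborel) \<partial>lborel)"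
    by (simp add: energy_def)
  also have "(\<integral>\<^sup>+ t. 3 * (\<integral>\<^sup>+ x. ?h (t, x) \<partial>lborel) \<partial>lborel) = 3 * (\<integral>\<^sup>+ t. (\<integral>\<^sup>+ x. ?h (t, x) \<partial>lborel) \<partial>lborel)"
    by (rule nn_integral_cmult) (rule lborel.borel_measurable_nn_integral_fst[OF meas])
  also have "(\<integral>\<^sup>+ t. (\<integral>\<^sup>+ x. ?h (t, x) \<partial>lborel) \<partial>lborel) = (\<integral>\<^sup>+ p. ?h p \<partial>lborel)"
    using lborel.nn_integral_fst[OF meas] by (simp add: lborel_prod)
  finally show ?thesis .
qed

lemma lift_Xop_Yop: "lift (Xop \<Lambda> m \<phi>) = Xf (lift \<phi>)" "lift (Yop \<Lambda> m \<phi>) = Yf (lift \<phi>)"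
  by (simp_all add: lift_Xop lift_Yop Xf_def[abs_def] Yf_def[abs_def])

lemma wave_solution_lift:
  assumes F: "smooth_on U (lift \<psi>)"
    and wave: "\<And>r t \<omega>. r > rC \<Longrightarrow> norm \<omega> = 1 \<Longrightarrow> wave_op \<Lambda> m \<psi> r t \<omega> = 0"
  shows "wave_solution \<Lambda> m (lift \<psi>)"
proof unfold_locales
  show "smooth_on U (lift \<psi>)" by fact
  show "lift \<psi> (r, t, c *\<^sub>R x) = lift \<psi> (r, t, x)" if "c > 0" for c r t x using that by (rule lift_scale)
  fix p assume p: "p \<in> U"
  obtain r t x where rtx: "p = (r, t, x)" by (cases p)
  have r: "r > rC" and x: "x \<noteq> 0" using p by (auto simp: rtx)
  note pos = beyond_rC[OF r]
  let ?f = "lift \<psi>" and ?\<omega> = "x /\<^sub>R norm x"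
  have "lift (d_t \<psi>) = pdiff dir_t ?f"
    by (auto simp: fun_eq_iff lift_def[of "d_t _"] d_t_eq_pdiff_lift)
  then have tt: "d_t (d_t \<psi>) r t ?\<omega> = pdiff dir_t (pdiff dir_t ?f) p"
    using d_t_eq_pdiff_lift[of "d_t \<psi>" r t x] by (simp add: rtx)
  have rr: "deriv (\<lambda>s. s\<^sup>2 * D s * d_r \<psi> s t ?\<omega>) r = Xf ?f p + r * pdiff dir_r (Xf ?f) p"
  proof -
    have eq: "(\<lambda>s. s\<^sup>2 * D s * d_r \<psi> s t ?\<omega>) = (\<lambda>s. s * Xf ?f (s, t, x))"
      by (simp add: fun_eq_iff d_r_eq_pdiff_lift Xf_def power2_eq_square)
    have "((\<lambda>s. Xf ?f ((0, t, x) + s *\<^sub>R dir_r)) has_real_derivative pdiff dir_r (Xf ?f) ((0, t, x) + r *\<^sub>R dir_r)) (at r)"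
      by (rule smooth_on_has_pdiff_line[OF smooth_Xf[OF F]]) (use r x in \<open>simp_all add: dir_in_Basis\<close>)
    then have "((\<lambda>s. Xf ?f (s, t, x)) has_real_derivative pdiff dir_r (Xf ?f) p) (at r)" by (simp add: rtx)
    from DERIV_mult[OF DERIV_ident this] show ?thesis
      unfolding eq by (intro DERIV_imp_deriv) (simp add: rtx algebra_simps)
  qed
  have lap: "lap_S2 \<psi> r t ?\<omega> = rho2 p * laplace_x ?f p"
  proof -
    have c: "1 / norm x > 0" using x by simp
    have 1: "pdiff (dir_x i) ?f (r, t, (1 / norm x) *\<^sub>R y) = norm x * pdiff (dir_x i) ?f (r, t, y)" if "y \<noteq> 0" for i y
      using pdiff_x_homogeneous[OF F r that c, of t 1 i] lift_scale[OF c] by simp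
    have "pdiff (dir_x i) (pdiff (dir_x i) ?f) (r, t, (1 / norm x) *\<^sub>R x) = (norm x)\<^sup>2 * pdiff (dir_x i) (pdiff (dir_x i) ?f) (r, t, x)" for i
      using pdiff_x_homogeneous[OF smooth_on_pdiff[OF F] r x c, of "dir_x i" t "norm x" i] 1
      by (simp add: power2_eq_square)
    then show ?thesis
      by (simp add: lap_S2_eq_pdiff_lift laplace_x_def rtx rho2_def dot_square_norm sum_distrib_left divide_inverse)
  qed
  have "wave_op \<Lambda> m \<psi> r t ?\<omega> = 0" by (rule wave[OF r]) (use x in simp)
  then have "(1 / D r) * pdiff dir_t (pdiff dir_t ?f) p - (1 / r\<^sup>2) * (Xf ?f p + r * pdiff dir_r (Xf ?f) p)
      + (1 / r\<^sup>2) * (rho2 p * laplace_x ?f p) = 0"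
    unfolding wave_op_def tt rr lap .
  then have "rho2 p * laplace_x ?f p = Xf ?f p + r * pdiff dir_r (Xf ?f) p - r\<^sup>2 / D r * pdiff dir_t (pdiff dir_t ?f) p"
    using pos by (simp add: field_simps)
  then show "rho2 p * laplace_x ?f p = Xf ?f p + fst p * pdiff dir_r (Xf ?f) p
      - (sg (fst p))\<^sup>2 * pdiff dir_t (pdiff dir_t ?f) p"
    by (simp add: rtx sg_square[OF r])
qed

end

context wave_solution
begin

definition "Eint r = (\<integral>\<^sup>+ p. indicator (ball 0 1 - {0}) (snd p) * ennreal (Etot (r, p)) \<partial>lborel)"

text \<open>The three factors come from \<open>Etot \<le> 2 G\<close> at \<open>r2\<close>, from the
  growth of \<open>G\<close> between the radii, and from the upper bound of \<open>G\<close> by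
  \<open>Etot\<close> at \<open>r1\<close>.\<close>

lemma total_energy_bound:
  assumes r0: "rC < r0" and r12: "r0 \<le> r1" "r1 \<le> r2"
    and N: "\<forall>c\<in>set coefficients. \<forall>r\<ge>r0. \<bar>c r\<bar> \<le> N" "N \<ge> 0"
  defines "K1 \<equiv> 2 * N\<^sup>2 + 1" and "K0 \<equiv> N\<^sup>2 + (2 * N\<^sup>2 + 1) * N\<^sup>2 / 2 + 1 / 2"
  defines "C \<equiv> 2 * (N * (7 + 4 * K1 + K0) * N)"
  shows "Eint r2 \<le> ennreal (2 * (exp (C / r0) * (1 + C / r0)\<^sup>2) * (1 + 2 * N + K1 * (1 + N) + K0)) * Eint r1"
proof -
  note est = estimates[OF N(1), folded K1_def K0_def]
  define A where "A = 1 + 2 * N + K1 * (1 + N) + K0"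
  define M where "M = exp (C / r0) * (1 + C / r0)\<^sup>2"
  have K: "K1 \<ge> 0" "K0 \<ge> 0" using N(2) by (auto simp: K1_def K0_def)
  have nn: "C \<ge> 0" "A \<ge> 0" "M \<ge> 0" using K N(2) by (auto simp: C_def A_def M_def)
  have inU: "(r, t, x) \<in> U" if "r \<ge> r0" "x \<noteq> 0" for r t x using that r0 by auto
  have E0: "0 \<le> Etot p" if "p \<in> U" for p
    using edensity_bounds(3)[OF that] by (simp add: Etot_def add_nonneg_nonneg)
  have bound: "c / r\<^sup>2 * Etot (r, t, x) \<le> C / r\<^sup>2 * G K1 K0 (r, t, x)"
    if "2 * c \<le> C" "r \<ge> r0" "x \<noteq> 0" for c r t x
  proof -
    have "c / r\<^sup>2 * Etot (r, t, x) \<le> (C / 2) / r\<^sup>2 * Etot (r, t, x)"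
      using that E0[OF inU[OF that(2,3)]] by (intro mult_right_mono divide_right_mono) auto
    also have "\<dots> \<le> (C / 2) / r\<^sup>2 * (2 * G K1 K0 (r, t, x))"
      using est(1)[OF inU[OF that(2,3)], of t] that nn by (intro mult_left_mono) auto
    finally show ?thesis by simp
  qed
  let ?I = "\<lambda>g r. (\<integral>\<^sup>+ p. indicator (ball 0 1 - {0}) (snd p) * ennreal (g (r, p)) \<partial>lborel)"
  have G0: "0 \<le> G K1 K0 (r, t, x)" if "r \<ge> r0" "x \<noteq> 0" for r t x
    using est(1)[OF inU[OF that], of t] E0[OF inU[OF that], of t] that by simp
  have "?I (G K1 K0) r2 \<le> ennreal M * ?I (G K1 K0) r1"
    unfolding M_def
  proof (rule energy_growth_bound[OF smooth_G(1) smooth_G(2) smooth_G(3) r0 beyond_rC(1)[OF r0] r12 nn(1) G0])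
    fix r t :: real and x :: "real^3" assume rx: "r0 \<le> r" "x \<noteq> 0"
    note p = inU[OF rx, of t]
    show "(\<Sum>i\<in>UNIV. x $ i * J K1 K0 i (r, t, x)) = 0" using tangential_J[OF p] by simp
    have "\<bar>\<Phi> K1 K0 (r, t, x)\<bar> \<le> N * (3 + 2 * K1 + K0) * N / r\<^sup>2 * Etot (r, t, x)"
      using est(3)[OF p] rx by simp
    also have "\<dots> \<le> C / r\<^sup>2 * G K1 K0 (r, t, x)"
      \<comment> \<open>The flux constant has \<open>3 + 2 K1 + K0\<close> where the bulk constant
        has \<open>7 + 4 K1 + K0\<close>, so a single \<open>C\<close> serves both.\<close>
      using K N(2) rx by (intro bound) (auto simp: C_def intro!: mult_mono)
    finally show "\<bar>\<Phi> K1 K0 (r, t, x)\<bar> \<le> C / r\<^sup>2 * G K1 K0 (r, t, x)" .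
    have "kp r * bulk K1 K0 (r, t, x) \<le> N * (7 + 4 * K1 + K0) * N / r\<^sup>2 * Etot (r, t, x)"
      using est(4)[OF p] rx by simp
    also have "\<dots> \<le> C / r\<^sup>2 * G K1 K0 (r, t, x)"
      using rx by (intro bound) (auto simp: C_def)
    finally show "pdiff dir_r (G K1 K0) (r, t, x) \<le> pdiff dir_t (\<Phi> K1 K0) (r, t, x)
        + (\<Sum>i\<in>UNIV. pdiff (dir_x i) (J K1 K0 i) (r, t, x)) + C / r\<^sup>2 * G K1 K0 (r, t, x)"
      unfolding pdiff_r_G[OF p] by simp
  qed
  moreover have "Eint r2 \<le> ennreal 2 * ?I (G K1 K0) r2"
  proof -
    have "Eint r2 \<le> (\<integral>\<^sup>+ p. ennreal 2 * (indicator (ball 0 1 - {0}) (snd p) * ennreal (G K1 K0 (r2, p))) \<partial>lborel)"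
      unfolding Eint_def
    proof (rule nn_integral_mono)
      fix p :: "real \<times> (real^3)"
      obtain t x where p: "p = (t, x)" by (cases p)
      show "indicator (ball 0 1 - {0}) (snd p) * ennreal (Etot (r2, p))
          \<le> ennreal 2 * (indicator (ball 0 1 - {0}) (snd p) * ennreal (G K1 K0 (r2, p)))"
      proof (cases "x \<in> ball 0 1 - {0}")
        case True
        then have "Etot (r2, p) \<le> 2 * G K1 K0 (r2, p)" using est(1)[OF inU] r12 by (simp add: p)
        then have "ennreal (Etot (r2, p)) \<le> ennreal 2 * ennreal (G K1 K0 (r2, p))"
          by (simp add: ennreal_mult'[symmetric] ennreal_leI del: ennreal_numeral)
        then show ?thesis using True by (simp add: p)
      qed (simp add: p)
    qed
    also have "\<dots> = ennreal 2 * ?I (G K1 K0) r2"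
      using measurable_slice[OF smooth_G(1)] r0 r12 by (intro nn_integral_cmult) simp
    finally show ?thesis .
  qed
  moreover have "?I (G K1 K0) r1 \<le> ennreal A * Eint r1"
  proof -
    have "?I (G K1 K0) r1 \<le> (\<integral>\<^sup>+ p. ennreal A * (indicator (ball 0 1 - {0}) (snd p) * ennreal (Etot (r1, p))) \<partial>lborel)"
    proof (rule nn_integral_mono)
      fix p :: "real \<times> (real^3)"
      obtain t x where p: "p = (t, x)" by (cases p)
      show "indicator (ball 0 1 - {0}) (snd p) * ennreal (G K1 K0 (r1, p))
          \<le> ennreal A * (indicator (ball 0 1 - {0}) (snd p) * ennreal (Etot (r1, p)))"
      proof (cases "x \<in> ball 0 1 - {0}")
        case True
        then have "G K1 K0 (r1, p) \<le> A * Etot (r1, p)" using est(2)[OF inU] r12 by (simp add: p A_def)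
        then have "ennreal (G K1 K0 (r1, p)) \<le> ennreal A * ennreal (Etot (r1, p))"
          using nn by (simp add: ennreal_mult'[symmetric] ennreal_leI)
        then show ?thesis using True by (simp add: p)
      qed (simp add: p)
    qed
    also have "\<dots> = ennreal A * Eint r1"
      unfolding Eint_def using measurable_slice[OF smooth_G(4)] r0 r12 by (intro nn_integral_cmult) simp
    finally show ?thesis .
  qed
  ultimately have "Eint r2 \<le> ennreal 2 * (ennreal M * (ennreal A * Eint r1))"
    by (meson mult_left_mono order_trans zero_le)
  also have "\<dots> = ennreal (2 * M * A) * Eint r1"
    using nn by (simp add: ennreal_mult mult.assoc)
  finally show ?thesis by (simp add: M_def A_def)
qed

lemma sum_of_energies:
  assumes "r > rC"
  shows "(\<integral>\<^sup>+ p. indicator (ball 0 1 - {0}) (snd p) * ennreal (edensity (Yf v) v (r, p)) \<partial>lborel)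
     + (\<integral>\<^sup>+ p. indicator (ball 0 1 - {0}) (snd p) * ennreal (edensity (Yf u) u (r, p)) \<partial>lborel)
     + (\<integral>\<^sup>+ p. indicator (ball 0 1 - {0}) (snd p) * ennreal (edensity (Yf f) f (r, p)) \<partial>lborel) = Eint r"
proof -
  have meas: "(\<lambda>p. indicator (ball 0 1 - {0}) (snd p) * ennreal (edensity (Yf g) g (r, p))) \<in> borel_measurable borel"
    if "smooth_on U g" for g
    by (rule measurable_slice[OF _ assms]) (rule smooth_densities[OF that smooth_Yf[OF that] that smooth_kp])
  note meas' = meas[OF smooth_v] meas[OF smooth_u] meas[OF smooth_f]
  have "Eint r = (\<integral>\<^sup>+ p. (indicator (ball 0 1 - {0}) (snd p) * ennreal (edensity (Yf v) v (r, p))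
     + indicator (ball 0 1 - {0}) (snd p) * ennreal (edensity (Yf u) u (r, p)))
     + indicator (ball 0 1 - {0}) (snd p) * ennreal (edensity (Yf f) f (r, p)) \<partial>lborel)"
    unfolding Eint_def
  proof (rule nn_integral_cong)
    fix p :: "real \<times> (real^3)"
    obtain t x where p: "p = (t, x)" by (cases p)
    show "indicator (ball 0 1 - {0}) (snd p) * ennreal (Etot (r, p)) =
       (indicator (ball 0 1 - {0}) (snd p) * ennreal (edensity (Yf v) v (r, p))
       + indicator (ball 0 1 - {0}) (snd p) * ennreal (edensity (Yf u) u (r, p)))
       + indicator (ball 0 1 - {0}) (snd p) * ennreal (edensity (Yf f) f (r, p))"
    proof (cases "x \<in> ball 0 1 - {0}")
      case True
      then have pU: "(r, p) \<in> U" using assms by (simp add: p)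
      have "Yf f (r, p) = z (r, p)" using Xf_eq[OF pU, of f] by (simp add: z_def u_def)
      then have "edensity (Yf f) f (r, p) = edensity z f (r, p)" by (simp add: edensity_def)
      then have "ennreal (Etot (r, p)) = ennreal (edensity (Yf v) v (r, p)) + ennreal (edensity (Yf u) u (r, p))
          + ennreal (edensity (Yf f) f (r, p))"
        using edensity_bounds(3)[OF pU] by (simp add: Etot_def w_def v_def[symmetric] ennreal_plus add_nonneg_nonneg)
      then show ?thesis using True by (simp add: p)
    qed (simp add: p)
  qed
  also have "\<dots> = (\<integral>\<^sup>+ p. indicator (ball 0 1 - {0}) (snd p) * ennreal (edensity (Yf v) v (r, p)) \<partial>lborel)
     + (\<integral>\<^sup>+ p. indicator (ball 0 1 - {0}) (snd p) * ennreal (edensity (Yf u) u (r, p)) \<partial>lborel)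
     + (\<integral>\<^sup>+ p. indicator (ball 0 1 - {0}) (snd p) * ennreal (edensity (Yf f) f (r, p)) \<partial>lborel)"
    using meas' by (simp add: nn_integral_add)
  finally show ?thesis ..
qed

end

theorem theorem1p6:
  fixes \<Lambda> m r0 :: real
  assumes "\<Lambda> > 0" and "m > 0" and "3 * m < 1 / sqrt \<Lambda>"
    and "r0 > SdS_rC \<Lambda> m"
  shows "\<exists>C>0. \<forall>\<psi> :: sfun.
           smooth_on (region \<Lambda> m) (lift \<psi>) \<longrightarrow>
           (\<forall>r t \<omega>. r > SdS_rC \<Lambda> m \<longrightarrow> norm \<omega> = 1 \<longrightarrow> wave_op \<Lambda> m \<psi> r t \<omega> = 0) \<longrightarrow>
           (\<forall>r1 r2. r0 \<le> r1 \<longrightarrow> r1 < r2 \<longrightarrow>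
              energy \<Lambda> m (Yop \<Lambda> m (Xop \<Lambda> m \<psi>)) r2 + energy \<Lambda> m (Xop \<Lambda> m \<psi>) r2
                + energy \<Lambda> m \<psi> r2
              \<le> ennreal C * (energy \<Lambda> m (Yop \<Lambda> m (Xop \<Lambda> m \<psi>)) r1
                + energy \<Lambda> m (Xop \<Lambda> m \<psi>) r1 + energy \<Lambda> m \<psi> r1))"
proof -
  interpret sds \<Lambda> m using assms by unfold_locales
  obtain N where N: "N \<ge> 0" "\<forall>c\<in>set coefficients. \<forall>r\<ge>r0. \<bar>c r\<bar> \<le> N"
    using bounded_coefficients[OF assms(4)] by blast
  define K1 where "K1 = 2 * N\<^sup>2 + 1"
  define K0 where "K0 = N\<^sup>2 + (2 * N\<^sup>2 + 1) * N\<^sup>2 / 2 + 1 / 2"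
  define B where "B = 2 * (N * (7 + 4 * K1 + K0) * N)"
  \<comment> \<open>\<open>C\<close> is built from \<open>N\<close> and \<open>r0\<close> before any
    solution is fixed, which makes the estimate uniform in \<psi>.\<close>
  define C where "C = 2 * (exp (B / r0) * (1 + B / r0)\<^sup>2) * (1 + 2 * N + K1 * (1 + N) + K0)"
  have K: "K1 \<ge> 0" "K0 \<ge> 0" using N by (auto simp: K1_def K0_def)
  then have "B \<ge> 0" using N by (simp add: B_def)
  then have "1 + B / r0 > 0" using beyond_rC(1)[OF assms(4)] by (simp add: add_pos_nonneg)
  moreover have "1 + 2 * N + K1 * (1 + N) + K0 > 0" using K N by (simp add: add_pos_nonneg)
  ultimately have "C > 0" by (simp add: C_def)
  show ?thesis
  proof (intro exI[of _ C] conjI allI impI)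
    show "C > 0" by fact
    fix \<psi> :: sfun and r1 r2 :: real
    assume F: "smooth_on (region \<Lambda> m) (lift \<psi>)"
      and wave: "\<forall>r t \<omega>. r > SdS_rC \<Lambda> m \<longrightarrow> norm \<omega> = 1 \<longrightarrow> wave_op \<Lambda> m \<psi> r t \<omega> = 0"
      and r12: "r0 \<le> r1" "r1 < r2"
    have F': "smooth_on U (lift \<psi>)" using F by (simp add: region_def)
    interpret wave_solution \<Lambda> m "lift \<psi>"
      by (rule wave_solution_lift[OF F']) (use wave in blast)
    have lifts: "lift (Xop \<Lambda> m \<psi>) = u" "lift (Yop \<Lambda> m (Xop \<Lambda> m \<psi>)) = v"
      by (simp_all add: lift_Xop_Yop u_def v_def)
    have energies: "energy \<Lambda> m (Yop \<Lambda> m (Xop \<Lambda> m \<psi>)) r + energy \<Lambda> m (Xop \<Lambda> m \<psi>) r + energy \<Lambda> m \<psi> r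
        = ennreal (1 / 2) * (3 * Eint r)" if r: "r > rC" for r
    proof -
      note e = energy_eq[OF _ r, of "Yop \<Lambda> m (Xop \<Lambda> m \<psi>)", unfolded lifts, OF smooth_v]
        energy_eq[OF _ r, of "Xop \<Lambda> m \<psi>", unfolded lifts, OF smooth_u] energy_eq[OF F' r]
      show ?thesis unfolding e distrib_left[symmetric] sum_of_energies[OF r] ..
    qed
    have "ennreal (1 / 2) * (3 * Eint r2) \<le> ennreal (1 / 2) * (3 * (ennreal C * Eint r1))"
      using total_energy_bound[OF assms(4) r12(1) less_imp_le[OF r12(2)] N(2,1)]
      unfolding C_def B_def K0_def K1_def by (rule mult_left_mono[OF mult_left_mono]) simp_all
    also have "\<dots> = ennreal C * (ennreal (1 / 2) * (3 * Eint r1))" by (simp add: mult_ac)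
    finally show "energy \<Lambda> m (Yop \<Lambda> m (Xop \<Lambda> m \<psi>)) r2 + energy \<Lambda> m (Xop \<Lambda> m \<psi>) r2 + energy \<Lambda> m \<psi> r2
        \<le> ennreal C * (energy \<Lambda> m (Yop \<Lambda> m (Xop \<Lambda> m \<psi>)) r1 + energy \<Lambda> m (Xop \<Lambda> m \<psi>) r1 + energy \<Lambda> m \<psi> r1)"
      using energies[of r1] energies[of r2] r12 assms(4) by (simp only:)
  qed
qed

end
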